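(* Let $X=(X_1,\dots,X_n)$ be an isotropic, one-unconditional, log-concave random vector in $\mathbb{R}^n$. Let $T\subset\mathbb{R}^n$ be a finite set in simplified form (with parameters $p,\delta,\rho$, numbers $k_1,\dots,k_n$ and function $f$ as below), and suppose that the class $\{I(t):t\in T\}$ of subsets of $\{1,\dots,n\}$ is of VC dimension $v$ (so $v\le cp$). Suppose that $|T|\ge\exp(f(p))$, where $f(p)=Cv\log(1+p)$ and $C$ is sufficiently large. Suppose that for each $t\in T$ the common witness exists, i.e. $$\Bigl\|\min_{s\in S(t)}\Bigl|\sum_{i\in I(t)\setminus I(s)}k_i1_{k_i>4\rho}X_i\Bigr|\Bigr\|_p\ge \bar C^{-1}p ,$$ where $\bar C$ is a universal constant. Then the following Sudakov minoration holds: $$\mathbf{E}\sup_{t\in T}\ \sup_{s\in S(t)}\Bigl|\sum_{i\in I(t)\setminus I(s)}t_iX_i\Bigr|\ge K^{-1}p$$ for a universal constant $K$. In particular, if $v\le \frac{p}{\log(1+p)}$, then $f(p)=Cp$ (i.e. the cardinality condition is $|T|\ge\exp(Cp)$).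
   Context: Isotropic: $\mathbf{E}X_i=0$ and $\mathbf{E}X_iX_j=\delta_{i,j}$ for all $i,j$. One-unconditional: $(\eta_1X_1,\dots,\eta_nX_n)$ has the same distribution as $X$ for every choice of signs $\eta_i\in\{-1,1\}$. Log-concave: the law $\mu$ of $X$ satisfies $\mu(\lambda A+(1-\lambda)B)\ge\mu(A)^\lambda\mu(B)^{1-\lambda}$ for non-empty measurable $A,B$ and $0<\lambda<1$. For $t\in\mathbb{R}^n$: $X_t=\sum_i t_iX_i$ and $I(t)=\{i:\ |t_i|>0\}$. For a real random variable $Y$, $\|Y\|_p=(\mathbf{E}|Y|^p)^{1/p}$. Simplified form of $T$: for a suitably small $\delta$, a sufficiently large integer $p$, and $\rho\le e^{-1}$ with $\rho/\log\frac1\rho=4C_0\delta$ ($C_0\ge1$ an absolute constant), there are numbers $k_i\ge\rho$, $i=1,\dots,n$, such that: (1) $|T|\ge\exp(-\frac34p+f(p))$ and $0\in T$; (2) for every $t\in T$ and every $i$, $t_i\in((k_i-2\rho)_+,k_i)\cup\{0\}$; (3) $\sum_{i=1}^n k_i1_{t_i\ne0}\le 2C_0\delta p$ for every $t\in T$; (4) $\|X_t-X_s\|_p\ge p/2$ for all $s,t\in T$, $s\neq t$. For such $T$ one has $|I(t)|\le cp$ for all $t\in T$, where $c$ is a sufficiently small absolute constant; this is the $c$ in $v\le cp$. For $t\in T$, $S(t)=\{s\in T:\ \|\sum_{i\in I(t)\setminus I(s)}k_i1_{k_i>4\rho}X_i\|_p\ge \frac p8\}$; a minimum over an empty $S(t)$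 (e.g. for $t=0$) is read as $+\infty$, and the supremum in the conclusion is over pairs $t\in T$, $s\in S(t)$. The VC dimension of a class of subsets of $\{1,\dots,n\}$ is $v$ if $v$ is the largest cardinality of a subset of $\{1,\dots,n\}$ shattered by the class.
   Formalization: f(p) is taken as Cp when v ≤ p/log(1+p) and as Cv log(1+p) otherwise, since with f(p)=Cv log(1+p) alone the claim fails (e.g. v=1, independent Laplace coordinates, about (1+p)^C multiples of unit vectors); X is defined on a sample space of real sequences, which realizes every law. *)

theory Defs
  imports "HOL-Probability.Probability"
begin

text \<open>
  The dimension \<open>n\<close> varies while the universal constants do not, so \<open>\<real>\<^sup>n\<close> is the product
  space of extensional functions on \<open>{1..n}\<close> rather than a type indexed by \<open>'n\<close>.
\<close>

definition Rn :: "nat \<Rightarrow> (nat \<Rightarrow> real) measure" where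
  "Rn n = (\<Pi>\<^sub>M i\<in>{1..n}. borel)"

definition random_vector :: "nat \<Rightarrow> 'a measure \<Rightarrow> ('a \<Rightarrow> nat \<Rightarrow> real) \<Rightarrow> bool" where
  "random_vector n M X \<longleftrightarrow> prob_space M \<and> X \<in> measurable M (Rn n)"

definition law :: "nat \<Rightarrow> 'a measure \<Rightarrow> ('a \<Rightarrow> nat \<Rightarrow> real) \<Rightarrow> (nat \<Rightarrow> real) measure" where
  "law n M X = distr M (Rn n) X"

text \<open>
  Although the Bochner integral of a non-integrable function is 0, no integrability assumption is
  missing: \<open>E X\<^sub>i\<^sup>2 = 1\<close> forces \<open>X\<^sub>i\<close> to be square integrable, hence all the integrals exist.
\<close>

definition isotropic :: "nat \<Rightarrow> 'a measure \<Rightarrow> ('a \<Rightarrow> nat \<Rightarrow> real) \<Rightarrow> bool" where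
  "isotropic n M X \<longleftrightarrow>
     (\<forall>i\<in>{1..n}. (\<integral>\<omega>. X \<omega> i \<partial>M) = 0) \<and>
     (\<forall>i\<in>{1..n}. \<forall>j\<in>{1..n}. (\<integral>\<omega>. X \<omega> i * X \<omega> j \<partial>M) = (if i = j then 1 else 0))"

definition one_unconditional :: "nat \<Rightarrow> 'a measure \<Rightarrow> ('a \<Rightarrow> nat \<Rightarrow> real) \<Rightarrow> bool" where
  "one_unconditional n M X \<longleftrightarrow>
     (\<forall>\<eta>. (\<forall>i\<in>{1..n}. \<eta> i \<in> {-1, 1}) \<longrightarrow>
        law n M (\<lambda>\<omega>. \<lambda>i\<in>{1..n}. \<eta> i * X \<omega> i) = law n M X)"

definition minkowski_comb ::
    "nat \<Rightarrow> real \<Rightarrow> (nat \<Rightarrow> real) set \<Rightarrow> (nat \<Rightarrow> real) set \<Rightarrow> (nat \<Rightarrow> real) set" where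
  "minkowski_comb n l A B = {(\<lambda>i\<in>{1..n}. l * a i + (1 - l) * b i) | a b. a \<in> A \<and> b \<in> B}"

text \<open>
  The Minkowski combination of two Borel sets need not be Borel, and \<open>measure\<close> is 0 on
  non-measurable sets, so the inequality is only required where its left-hand side is meaningful.
  This includes all compact \<open>A\<close>, \<open>B\<close>, from which the inequality for all Borel \<open>A\<close>, \<open>B\<close> (with
  the completed measure on the left) follows by inner regularity.
\<close>

definition log_concave_measure :: "nat \<Rightarrow> (nat \<Rightarrow> real) measure \<Rightarrow> bool" where
  "log_concave_measure n \<mu> \<longleftrightarrow>
     (\<forall>A\<in>sets (Rn n). \<forall>B\<in>sets (Rn n). \<forall>l. A \<noteq> {} \<longrightarrow> B \<noteq> {} \<longrightarrow> 0 < l \<longrightarrow> l < 1 \<longrightarrow>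
        minkowski_comb n l A B \<in> sets (Rn n) \<longrightarrow>
        measure \<mu> (minkowski_comb n l A B) \<ge> measure \<mu> A powr l * measure \<mu> B powr (1 - l))"

text \<open>
  \<open>p\<close>-th norm of a \<open>[0,\<infinity>]\<close>-valued variable; the norm of a real variable \<open>Y\<close> is obtained from
  \<open>\<lambda>\<omega>. ennreal \<bar>Y \<omega>\<bar>\<close>. The value \<open>\<infinity>\<close> is needed for minima over empty sets.
\<close>

definition Lp_norm :: "'a measure \<Rightarrow> nat \<Rightarrow> ('a \<Rightarrow> ennreal) \<Rightarrow> ennreal" where
  "Lp_norm M p Y =
     (let m = \<integral>\<^sup>+ \<omega>. Y \<omega> ^ p \<partial>M in if m = \<infinity> then \<infinity> else ennreal (root p (enn2real m)))"

definition lin_comb :: "nat set \<Rightarrow> (nat \<Rightarrow> real) \<Rightarrow> (nat \<Rightarrow> real) \<Rightarrow> real" where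
  "lin_comb J a x = (\<Sum>i\<in>J. a i * x i)"

definition supp :: "nat \<Rightarrow> (nat \<Rightarrow> real) \<Rightarrow> nat set" where
  "supp n t = {i\<in>{1..n}. \<bar>t i\<bar> > 0}"

definition shatters :: "nat set set \<Rightarrow> nat set \<Rightarrow> bool" where
  "shatters F S \<longleftrightarrow> (\<forall>B\<subseteq>S. \<exists>A\<in>F. A \<inter> S = B)"

definition has_vc_dim :: "nat \<Rightarrow> nat set set \<Rightarrow> nat \<Rightarrow> bool" where
  "has_vc_dim n F v \<longleftrightarrow>
     (\<exists>S\<subseteq>{1..n}. shatters F S \<and> card S = v) \<and>
     (\<forall>S\<subseteq>{1..n}. shatters F S \<longrightarrow> card S \<le> v)"

text \<open>
  The function \<open>f\<close>: it is \<open>C v log (1 + p)\<close>, except that for \<open>v \<le> p / log (1 + p)\<close> it is \<open>C p\<close>;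
  that is, \<open>f p = C max {p, v log (1 + p)}\<close>.  Without the second clause the minoration fails
  already for \<open>v = 1\<close> (multiples of about \<open>(1 + p)\<^sup>C\<close> unit vectors, independent Laplace \<open>X\<^sub>i\<close>).
\<close>

definition card_exponent :: "real \<Rightarrow> nat \<Rightarrow> nat \<Rightarrow> real" where
  "card_exponent C v p =
     (if real v \<le> real p / ln (1 + real p) then C * real p else C * real v * ln (1 + real p))"

definition simplified_form ::
    "nat \<Rightarrow> 'a measure \<Rightarrow> ('a \<Rightarrow> nat \<Rightarrow> real) \<Rightarrow> real \<Rightarrow> real \<Rightarrow> real \<Rightarrow> nat \<Rightarrow> (nat \<Rightarrow> real) \<Rightarrow>
     (nat \<Rightarrow> real) \<Rightarrow> (nat \<Rightarrow> real) set \<Rightarrow> bool" where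
  "simplified_form n M X C0 \<delta> \<rho> p k f T \<longleftrightarrow>
     0 < \<rho> \<and> \<rho> \<le> exp (-1) \<and> \<rho> / ln (1 / \<rho>) = 4 * C0 * \<delta> \<and>
     (\<forall>i\<in>{1..n}. k i \<ge> \<rho>) \<and>
     finite T \<and> T \<subseteq> space (Rn n) \<and>
     real (card T) \<ge> exp (- (3 / 4) * real p + f p) \<and> (\<lambda>i\<in>{1..n}. 0) \<in> T \<and>
     (\<forall>t\<in>T. \<forall>i\<in>{1..n}. t i \<in> {max 0 (k i - 2 * \<rho>)<..<k i} \<union> {0}) \<and>
     (\<forall>t\<in>T. (\<Sum>i\<in>{1..n}. k i * of_bool (t i \<noteq> 0)) \<le> 2 * C0 * \<delta> * real p) \<and>
     (\<forall>t\<in>T. \<forall>s\<in>T. s \<noteq> t \<longrightarrow>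
        Lp_norm M p (\<lambda>\<omega>. ennreal \<bar>lin_comb {1..n} t (X \<omega>) - lin_comb {1..n} s (X \<omega>)\<bar>)
          \<ge> ennreal (real p / 2))"

definition big_part :: "real \<Rightarrow> (nat \<Rightarrow> real) \<Rightarrow> nat \<Rightarrow> real" where
  "big_part \<rho> k i = k i * of_bool (k i > 4 * \<rho>)"

definition far_set ::
    "nat \<Rightarrow> 'a measure \<Rightarrow> ('a \<Rightarrow> nat \<Rightarrow> real) \<Rightarrow> real \<Rightarrow> nat \<Rightarrow> (nat \<Rightarrow> real) \<Rightarrow>
     (nat \<Rightarrow> real) set \<Rightarrow> (nat \<Rightarrow> real) \<Rightarrow> (nat \<Rightarrow> real) set" where
  "far_set n M X \<rho> p k T t =
     {s\<in>T. Lp_norm M p (\<lambda>\<omega>. ennreal \<bar>lin_comb (supp n t - supp n s) (big_part \<rho> k) (X \<omega>)\<bar>)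
              \<ge> ennreal (real p / 8)}"

definition common_witness ::
    "nat \<Rightarrow> 'a measure \<Rightarrow> ('a \<Rightarrow> nat \<Rightarrow> real) \<Rightarrow> real \<Rightarrow> real \<Rightarrow> nat \<Rightarrow> (nat \<Rightarrow> real) \<Rightarrow>
     (nat \<Rightarrow> real) set \<Rightarrow> (nat \<Rightarrow> real) \<Rightarrow> bool" where
  "common_witness n M X Cbar \<rho> p k T t \<longleftrightarrow>
     Lp_norm M p (\<lambda>\<omega>. INF s\<in>far_set n M X \<rho> p k T t.
         ennreal \<bar>lin_comb (supp n t - supp n s) (big_part \<rho> k) (X \<omega>)\<bar>)
       \<ge> ennreal (real p / Cbar)"

end

theory Submission
  imports Defs
begin

text \<open>
  Smoothing \<open>X\<close> by a uniform vector on a cube gives a log-concave unconditional density that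
  decreases in each \<open>\<bar>x i\<bar>\<close>. The Prekopa-Leindler inequality in the coordinates \<open>sqrt \<bar>x i\<bar>\<close> then holds
  with a gain: if every point of \<open>Y\<close> exceeds every point of \<open>B\<close> by a factor 16 in at least \<open>j\<close>
  coordinates, then \<open>P Y * P B \<le> (16/25) ^ j\<close>. Iterating this over dyadic levels shows that a sum of at
  most \<open>p\<close> coordinates has \<open>p\<close>-th norm of order \<open>p\<close>, hence any two points of \<open>T\<close> are far apart in the
  sense of \<open>far_set\<close> in at least one direction.

  Suppose the supremum is small. For most \<open>x\<close> it is then small after at least half of the sign
  changes of \<open>x\<close>; let \<open>B\<close> be the set of these \<open>x\<close>. For each \<open>y\<close> consider the \<open>t \<in> T\<close> for which all sums over
  \<open>I t - I s\<close>, \<open>s \<in> S t\<close>, of the coefficients times \<open>\<bar>y i\<bar>\<close> are of order \<open>p\<close>. By the common witness and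
  log-concavity, each \<open>t\<close> has this property with probability at least \<open>exp (- 4 p)\<close>. If \<open>y\<close> exceeds
  16 times some point of \<open>B\<close> only on a set \<open>J\<close> of at most \<open>j\<close> coordinates, there are at most
  \<open>(j + 1) ^ v\<close> traces \<open>I t \<inter> J\<close> by the Sauer-Shelah lemma, and those \<open>t\<close> with a common trace are so
  separated off \<open>J\<close> that, by counting signs, there are at most \<open>2 ^ (p + 1)\<close> of them. With \<open>j\<close> a multiple
  of \<open>p\<close>, the gain makes all other \<open>y\<close> negligible, so \<open>T\<close> cannot have the assumed cardinality.
\<close>

section \<open>Traces of set systems and sign patterns\<close>

text \<open>The Prekopa-Leindler inequality alone bounds \<open>P Y * P B\<close> only by 1. The
  gain is a Jacobian: under \<open>x = a ^ 2\<close> the factor \<open>2 * a\<close>, taken at the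
  mean of \<open>a\<close> and \<open>b\<close>, exceeds the geometric mean of its values at
  \<open>a\<close> and \<open>b\<close>. A density that decreases in each absolute value does not
  lose this again, since the squared mean of the roots is at most the arithmetic mean. A factor 16
  between coordinates is a factor 4 between roots, whence
  \<open>25/16 = (4 + 1) ^ 2 / (4 * 4)\<close>. Every coordinate may use either mean, so one
  inequality yields the squaring of tails (arithmetic means), the decay of orthants (mixed means)
  and the comparison of \<open>Y\<close> with \<open>B\<close> (square roots).

  The supremum consists of signed sums, whereas \<open>y\<close> is tested through absolute values;
  the signs connect the two. Turning the signs on \<open>I t\<close> so that all terms become
  positive makes the sums over \<open>I t - I s\<close> large, and a sign vector that keeps the sums
  small cannot agree with this choice on \<open>I t - I s\<close>.

  The rate \<open>exp (- 4 * p)\<close> comes from moments: started there, squared tails beat the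
  growth of dyadic levels to the power \<open>p\<close>.\<close>

text \<open>Pajor's form of the Sauer-Shelah lemma. Splitting by membership of \<open>x\<close> and
  deleting \<open>x\<close> gives two families on \<open>J\<close>; a set shattered by both is
  counted twice, and it also yields two shattered sets, itself and the set with \<open>x\<close>
  inserted.\<close>

lemma card_le_card_shattered:
  assumes "finite J" "F \<subseteq> Pow J"
  shows "card F \<le> card {S. S \<subseteq> J \<and> shatters F S}"
  using assms
proof (induction J arbitrary: F rule: finite_induct)
  case empty
  show ?case
  proof (cases "F = {}")
    case False
    then have F: "F = {{}}" using empty by auto
    have "{S. S \<subseteq> {} \<and> shatters F S} = {{}}" by (auto simp: F shatters_def)
    then show ?thesis by (simp add: F)
  qed simp
next
  case ins: (insert x J)
  define F1 where "F1 = {A \<in> F. x \<notin> A}"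
  define F2 where "F2 = (\<lambda>A. A - {x}) ` {A \<in> F. x \<in> A}"
  let ?Sh = "\<lambda>F. {S. S \<subseteq> J \<and> shatters F S}"
  have sub: "F1 \<subseteq> Pow J" "F2 \<subseteq> Pow J" using ins by (auto simp: F1_def F2_def)
  have fin: "finite (?Sh F1)" "finite (?Sh F2)" using ins by auto
  have "finite F" using ins.prems ins.hyps by (meson finite_Pow_iff finite_insert finite_subset)
  have "card F = card F1 + card {A \<in> F. x \<in> A}"
    unfolding F1_def using \<open>finite F\<close> by (subst card_Un_disjoint[symmetric]) (auto intro!: arg_cong[where f=card])
  also have "card {A \<in> F. x \<in> A} = card F2"
    unfolding F2_def by (rule card_image[symmetric]) (auto simp: inj_on_def)
  also have "card F1 + card F2 \<le> card (?Sh F1) + card (?Sh F2)"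
    by (intro add_mono ins.IH sub)
  also have "\<dots> = card (?Sh F1 \<union> ?Sh F2) + card (?Sh F1 \<inter> ?Sh F2)"
    by (rule card_Un_Int[OF fin])
  also have "card (?Sh F1 \<inter> ?Sh F2) = card (insert x ` (?Sh F1 \<inter> ?Sh F2))"
    by (rule card_image[symmetric]) (use ins.hyps in \<open>auto simp: inj_on_def\<close>)
  also have "card (?Sh F1 \<union> ?Sh F2) + \<dots> = card ((?Sh F1 \<union> ?Sh F2) \<union> insert x ` (?Sh F1 \<inter> ?Sh F2))"
    by (rule card_Un_disjoint[symmetric]) (use fin ins.hyps in auto)
  also have "\<dots> \<le> card {S. S \<subseteq> insert x J \<and> shatters F S}"
  proof (rule card_mono)
    show "finite {S. S \<subseteq> insert x J \<and> shatters F S}" using ins by auto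
    have 1: "shatters F S" if "S \<subseteq> J" "shatters F1 S" for S
      using that unfolding shatters_def F1_def by blast
    have 2: "shatters F S" if S: "S \<subseteq> J" "shatters F2 S" for S
      unfolding shatters_def
    proof (intro allI impI)
      fix B assume "B \<subseteq> S"
      then obtain A where A: "A \<in> F" "x \<in> A" "(A - {x}) \<inter> S = B"
        using S unfolding shatters_def F2_def by blast
      moreover have "x \<notin> S" using S ins.hyps by auto
      ultimately show "\<exists>A\<in>F. A \<inter> S = B" by (intro bexI[of _ A]) auto
    qed
    have 3: "shatters F (insert x S)" if S: "S \<subseteq> J" "shatters F1 S" "shatters F2 S" for S
      unfolding shatters_def
    proof (intro allI impI)
      fix B assume B: "B \<subseteq> insert x S"
      have xS: "x \<notin> S" using S ins.hyps by auto
      have B': "B - {x} \<subseteq> S" using B by auto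
      show "\<exists>A\<in>F. A \<inter> insert x S = B"
      proof (cases "x \<in> B")
        case True
        obtain A where A: "A \<in> F" "x \<in> A" "(A - {x}) \<inter> S = B - {x}"
          using S(3) B' unfolding shatters_def F2_def by blast
        then show ?thesis using True xS by (intro bexI[of _ A]) auto
      next
        case False
        obtain A where A: "A \<in> F" "x \<notin> A" "A \<inter> S = B - {x}"
          using S(2) B' unfolding shatters_def F1_def by blast
        then show ?thesis using False by (intro bexI[of _ A]) auto
      qed
    qed
    show "(?Sh F1 \<union> ?Sh F2) \<union> insert x ` (?Sh F1 \<inter> ?Sh F2) \<subseteq> {S. S \<subseteq> insert x J \<and> shatters F S}"
      using 1 2 3 by auto
  qed
  finally show ?case .
qed

text \<open>A set with at most \<open>v\<close> elements is a union of \<open>v\<close> sets, each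
  empty or a singleton from \<open>J\<close>, so every step multiplies the count by at most
  \<open>card J + 1\<close>.\<close>

lemma card_subsets_card_le:
  assumes "finite J" shows "card {S. S \<subseteq> J \<and> card S \<le> v} \<le> (card J + 1) ^ v"
proof (induction v)
  case 0
  have "{S. S \<subseteq> J \<and> card S \<le> 0} \<subseteq> {{}}"
    using finite_subset[OF _ assms] by (auto simp: card_eq_0_iff)
  then have "card {S. S \<subseteq> J \<and> card S \<le> 0} \<le> card {{} :: 'a set}" by (rule card_mono[rotated]) simp
  then show ?case by simp
next
  case (Suc v)
  let ?P = "{S. S \<subseteq> J \<and> card S \<le> v}" and ?E = "insert {} ((\<lambda>x. {x}) ` J)"
  have fin: "finite ?P" "finite ?E" using assms by auto
  have "{S. S \<subseteq> J \<and> card S \<le> Suc v} \<subseteq> (\<lambda>(S, E). S \<union> E) ` (?P \<times> ?E)"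
  proof
    fix S assume "S \<in> {S. S \<subseteq> J \<and> card S \<le> Suc v}"
    then have S: "S \<subseteq> J" "card S \<le> Suc v" by auto
    show "S \<in> (\<lambda>(S, E). S \<union> E) ` (?P \<times> ?E)"
    proof (cases "S = {}")
      case True
      then show ?thesis by (auto intro!: image_eqI[of _ _ "({}, {})"])
    next
      case False
      then obtain x where x: "x \<in> S" by auto
      have "finite S" using S assms finite_subset by auto
      then have "card (S - {x}) \<le> v" using S x by (simp add: card_Diff_singleton)
      then show ?thesis using S x by (intro image_eqI[of _ _ "(S - {x}, {x})"]) auto
    qed
  qed
  then have "card {S. S \<subseteq> J \<and> card S \<le> Suc v} \<le> card ((\<lambda>(S, E). S \<union> E) ` (?P \<times> ?E))"
    using fin by (intro card_mono) auto
  also have "\<dots> \<le> card ?P * card ?E"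
    unfolding card_cartesian_product[symmetric] using fin by (intro card_image_le finite_cartesian_product)
  also have "\<dots> \<le> (card J + 1) ^ v * (card J + 1)"
  proof (rule mult_le_mono)
    have "card ?E \<le> Suc (card ((\<lambda>x. {x}) ` J))" by (simp add: card_insert_if assms)
    moreover have "card ((\<lambda>x. {x}) ` J) \<le> card J" by (rule card_image_le[OF assms])
    ultimately show "card ?E \<le> card J + 1" by simp
  qed (rule Suc)
  finally show ?case by (simp add: mult.commute)
qed

lemma card_traces_le:
  assumes J: "finite J" "J \<subseteq> I" and vc: "\<And>S. S \<subseteq> I \<Longrightarrow> shatters F S \<Longrightarrow> card S \<le> v"
  shows "card ((\<lambda>A. A \<inter> J) ` F) \<le> (card J + 1) ^ v"
proof -
  let ?F = "(\<lambda>A. A \<inter> J) ` F"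
  have "card ?F \<le> card {S. S \<subseteq> J \<and> shatters ?F S}"
    by (rule card_le_card_shattered[OF J(1)]) auto
  also have "\<dots> \<le> card {S. S \<subseteq> J \<and> card S \<le> v}"
  proof (rule card_mono)
    show "finite {S. S \<subseteq> J \<and> card S \<le> v}" using J by auto
    show "{S. S \<subseteq> J \<and> shatters ?F S} \<subseteq> {S. S \<subseteq> J \<and> card S \<le> v}"
    proof safe
      fix S assume S: "S \<subseteq> J" "shatters ?F S"
      have "shatters F S"
        unfolding shatters_def
      proof (intro allI impI)
        fix B assume "B \<subseteq> S"
        then have "\<exists>A'\<in>?F. A' \<inter> S = B" using S(2) by (simp only: shatters_def)
        then obtain A where A: "A \<in> F" "A \<inter> J \<inter> S = B" by blast
        moreover have "A \<inter> S = A \<inter> J \<inter> S" using S(1) by blast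
        ultimately show "\<exists>A\<in>F. A \<inter> S = B" by blast
      qed
      then show "card S \<le> v" using vc[of S] S J by auto
    qed
  qed
  also have "\<dots> \<le> (card J + 1) ^ v" by (rule card_subsets_card_le[OF J(1)])
  finally show ?thesis .
qed

section \<open>Sign vectors and the discrete cube\<close>

definition signs :: "'i set \<Rightarrow> ('i \<Rightarrow> real) set" where "signs I = (I \<rightarrow>\<^sub>E {-1, 1})"

lemma finite_signs: "finite I \<Longrightarrow> finite (signs I)"
  by (simp add: signs_def finite_PiE)

lemma card_signs: "finite I \<Longrightarrow> card (signs I) = 2 ^ card I"
  by (simp add: signs_def card_PiE numeral_2_eq_2)

text \<open>
  Prescribing the signs on \<open>A t\<close> merges at most \<open>2 ^ d\<close> patterns, so if the images of \<open>G\<close> for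
  different \<open>t\<close> are disjoint, they soon fill the whole discrete cube.
\<close>

lemma card_le_of_disjoint_sign_changes:
  assumes I: "finite I" and \<sigma>: "\<And>i. i \<in> I \<Longrightarrow> \<sigma> i \<in> {-1, 1}" and C: "finite C" and A: "\<And>t. t \<in> C \<Longrightarrow> A t \<subseteq> I \<and> card (A t) \<le> d"
    and G: "G \<subseteq> signs I" "card (signs I) \<le> 2 * card G"
    and disj: "\<And>t t' e e'. t \<in> C \<Longrightarrow> t' \<in> C \<Longrightarrow> t \<noteq> t' \<Longrightarrow> e \<in> G \<Longrightarrow> e' \<in> G \<Longrightarrow>
       (\<lambda>i\<in>I. if i \<in> A t then \<sigma> i else e i) \<noteq> (\<lambda>i\<in>I. if i \<in> A t' then \<sigma> i else e' i)"
  shows "card C \<le> 2 ^ (d + 1)"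
proof -
  define D where "D = (\<lambda>t. (\<lambda>e. \<lambda>i\<in>I. if i \<in> A t then \<sigma> i else e i) ` G)"
  have fG: "finite G" using G finite_signs[OF I] finite_subset by auto
  have sgn: "e i \<in> {-1, 1}" if "e \<in> G" "i \<in> I" for e i
    using that G(1) by (force simp: signs_def PiE_iff)
  have D: "D t \<subseteq> signs I" for t
    unfolding D_def signs_def
  proof (intro image_subsetI restrict_PiE_iff[THEN iffD2] ballI)
    fix e i assume "e \<in> G" "i \<in> I"
    from sgn[OF this] \<sigma>[OF \<open>i \<in> I\<close>] show "(if i \<in> A t then \<sigma> i else e i) \<in> {-1, 1}" by simp
  qed
  have cG: "card G \<le> card (D t) * 2 ^ d" if t: "t \<in> C" for t
  proof -
    have At: "A t \<subseteq> I" "card (A t) \<le> d" "finite (A t)" using A[OF t] I finite_subset by auto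
    \<comment> \<open>Only the original signs on \<open>A t\<close> are lost in passing to
      \<open>D t\<close>; the second component keeps them, which makes the map injective.\<close>
    let ?h = "\<lambda>e. (\<lambda>i\<in>I. if i \<in> A t then \<sigma> i else e i, restrict e (A t))"
    have "inj_on ?h G"
    proof (rule inj_onI)
      fix e e' assume e: "e \<in> G" "e' \<in> G" "?h e = ?h e'"
      show "e = e'"
      proof
        fix i
        show "e i = e' i"
        proof (cases "i \<in> I")
          case True
          from e(3) have "(if i \<in> A t then \<sigma> i else e i) = (if i \<in> A t then \<sigma> i else e' i)"
            using True by (auto dest: fun_cong[of _ _ i])
          moreover from e(3) have "restrict e (A t) i = restrict e' (A t) i" by (auto dest: fun_cong[of _ _ i])
          ultimately show ?thesis by (auto split: if_splits)
        next
          case False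
          have "e \<in> signs I" "e' \<in> signs I" using e(1,2) G(1) by blast+
          then have "e i = undefined" "e' i = undefined" using False by (auto simp: signs_def intro: PiE_arb)
          then show ?thesis by simp
        qed
      qed
    qed
    moreover have "?h ` G \<subseteq> D t \<times> signs (A t)"
    proof
      fix z assume "z \<in> ?h ` G"
      then obtain e where e: "e \<in> G" "z = ?h e" by blast
      have "restrict e (A t) \<in> signs (A t)"
        unfolding signs_def
      proof (intro restrict_PiE_iff[THEN iffD2] ballI)
        fix i assume "i \<in> A t"
        with At(1) have "i \<in> I" by blast
        from sgn[OF e(1) this] show "e i \<in> {-1, 1}" .
      qed
      moreover have "(\<lambda>i\<in>I. if i \<in> A t then \<sigma> i else e i) \<in> D t" unfolding D_def using e(1) by (rule imageI)
      ultimately show "z \<in> D t \<times> signs (A t)" unfolding e(2) by (rule SigmaI[rotated])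
    qed
    moreover have "finite (D t \<times> signs (A t))"
      using fG At by (simp add: D_def finite_signs)
    ultimately have "card G \<le> card (D t \<times> signs (A t))" by (rule card_inj_on_le)
    also have "\<dots> = card (D t) * 2 ^ card (A t)" using At by (simp add: card_cartesian_product card_signs)
    also have "\<dots> \<le> card (D t) * 2 ^ d" using At by (intro mult_left_mono power_increasing) auto
    finally show ?thesis .
  qed
  have "card C * card G = (\<Sum>t\<in>C. card G)" by simp
  also have "\<dots> \<le> (\<Sum>t\<in>C. card (D t) * 2 ^ d)" by (intro sum_mono cG)
  also have "\<dots> = (\<Sum>t\<in>C. card (D t)) * 2 ^ d" by (simp add: sum_distrib_right)
  also have "(\<Sum>t\<in>C. card (D t)) = card (\<Union>t\<in>C. D t)"
    using C fG disj by (subst card_UN_disjoint) (auto simp: D_def)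
  also have "\<dots> \<le> card (signs I)"
    using D by (intro card_mono finite_signs I) auto
  also have "card (signs I) * 2 ^ d \<le> (2 * card G) * 2 ^ d" using G by (intro mult_right_mono) auto
  finally have "card C * card G \<le> 2 ^ (d + 1) * card G" by (simp add: mult_ac)
  moreover have "0 < card G" using G card_signs[OF I] by (cases "card G") auto
  ultimately show ?thesis by simp
qed

section \<open>Prekopa-Leindler inequalities on the line\<close>

text \<open>A Borel set need not contain its supremum, so cutting at a maximum is replaced by cuts
  at all \<open>c\<close> below some element. For bounded \<open>A\<close> these cuts exhaust
  everything except possibly the point \<open>Sup A\<close>, a null set.\<close>

lemma emeasure_le_of_lessThan_parts:
  fixes A :: "real set"
  assumes [measurable]: "A \<in> sets borel"
    and le: "\<And>c. \<exists>a\<in>A. c \<le> a \<Longrightarrow> emeasure lborel (A \<inter> {..<c}) \<le> R"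
    and ne: "A \<noteq> {}"
  shows "emeasure lborel A \<le> R"
proof (cases "bdd_above A")
  case True
  define c where "c = (\<lambda>n. Sup A - 1 / real (Suc n))"
  have "(SUP n. emeasure lborel (A \<inter> {..<c n})) = emeasure lborel (\<Union>n. A \<inter> {..<c n})"
    by (rule SUP_emeasure_incseq)
       (auto simp: c_def incseq_def frac_le intro: order_less_le_trans)
  also have "(\<Union>n. A \<inter> {..<c n}) = A \<inter> {..<Sup A}"
  proof -
    have "\<exists>n. x < c n" if "x < Sup A" for x
    proof -
      from reals_Archimedean[of "Sup A - x"] that obtain n where "inverse (real (Suc n)) < Sup A - x"
        by (auto simp del: of_nat_Suc)
      then show ?thesis by (auto simp: c_def inverse_eq_divide intro!: exI[of _ n])
    qed
    moreover have "c n < Sup A" for n by (simp add: c_def)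
    ultimately show ?thesis by (auto intro: less_trans)
  qed
  also have "emeasure lborel (A \<inter> {..<Sup A}) = emeasure lborel A"
  proof (rule emeasure_eq_AE)
    have "AE x in lborel. x \<noteq> Sup A" by (rule AE_lborel_singleton)
    then show "AE x in lborel. x \<in> A \<inter> {..<Sup A} \<longleftrightarrow> x \<in> A"
    proof eventually_elim
      case (elim x)
      then show ?case using cSup_upper[OF _ True, of x] by auto
    qed
  qed auto
  finally have "emeasure lborel A = (SUP n. emeasure lborel (A \<inter> {..<c n}))" ..
  also have "\<dots> \<le> R"
  proof (intro SUP_least le)
    fix n
    have "c n < Sup A" by (simp add: c_def)
    then show "\<exists>a\<in>A. c n \<le> a" using less_cSup_iff[OF ne True, of "c n"] by (auto intro: less_imp_le)
  qed
  finally show ?thesis .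
next
  case False
  have "(SUP n. emeasure lborel (A \<inter> {..<real n})) = emeasure lborel (\<Union>n. A \<inter> {..<real n})"
    by (rule SUP_emeasure_incseq) (auto simp: incseq_def)
  also have "(\<Union>n. A \<inter> {..<real n}) = A"
    using reals_Archimedean2 by auto
  finally have "emeasure lborel A = (SUP n. emeasure lborel (A \<inter> {..<real n}))" ..
  also have "\<dots> \<le> R"
  proof (intro SUP_least le)
    fix n :: nat
    show "\<exists>a\<in>A. real n \<le> a" using False unfolding bdd_above_def by (meson linear)
  qed
  finally show ?thesis .
qed

lemma emeasure_midpoint_image_le:
  fixes A S :: "real set"
  assumes [measurable]: "A \<in> sets borel" "S \<in> sets borel"
    and sub: "\<And>a. a \<in> A \<Longrightarrow> (a + b) / 2 \<in> S"
  shows "emeasure lborel A \<le> 2 * emeasure lborel S"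
proof -
  have "emeasure lborel A = (\<integral>\<^sup>+x. indicator A x \<partial>lborel)" by simp
  also have "\<dots> \<le> (\<integral>\<^sup>+x. indicator S (b/2 + 1/2 * x) \<partial>lborel)"
    using sub by (intro nn_integral_mono) (auto split: split_indicator simp: add_divide_distrib add.commute)
  also have "\<dots> = 2 * (ennreal \<bar>1/2\<bar> * (\<integral>\<^sup>+x. indicator S (b/2 + 1/2 * x) \<partial>lborel))"
  proof -
    have "ennreal 2 * ennreal \<bar>1/2\<bar> = ennreal 1" by (subst ennreal_mult[symmetric]) auto
    then have "2 * ennreal \<bar>1/2\<bar> = 1" by simp
    then show ?thesis by (simp only: mult.assoc[symmetric] mult_1)
  qed
  also have "\<dots> = 2 * (\<integral>\<^sup>+x. indicator S x \<partial>lborel)"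
    by (subst nn_integral_real_affine[where c="1/2" and t="b/2" and f="indicator S"]) auto
  finally show ?thesis by simp
qed

lemma emeasure_le_of_atLeast_parts:
  fixes B :: "real set"
  assumes [measurable]: "B \<in> sets borel"
    and le: "\<And>d. \<exists>b\<in>B. b \<le> d \<Longrightarrow> emeasure lborel (B \<inter> {d..}) \<le> R"
    and ne: "B \<noteq> {}"
  shows "emeasure lborel B \<le> R"
proof -
  have refl: "emeasure lborel (uminus -` D) = emeasure lborel D" if [measurable]: "D \<in> sets borel" for D :: "real set"
  proof -
    have [measurable]: "uminus -` D \<in> sets borel" by (rule measurable_sets_borel[of _ borel]) auto
    have "emeasure lborel D = (\<integral>\<^sup>+x. indicator D x \<partial>lborel)" by simp
    also have "\<dots> = (\<integral>\<^sup>+x. indicator D (0 + (-1) * x) \<partial>lborel)"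
      by (subst nn_integral_real_affine[where c="-1" and t=0]) auto
    also have "\<dots> = (\<integral>\<^sup>+x. indicator (uminus -` D) x \<partial>lborel)"
      by (intro nn_integral_cong) (auto split: split_indicator)
    finally show ?thesis by simp
  qed
  have "emeasure lborel (uminus -` B) \<le> R"
  proof (rule emeasure_le_of_lessThan_parts)
    show "uminus -` B \<in> sets borel" by (rule measurable_sets_borel[of _ borel]) auto
    show "uminus -` B \<noteq> {}" using ne by (metis ex_in_conv minus_minus vimage_eq)
    fix c assume "\<exists>a\<in>uminus -` B. c \<le> a"
    then obtain a where a: "- a \<in> B" "c \<le> a" by auto
    have "emeasure lborel (uminus -` B \<inter> {..<c}) \<le> emeasure lborel (uminus -` (B \<inter> {-c..}))"
      by (rule emeasure_mono) (auto intro!: measurable_sets_borel[of _ borel])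
    also have "\<dots> \<le> R" using a by (subst refl) (auto intro!: le bexI[of _ "- a"])
    finally show "emeasure lborel (uminus -` B \<inter> {..<c}) \<le> R" .
  qed
  then show ?thesis by (simp add: refl)
qed

text \<open>The part of \<open>A\<close> left of \<open>a0\<close>, averaged with \<open>b0\<close>,
  lands left of the midpoint of \<open>a0\<close> and \<open>b0\<close>; the part of
  \<open>B\<close> from \<open>b0\<close> on, averaged with \<open>a0\<close>, lands at or right of
  it. The two images are disjoint, and the exhaustion lemmas remove the cuts one set at a
  time.\<close>

lemma brunn_minkowski_1d:
  fixes A B S :: "real set"
  assumes [measurable]: "A \<in> sets borel" "B \<in> sets borel" "S \<in> sets borel"
    and ne: "A \<noteq> {}" "B \<noteq> {}"
    and mid: "\<And>a b. a \<in> A \<Longrightarrow> b \<in> B \<Longrightarrow> (a + b) / 2 \<in> S"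
  shows "emeasure lborel A + emeasure lborel B \<le> 2 * emeasure lborel S"
proof -
  have key: "emeasure lborel (A \<inter> {..<a0}) + emeasure lborel (B \<inter> {b0..}) \<le> 2 * emeasure lborel S"
    if "a0 \<in> A" "b0 \<in> B" for a0 b0
  proof -
    let ?m = "(a0 + b0) / 2"
    have "emeasure lborel (A \<inter> {..<a0}) \<le> 2 * emeasure lborel (S \<inter> {..<?m})"
      by (rule emeasure_midpoint_image_le[where b=b0]) (use mid that in auto)
    moreover have "emeasure lborel (B \<inter> {b0..}) \<le> 2 * emeasure lborel (S \<inter> {?m..})"
      by (rule emeasure_midpoint_image_le[where b=a0])
         (use mid[OF that(1)] that in \<open>auto simp: add.commute\<close>)
    moreover have "emeasure lborel (S \<inter> {..<?m}) + emeasure lborel (S \<inter> {?m..}) = emeasure lborel S"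
      by (subst plus_emeasure) (auto intro!: arg_cong[where f="emeasure lborel"])
    ultimately show ?thesis
      by (metis add_mono distrib_left)
  qed
  \<comment> \<open>Subtraction on \<open>ennreal\<close> can be undone only for a finite
    subtrahend, hence the case distinctions on infinite measure below.\<close>
  have lift: "X \<le> R - Y" if "X + Y \<le> R" "Y \<noteq> \<top>" for X Y R :: ennreal
    using that by (simp add: ennreal_le_minus_iff add.commute)
  have drop: "X + Y \<le> R" if "X \<le> R - Y" "Y \<le> R" "Y \<noteq> \<top>" for X Y R :: ennreal
    using that by (metis add.commute add_left_mono add_diff_inverse_ennreal)
  have A: "emeasure lborel A + emeasure lborel (B \<inter> {b0..}) \<le> 2 * emeasure lborel S" if b0: "b0 \<in> B" for b0
  proof (cases "emeasure lborel (B \<inter> {b0..}) = \<top>")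
    case True
    then show ?thesis using key[OF _ b0] ne by auto
  next
    case False
    have "emeasure lborel A \<le> 2 * emeasure lborel S - emeasure lborel (B \<inter> {b0..})"
    proof (rule emeasure_le_of_lessThan_parts)
      fix c assume "\<exists>a\<in>A. c \<le> a"
      then obtain a where a: "a \<in> A" "c \<le> a" by auto
      have "emeasure lborel (A \<inter> {..<c}) \<le> emeasure lborel (A \<inter> {..<a})"
        using a by (intro emeasure_mono) auto
      also have "\<dots> \<le> 2 * emeasure lborel S - emeasure lborel (B \<inter> {b0..})"
        using lift[OF key[OF a(1) b0] False] .
      finally show "emeasure lborel (A \<inter> {..<c}) \<le> 2 * emeasure lborel S - emeasure lborel (B \<inter> {b0..})" .
    qed (use ne in auto)
    moreover have "emeasure lborel (B \<inter> {b0..}) \<le> 2 * emeasure lborel S"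
    proof -
      obtain a0 where "a0 \<in> A" using ne by auto
      from key[OF this b0] show ?thesis by (meson add_increasing order_trans order_refl zero_le)
    qed
    ultimately show ?thesis using False by (intro drop)
  qed
  show ?thesis
  proof (cases "emeasure lborel A = \<top>")
    case True
    then show ?thesis using A ne by auto
  next
    case False
    have "emeasure lborel B \<le> 2 * emeasure lborel S - emeasure lborel A"
    proof (rule emeasure_le_of_atLeast_parts)
      fix d assume "\<exists>b\<in>B. b \<le> d"
      then obtain b where b: "b \<in> B" "b \<le> d" by auto
      have "emeasure lborel (B \<inter> {d..}) \<le> emeasure lborel (B \<inter> {b..})"
        using b by (intro emeasure_mono) auto
      also have "\<dots> \<le> 2 * emeasure lborel S - emeasure lborel A"
        using lift[OF _ False] A[OF b(1)] by (simp add: add.commute)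
      finally show "emeasure lborel (B \<inter> {d..}) \<le> 2 * emeasure lborel S - emeasure lborel A" .
    qed (use ne in auto)
    moreover have "emeasure lborel A \<le> 2 * emeasure lborel S"
    proof -
      obtain b0 where "b0 \<in> B" using ne by auto
      from A[OF this] show ?thesis by (meson add_increasing2 order_trans order_refl zero_le)
    qed
    ultimately show ?thesis using False by (subst add.commute) (intro drop)
  qed
qed

section \<open>From level sets to functions\<close>

lemma nn_integral_layer_cake:
  fixes f :: "real \<Rightarrow> real"
  assumes [measurable]: "f \<in> borel_measurable borel" and nn: "\<And>x. 0 \<le> f x"
  shows "(\<integral>\<^sup>+x. ennreal (f x) \<partial>lborel)
       = (\<integral>\<^sup>+t. indicator {0<..} t * emeasure lborel {x. t < f x} \<partial>lborel)"
proof -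
  have "(\<integral>\<^sup>+x. ennreal (f x) \<partial>lborel) = (\<integral>\<^sup>+x. (\<integral>\<^sup>+t. indicator {0<..<f x} t \<partial>lborel) \<partial>lborel)"
    using nn by (intro nn_integral_cong) simp
  also have "\<dots> = (\<integral>\<^sup>+x. (\<integral>\<^sup>+t. indicator {0<..} t * indicator {x. t < f x} x \<partial>lborel) \<partial>lborel)"
    by (intro nn_integral_cong) (auto split: split_indicator)
  also have "\<dots> = (\<integral>\<^sup>+t. (\<integral>\<^sup>+x. indicator {0<..} t * indicator {x. t < f x} x \<partial>lborel) \<partial>lborel)"
    by (rule lborel_pair.Fubini'[symmetric]) measurable
  also have "\<dots> = (\<integral>\<^sup>+t. indicator {0<..} t * emeasure lborel {x. t < f x} \<partial>lborel)"
    by (intro nn_integral_cong) (simp add: nn_integral_cmult)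
  finally show ?thesis .
qed

text \<open>With both suprema equal to 1 all level sets below height 1 are nonempty, so
  Brunn-Minkowski applies height by height; from height 1 on the left side vanishes. The additive
  result is stronger than the product form.\<close>

lemma prekopa_leindler_1d_sup_1:
  fixes f g h :: "real \<Rightarrow> real"
  assumes [measurable]: "f \<in> borel_measurable borel" "g \<in> borel_measurable borel" "h \<in> borel_measurable borel"
    and nn: "\<And>x. 0 \<le> f x" "\<And>x. 0 \<le> g x" "\<And>x. 0 \<le> h x"
    and le1: "\<And>x. f x \<le> 1" "\<And>x. g x \<le> 1"
    and near1: "\<And>t. t < 1 \<Longrightarrow> \<exists>x. t < f x" "\<And>t. t < 1 \<Longrightarrow> \<exists>x. t < g x"
    and mid: "\<And>s t. f s * g t \<le> (h ((s + t) / 2))\<^sup>2"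
  shows "(\<integral>\<^sup>+x. ennreal (f x) \<partial>lborel) + (\<integral>\<^sup>+x. ennreal (g x) \<partial>lborel) \<le> 2 * (\<integral>\<^sup>+x. ennreal (h x) \<partial>lborel)"
proof -
  have "(\<integral>\<^sup>+x. ennreal (f x) \<partial>lborel) + (\<integral>\<^sup>+x. ennreal (g x) \<partial>lborel)
     = (\<integral>\<^sup>+t. indicator {0<..} t * emeasure lborel {x. t < f x} + indicator {0<..} t * emeasure lborel {x. t < g x} \<partial>lborel)"
    by (simp add: nn_integral_layer_cake nn nn_integral_add)
  also have "\<dots> \<le> (\<integral>\<^sup>+t. 2 * (indicator {0<..} t * emeasure lborel {x. t < h x}) \<partial>lborel)"
  proof (rule nn_integral_mono)
    fix t :: real
    show "indicator {0<..} t * emeasure lborel {x. t < f x} + indicator {0<..} t * emeasure lborel {x. t < g x}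
        \<le> 2 * (indicator {0<..} t * emeasure lborel {x. t < h x})"
    proof (cases "0 < t \<and> t < 1")
      case True
      have "emeasure lborel {x. t < f x} + emeasure lborel {x. t < g x} \<le> 2 * emeasure lborel {x. t < h x}"
      proof (rule brunn_minkowski_1d)
        fix a b assume ab: "a \<in> {x. t < f x}" "b \<in> {x. t < g x}"
        then have "t\<^sup>2 < f a * g b"
          using True by (simp add: power2_eq_square mult_strict_mono)
        also have "\<dots> \<le> (h ((a + b) / 2))\<^sup>2" by (rule mid)
        finally show "(a + b) / 2 \<in> {x. t < h x}" using nn(3) by (simp add: power2_less_imp_less)
      qed (use near1 True in auto)
      then show ?thesis using True by simp
    next
      case False
      have "{x. t < f x} = {}" "{x. t < g x} = {}" if "0 < t"
        using le1 False that by (auto simp: not_less intro: order_trans)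
      then show ?thesis by (auto split: split_indicator)
    qed
  qed
  also have "\<dots> = 2 * (\<integral>\<^sup>+x. ennreal (h x) \<partial>lborel)"
    by (simp add: nn_integral_layer_cake nn nn_integral_cmult)
  finally show ?thesis .
qed

lemma ennreal_mult_le_power2_of_add_le:
  fixes x y z :: ennreal
  assumes "x + y \<le> 2 * z" shows "x * y \<le> z\<^sup>2"
proof (cases "z = \<top>")
  case True
  then show ?thesis by (simp add: power2_eq_square)
next
  case False
  then have "2 * z < \<top>" by (simp add: ennreal_mult_less_top top.not_eq_extremum)
  then have "x + y < \<top>" using assms le_less_trans by blast
  then have "x < \<top>" "y < \<top>" by (metis ennreal_add_eq_top top.not_eq_extremum)+
  then obtain x' y' z' where *: "x = ennreal x'" "y = ennreal y'" "z = ennreal z'" "0 \<le> x'" "0 \<le> y'" "0 \<le> z'"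
    using False by (metis ennreal_cases less_irrefl)
  have "ennreal (x' + y') \<le> ennreal (2 * z')"
    using assms * by (simp add: ennreal_mult'')
  then have "x' + y' \<le> 2 * z'" using * by (subst (asm) ennreal_le_iff) auto
  then have "(x' + y')\<^sup>2 \<le> (2 * z')\<^sup>2" using * by (intro power_mono) auto
  moreover have "4 * (x' * y') \<le> (x' + y')\<^sup>2"
    using sum_squares_ge_zero[of "x' - y'" 0] by (simp add: power2_eq_square algebra_simps)
  ultimately have "x' * y' \<le> z'\<^sup>2" by (simp add: power2_eq_square)
  then have "ennreal (x' * y') \<le> ennreal (z'\<^sup>2)" by (rule ennreal_leI)
  then show ?thesis using * by (simp add: ennreal_mult ennreal_power)
qed

lemma prekopa_leindler_1d_bounded:
  fixes f g h :: "real \<Rightarrow> real"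
  assumes [measurable]: "f \<in> borel_measurable borel" "g \<in> borel_measurable borel" "h \<in> borel_measurable borel"
    and nn: "\<And>x. 0 \<le> f x" "\<And>x. 0 \<le> g x" "\<And>x. 0 \<le> h x"
    and bdd: "bdd_above (range f)" "bdd_above (range g)"
    and mid: "\<And>s t. f s * g t \<le> (h ((s + t) / 2))\<^sup>2"
  shows "(\<integral>\<^sup>+x. ennreal (f x) \<partial>lborel) * (\<integral>\<^sup>+x. ennreal (g x) \<partial>lborel) \<le> (\<integral>\<^sup>+x. ennreal (h x) \<partial>lborel)\<^sup>2"
proof (cases "(\<forall>x. f x = 0) \<or> (\<forall>x. g x = 0)")
  case True
  then show ?thesis by auto
next
  case False
  define a b where "a = Sup (range f)" and "b = Sup (range g)"
  have up: "f x \<le> a" "g x \<le> b" for x using bdd by (auto simp: a_def b_def intro: cSup_upper)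
  obtain x y where "f x \<noteq> 0" "g y \<noteq> 0" using False by auto
  then have pos: "0 < a" "0 < b" using up[of x] up[of y] nn(1)[of x] nn(2)[of y] by linarith+
  \<comment> \<open>The geometric mean of the two suprema is the scale of \<open>h\<close> for which
    the normalized functions satisfy the same midpoint condition.\<close>
  define c where "c = sqrt (a * b)"
  have c: "0 < c" "c\<^sup>2 = a * b" using pos by (auto simp: c_def)
  have sum: "(\<integral>\<^sup>+x. ennreal (f x / a) \<partial>lborel) + (\<integral>\<^sup>+x. ennreal (g x / b) \<partial>lborel)
      \<le> 2 * (\<integral>\<^sup>+x. ennreal (h x / c) \<partial>lborel)"
  proof (rule prekopa_leindler_1d_sup_1)
    show "\<exists>x. t < f x / a" if "t < 1" for t
    proof -
      have "t * a < a" using that pos by simp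
      then obtain x where "t * a < f x"
        using bdd unfolding a_def by (auto simp: less_cSup_iff)
      then show ?thesis using pos by (auto simp: field_simps)
    qed
    show "\<exists>x. t < g x / b" if "t < 1" for t
    proof -
      have "t * b < b" using that pos by simp
      then obtain x where "t * b < g x"
        using bdd unfolding b_def by (auto simp: less_cSup_iff)
      then show ?thesis using pos by (auto simp: field_simps)
    qed
    show "f s / a * (g t / b) \<le> (h ((s + t) / 2) / c)\<^sup>2" for s t
      using mid[of s t] pos c by (simp add: power_divide divide_right_mono)
  qed (use nn up pos c in auto)
  have scale: "(\<integral>\<^sup>+x. ennreal (k x / r) \<partial>lborel) = ennreal (1 / r) * (\<integral>\<^sup>+x. ennreal (k x) \<partial>lborel)"
    if [measurable]: "k \<in> borel_measurable borel" and "0 < r" "\<And>x. 0 \<le> k x" for k :: "real \<Rightarrow> real" and r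
  proof -
    have "(\<integral>\<^sup>+x. ennreal (k x / r) \<partial>lborel) = (\<integral>\<^sup>+x. ennreal (1 / r) * ennreal (k x) \<partial>lborel)"
      using that by (intro nn_integral_cong) (simp flip: ennreal_mult)
    then show ?thesis by (simp add: nn_integral_cmult)
  qed
  let ?F = "\<integral>\<^sup>+x. ennreal (f x) \<partial>lborel" and ?G = "\<integral>\<^sup>+x. ennreal (g x) \<partial>lborel" and ?H = "\<integral>\<^sup>+x. ennreal (h x) \<partial>lborel"
  have "(ennreal (1 / a) * ?F) * (ennreal (1 / b) * ?G) \<le> (ennreal (1 / c) * ?H)\<^sup>2"
    using ennreal_mult_le_power2_of_add_le[OF sum] pos c nn by (simp add: scale)
  then have "ennreal (a * b) * ((ennreal (1 / a) * ?F) * (ennreal (1 / b) * ?G)) \<le> ennreal (a * b) * (ennreal (1 / c) * ?H)\<^sup>2"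
    by (rule mult_left_mono) simp
  also have "ennreal (a * b) * ((ennreal (1 / a) * ?F) * (ennreal (1 / b) * ?G))
     = (ennreal (a * b) * ennreal (1 / a) * ennreal (1 / b)) * (?F * ?G)"
    by (simp add: mult_ac)
  also have "ennreal (a * b) * ennreal (1 / a) * ennreal (1 / b) = 1"
    using pos by (simp flip: ennreal_mult)
  also have "ennreal (a * b) * (ennreal (1 / c) * ?H)\<^sup>2 = (ennreal (a * b) * ennreal (1 / c) * ennreal (1 / c)) * ?H\<^sup>2"
    by (simp add: power2_eq_square mult_ac)
  also have "ennreal (a * b) * ennreal (1 / c) * ennreal (1 / c) = 1"
    using pos c by (simp flip: ennreal_mult add: power2_eq_square)
  finally show ?thesis by simp
qed

lemma nn_integral_eq_SUP_min:
  assumes [measurable]: "f \<in> borel_measurable M"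
  shows "(\<integral>\<^sup>+x. f x \<partial>M) = (SUP m::nat. \<integral>\<^sup>+x. min (f x) (of_nat m) \<partial>M)"
proof -
  have "(SUP m::nat. min (f x) (of_nat m)) = f x" for x
  proof -
    have "(SUP m::nat. min (f x) (of_nat m)) = min (f x) (SUP m::nat. of_nat m)"
      by (subst inf_min[symmetric])+ (simp add: inf_SUP)
    then show ?thesis by (simp add: ennreal_SUP_of_nat_eq_top)
  qed
  then have "(\<integral>\<^sup>+x. f x \<partial>M) = (\<integral>\<^sup>+x. (SUP m::nat. min (f x) (of_nat m)) \<partial>M)" by simp
  also have "\<dots> = (SUP m::nat. \<integral>\<^sup>+x. min (f x) (of_nat m) \<partial>M)"
    by (rule nn_integral_monotone_convergence_SUP)
       (auto simp: incseq_def le_fun_def intro: min.coboundedI2)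
  finally show ?thesis .
qed

lemma prekopa_leindler_1d:
  fixes f g h :: "real \<Rightarrow> ennreal"
  assumes [measurable]: "f \<in> borel_measurable borel" "g \<in> borel_measurable borel" "h \<in> borel_measurable borel"
    and mid: "\<And>s t. f s * g t \<le> (h ((s + t) / 2))\<^sup>2"
  shows "(\<integral>\<^sup>+x. f x \<partial>lborel) * (\<integral>\<^sup>+x. g x \<partial>lborel) \<le> (\<integral>\<^sup>+x. h x \<partial>lborel)\<^sup>2"
proof -
  have trunc: "(\<integral>\<^sup>+x. min (f x) (of_nat m) \<partial>lborel) * (\<integral>\<^sup>+x. min (g x) (of_nat m') \<partial>lborel) \<le> (\<integral>\<^sup>+x. h x \<partial>lborel)\<^sup>2"
    for m m' :: nat
  proof -
    \<comment> \<open>Cutting \<open>h\<close> at this height keeps the midpoint condition: where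
      \<open>h\<close> is cut, its square is \<open>m * m'\<close>, which bounds the product of the
      truncated \<open>f\<close> and \<open>g\<close>.\<close>
    define r where "r = sqrt (real m * real m')"
    have r: "0 \<le> r" "r\<^sup>2 = real m * real m'" by (auto simp: r_def)
    define f' g' h' where "f' = (\<lambda>x. enn2real (min (f x) (of_nat m)))" and "g' = (\<lambda>x. enn2real (min (g x) (of_nat m')))"
      and "h' = (\<lambda>x. enn2real (min (h x) (ennreal r)))"
    have fin: "min (f x) (of_nat m) < \<top>" "min (g x) (of_nat m') < \<top>" "min (h x) (ennreal r) < \<top>" for x
      by (auto simp: min_less_iff_disj of_nat_less_top)
    have eq: "ennreal (f' x) = min (f x) (of_nat m)" "ennreal (g' x) = min (g x) (of_nat m')"
       "ennreal (h' x) = min (h x) (ennreal r)" for x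
      using fin by (auto simp: f'_def g'_def h'_def)
    have up: "f' x \<le> real m" "g' x \<le> real m'" for x
    proof -
      have "ennreal (f' x) \<le> ennreal (real m)" by (simp add: eq ennreal_of_nat_eq_real_of_nat)
      then show "f' x \<le> real m" by (simp add: ennreal_le_iff)
      have "ennreal (g' x) \<le> ennreal (real m')" by (simp add: eq ennreal_of_nat_eq_real_of_nat)
      then show "g' x \<le> real m'" by (simp add: ennreal_le_iff)
    qed
    have nn: "0 \<le> f' x" "0 \<le> g' x" "0 \<le> h' x" for x by (auto simp: f'_def g'_def h'_def)
    have "(\<integral>\<^sup>+x. ennreal (f' x) \<partial>lborel) * (\<integral>\<^sup>+x. ennreal (g' x) \<partial>lborel) \<le> (\<integral>\<^sup>+x. ennreal (h' x) \<partial>lborel)\<^sup>2"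
    proof (rule prekopa_leindler_1d_bounded)
      show "f' s * g' t \<le> (h' ((s + t) / 2))\<^sup>2" for s t
      proof -
        have "ennreal (f' s * g' t) \<le> ennreal ((h' ((s + t) / 2))\<^sup>2)"
        proof (cases "h ((s + t) / 2) \<le> ennreal r")
          case True
          have "ennreal (f' s * g' t) = min (f s) (of_nat m) * min (g t) (of_nat m')"
            using nn by (simp add: ennreal_mult eq)
          also have "\<dots> \<le> f s * g t" by (intro mult_mono) auto
          also have "\<dots> \<le> (h ((s + t) / 2))\<^sup>2" by (rule mid)
          also have "\<dots> = ennreal (h' ((s + t) / 2))^2" using True by (simp add: eq min_absorb1)
          finally show ?thesis using nn by (simp add: ennreal_power)
        next
          case False
          then have "h' ((s + t) / 2) = r" using r by (simp add: h'_def min_absorb2)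
          moreover have "f' s * g' t \<le> real m * real m'" using up nn by (intro mult_mono) auto
          ultimately show ?thesis using r by (simp add: ennreal_leI)
        qed
        then show ?thesis by (simp add: ennreal_le_iff)
      qed
      show "bdd_above (range f')" "bdd_above (range g')" using up by (auto simp: bdd_above_def)
    qed (auto simp: f'_def g'_def h'_def)
    also have "\<dots> \<le> (\<integral>\<^sup>+x. h x \<partial>lborel)\<^sup>2"
      by (intro power_mono nn_integral_mono) (auto simp: eq)
    finally show ?thesis by (simp add: eq)
  qed
  show ?thesis
    unfolding nn_integral_eq_SUP_min[of f lborel, simplified] nn_integral_eq_SUP_min[of g lborel, simplified]
    by (simp only: SUP_mult_left_ennreal SUP_mult_right_ennreal) (intro SUP_least trunc)
qed

text \<open>
  For \<open>q = True\<close> the mean averages square roots: after the substitution \<open>s = a\<^sup>2\<close> densities are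
  multiplied by \<open>2 a\<close>, and \<open>pl_gain\<close> is the square of the ratio of \<open>(a + b) / 2\<close> to \<open>sqrt (a b)\<close>.
\<close>

definition pl_mean :: "bool \<Rightarrow> real \<Rightarrow> real \<Rightarrow> real" where
  "pl_mean q s t = (if q then ((sqrt s + sqrt t) / 2)\<^sup>2 else (s + t) / 2)"

definition pl_gain :: "bool \<Rightarrow> real \<Rightarrow> real \<Rightarrow> real" where
  "pl_gain q s t = (if q then (sqrt s + sqrt t)\<^sup>2 / (4 * (sqrt s * sqrt t)) else 1)"

lemma pl_mean_pos: "0 < s \<Longrightarrow> 0 < t \<Longrightarrow> 0 < pl_mean q s t"
  using add_pos_pos[of "sqrt s" "sqrt t"] by (simp add: pl_mean_def)

lemma pl_mean_le_arith: "0 \<le> s \<Longrightarrow> 0 \<le> t \<Longrightarrow> pl_mean q s t \<le> (s + t) / 2"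
  using sum_squares_ge_zero[of "sqrt s - sqrt t" 0]
  by (simp add: pl_mean_def power2_eq_square field_simps)

lemma pl_gain_ge_1: "0 < s \<Longrightarrow> 0 < t \<Longrightarrow> 1 \<le> pl_gain q s t"
  using sum_squares_ge_zero[of "sqrt s - sqrt t" 0]
  by (simp add: pl_gain_def power2_eq_square field_simps)

lemma pl_gain_ge_of_ratio:
  assumes "0 < t" "16 * t \<le> s" shows "25 / 16 \<le> pl_gain True s t"
proof -
  let ?a = "sqrt s" and ?b = "sqrt t"
  have "sqrt (16 * t) \<le> ?a" using assms by (intro real_sqrt_le_mono)
  then have ab: "4 * ?b \<le> ?a" by (simp add: real_sqrt_mult)
  have b: "0 < ?b" using assms by simp
  have "0 \<le> (?a - 4 * ?b) * (4 * ?a - ?b)" using ab b by (intro mult_nonneg_nonneg) linarith+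
  \<comment> \<open>The first factor vanishes where the square roots have ratio 4, the borderline
    case of the bound.\<close>
  moreover have "4 * (?a + ?b)\<^sup>2 - 25 * (?a * ?b) = (?a - 4 * ?b) * (4 * ?a - ?b)"
    by algebra
  ultimately have "25 * (?a * ?b) \<le> 4 * (?a + ?b)\<^sup>2" by linarith
  moreover have "0 < 4 * (?a * ?b)" using ab b by (intro mult_pos_pos) linarith+
  ultimately have "25 / 16 \<le> (?a + ?b)\<^sup>2 / (4 * (?a * ?b))" by (subst pos_le_divide_eq) auto
  then show ?thesis by (simp add: pl_gain_def)
qed

section \<open>Averages of square roots on the half line\<close>

lemma nn_integral_even:
  fixes f :: "real \<Rightarrow> ennreal"
  assumes [measurable]: "f \<in> borel_measurable borel" and even: "\<And>s. f (- s) = f s"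
  shows "(\<integral>\<^sup>+x. f x \<partial>lborel) = 2 * (\<integral>\<^sup>+x. f x * indicator {0<..} x \<partial>lborel)"
proof -
  have "(\<integral>\<^sup>+x. f x * indicator {..<0} x \<partial>lborel) = (\<integral>\<^sup>+x. f (0 + (-1) * x) * indicator {..<0} (0 + (-1) * x) \<partial>lborel)"
    by (subst nn_integral_real_affine[where c="-1" and t=0]) auto
  also have "\<dots> = (\<integral>\<^sup>+x. f x * indicator {0<..} x \<partial>lborel)"
    by (intro nn_integral_cong) (auto simp: even split: split_indicator)
  finally have neg: "(\<integral>\<^sup>+x. f x * indicator {..<0} x \<partial>lborel) = (\<integral>\<^sup>+x. f x * indicator {0<..} x \<partial>lborel)" .
  have "AE x in lborel. x \<noteq> (0::real)" by (rule AE_lborel_singleton)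
  then have "(\<integral>\<^sup>+x. f x \<partial>lborel) = (\<integral>\<^sup>+x. f x * indicator {..<0} x + f x * indicator {0<..} x \<partial>lborel)"
    by (intro nn_integral_cong_AE, eventually_elim) (auto split: split_indicator)
  then show ?thesis by (simp add: nn_integral_add neg mult_2)
qed

text \<open>Substitution takes place on \<open>{0..real n}\<close>, where squaring is increasing,
  and monotone convergence extends it to the half line. For \<open>n = 0\<close> the interval
  degenerates and both integrals are 0.\<close>

lemma nn_integral_half_line_square:
  fixes f :: "real \<Rightarrow> ennreal"
  assumes [measurable]: "f \<in> borel_measurable borel"
  shows "(\<integral>\<^sup>+x. f x * indicator {0<..} x \<partial>lborel) = (\<integral>\<^sup>+a. f (a\<^sup>2) * ennreal (2 * a) * indicator {0<..} a \<partial>lborel)"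
proof -
  have eq: "(\<integral>\<^sup>+x. f x * indicator {0..(real n)\<^sup>2} x \<partial>lborel) = (\<integral>\<^sup>+a. f (a\<^sup>2) * ennreal (2 * a) * indicator {0..real n} a \<partial>lborel)" for n :: nat
  proof (cases "n = 0")
    case True
    have "AE x in lborel. x \<noteq> (0::real)" by (rule AE_lborel_singleton)
    then have "(\<integral>\<^sup>+x. f x * indicator {0..(real n)\<^sup>2} x \<partial>lborel) = (\<integral>\<^sup>+x. 0 \<partial>(lborel :: real measure))"
      by (intro nn_integral_cong_AE, eventually_elim) (auto simp: True split: split_indicator)
    moreover have "(\<integral>\<^sup>+a. f (a\<^sup>2) * ennreal (2 * a) * indicator {0..real n} a \<partial>lborel) = (\<integral>\<^sup>+x. 0 \<partial>(lborel :: real measure))"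
      using True by (intro nn_integral_cong) (auto split: split_indicator)
    ultimately show ?thesis by simp
  next
    case False
    have "((\<lambda>x::real. x\<^sup>2) has_real_derivative 2 * x) (at x)" for x
      by (auto intro!: derivative_eq_intros)
    then show ?thesis
      using nn_integral_substitution_aux[of f 0 "real n" "\<lambda>x. x\<^sup>2" "\<lambda>x. 2 * x"] False
      by (auto intro!: continuous_intros)
  qed
  have lim: "(\<integral>\<^sup>+x. g x * indicator {0<..} x \<partial>lborel) = (SUP n. \<integral>\<^sup>+x. g x * indicator {0..c n} x \<partial>lborel)"
    if [measurable]: "g \<in> borel_measurable borel" and "incseq c" and unb: "\<And>x. \<exists>n. x \<le> c n"
    for g :: "real \<Rightarrow> ennreal" and c :: "nat \<Rightarrow> real"
  proof -
    have "AE x in lborel. x \<noteq> (0::real)" by (rule AE_lborel_singleton)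
    then have "(\<integral>\<^sup>+x. g x * indicator {0<..} x \<partial>lborel) = (\<integral>\<^sup>+x. (SUP n. g x * indicator {0..c n} x) \<partial>lborel)"
    proof (intro nn_integral_cong_AE, eventually_elim)
      case (elim x)
      show ?case
      proof (cases "0 < x")
        case True
        obtain n where "x \<le> c n" using unb by auto
        then have "g x \<le> (SUP n. g x * indicator {0..c n} x)" using True
          by (intro SUP_upper2[of n]) auto
        moreover have "(SUP n. g x * indicator {0..c n} x) \<le> g x"
          by (intro SUP_least) (auto split: split_indicator)
        ultimately show ?thesis using True by simp
      qed (use elim in simp)
    qed
    also have "\<dots> = (SUP n. \<integral>\<^sup>+x. g x * indicator {0..c n} x \<partial>lborel)"
      using \<open>incseq c\<close>
      by (intro nn_integral_monotone_convergence_SUP)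
         (auto simp: incseq_def le_fun_def split: split_indicator intro: order_trans)
    finally show ?thesis .
  qed
  have "(\<integral>\<^sup>+x. f x * indicator {0<..} x \<partial>lborel) = (SUP n. \<integral>\<^sup>+x. f x * indicator {0..(real n)\<^sup>2} x \<partial>lborel)"
  proof (rule lim)
    show "\<exists>n. x \<le> (real n)\<^sup>2" for x
    proof -
      obtain n where "x \<le> real n" using real_arch_simple by auto
      also have "real n \<le> (real n)\<^sup>2"
        by (cases n) (auto simp: power2_eq_square mult_le_cancel_left1)
      finally show ?thesis by blast
    qed
  qed (auto simp: incseq_def)
  also have "\<dots> = (SUP n. \<integral>\<^sup>+a. f (a\<^sup>2) * ennreal (2 * a) * indicator {0..real n} a \<partial>lborel)" by (simp only: eq)
  also have "\<dots> = (\<integral>\<^sup>+a. f (a\<^sup>2) * ennreal (2 * a) * indicator {0<..} a \<partial>lborel)"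
    by (rule lim[symmetric]) (auto simp: incseq_def real_arch_simple)
  finally show ?thesis .
qed

text \<open>If \<open>q\<close> holds, substitution multiplies \<open>f\<close> and \<open>g\<close>
  by \<open>2 * a\<close> and \<open>2 * b\<close>, and \<open>h\<close> by \<open>a + b\<close> at
  the mean. The hypothesis may be weaker by the factor \<open>pl_gain\<close> because
  \<open>(a + b) ^ 2 / (4 * a * b)\<close> is exactly what these weights absorb.\<close>

lemma prekopa_leindler_half_line:
  fixes f g h :: "real \<Rightarrow> ennreal"
  assumes [measurable]: "f \<in> borel_measurable borel" "g \<in> borel_measurable borel" "h \<in> borel_measurable borel"
    and mid: "\<And>s t. 0 < s \<Longrightarrow> 0 < t \<Longrightarrow> f s * g t \<le> ennreal (pl_gain q s t) * (h (pl_mean q s t))\<^sup>2"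
  shows "(\<integral>\<^sup>+x. f x * indicator {0<..} x \<partial>lborel) * (\<integral>\<^sup>+x. g x * indicator {0<..} x \<partial>lborel)
    \<le> (\<integral>\<^sup>+x. h x * indicator {0<..} x \<partial>lborel)\<^sup>2"
proof (cases q)
  case False
  show ?thesis
  proof (rule prekopa_leindler_1d)
    show "f s * indicator {0<..} s * (g t * indicator {0<..} t) \<le> (h ((s + t) / 2) * indicator {0<..} ((s + t) / 2))\<^sup>2" for s t
      using mid[of s t] False by (auto simp: pl_gain_def pl_mean_def split: split_indicator)
  qed auto
next
  case True
  show ?thesis unfolding nn_integral_half_line_square[OF assms(1)] nn_integral_half_line_square[OF assms(2)]
    nn_integral_half_line_square[OF assms(3)]
  proof (rule prekopa_leindler_1d)
    fix a b :: real
    show "f (a\<^sup>2) * ennreal (2 * a) * indicator {0<..} a * (g (b\<^sup>2) * ennreal (2 * b) * indicator {0<..} b)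
       \<le> (h (((a + b) / 2)\<^sup>2) * ennreal (2 * ((a + b) / 2)) * indicator {0<..} ((a + b) / 2))\<^sup>2"
    proof (cases "0 < a \<and> 0 < b")
      case ab: True
      then have G: "pl_gain q (a\<^sup>2) (b\<^sup>2) = (a + b)\<^sup>2 / (4 * (a * b))" and M: "pl_mean q (a\<^sup>2) (b\<^sup>2) = ((a + b) / 2)\<^sup>2"
        using True by (auto simp: pl_gain_def pl_mean_def)
      have "f (a\<^sup>2) * ennreal (2 * a) * (g (b\<^sup>2) * ennreal (2 * b)) = (f (a\<^sup>2) * g (b\<^sup>2)) * ennreal (2 * a * (2 * b))"
        using ab by (simp add: ennreal_mult mult_ac)
      also have "\<dots> \<le> (ennreal ((a + b)\<^sup>2 / (4 * (a * b))) * (h (((a + b) / 2)\<^sup>2))\<^sup>2) * ennreal (2 * a * (2 * b))"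
        using mid[of "a\<^sup>2" "b\<^sup>2"] ab by (intro mult_right_mono) (auto simp: G M)
      also have "\<dots> = (h (((a + b) / 2)\<^sup>2))\<^sup>2 * (ennreal ((a + b)\<^sup>2 / (4 * (a * b))) * ennreal (2 * a * (2 * b)))"
        by (simp add: mult_ac)
      also have "ennreal ((a + b)\<^sup>2 / (4 * (a * b))) * ennreal (2 * a * (2 * b)) = ennreal ((a + b)\<^sup>2)"
        using ab by (subst ennreal_mult[symmetric]) (auto simp: field_simps)
      also have "(h (((a + b) / 2)\<^sup>2))\<^sup>2 * ennreal ((a + b)\<^sup>2) = (h (((a + b) / 2)\<^sup>2) * ennreal (2 * ((a + b) / 2)))\<^sup>2"
      proof -
        have "2 * ((a + b) / 2) = a + b" by simp
        then show ?thesis using ab by (simp only: power_mult_distrib) (simp add: ennreal_power del: ennreal_plus)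
      qed
      finally show ?thesis using ab by simp
    qed (auto split: split_indicator)
  qed auto
qed

lemma prekopa_leindler_even:
  fixes f g h :: "real \<Rightarrow> ennreal"
  assumes [measurable]: "f \<in> borel_measurable borel" "g \<in> borel_measurable borel" "h \<in> borel_measurable borel"
    and even: "\<And>s. f (- s) = f s" "\<And>s. g (- s) = g s" "\<And>s. h (- s) = h s"
    and mid: "\<And>s t. 0 < s \<Longrightarrow> 0 < t \<Longrightarrow> f s * g t \<le> ennreal (pl_gain q s t) * (h (pl_mean q s t))\<^sup>2"
  shows "(\<integral>\<^sup>+x. f x \<partial>lborel) * (\<integral>\<^sup>+x. g x \<partial>lborel) \<le> (\<integral>\<^sup>+x. h x \<partial>lborel)\<^sup>2"
proof -
  let ?p = "\<lambda>u::real\<Rightarrow>ennreal. \<integral>\<^sup>+x. u x * indicator {0<..} x \<partial>lborel"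
  have "(\<integral>\<^sup>+x. f x \<partial>lborel) * (\<integral>\<^sup>+x. g x \<partial>lborel) = 4 * (?p f * ?p g)"
  proof -
    have "(2 * A) * (2 * B) = 4 * (A * B)" for A B :: ennreal
    proof -
      have "(2 * A) * (2 * B) = (2 * 2) * (A * B)" by (simp only: mult_ac)
      then show ?thesis by simp
    qed
    then show ?thesis
      unfolding nn_integral_even[OF assms(1) even(1)] nn_integral_even[OF assms(2) even(2)] .
  qed
  also have "\<dots> \<le> 4 * (?p h)\<^sup>2"
    by (intro mult_left_mono prekopa_leindler_half_line[where q=q] mid) auto
  also have "\<dots> = (2 * ?p h)\<^sup>2" by (simp add: power_mult_distrib)
  finally show ?thesis by (simp add: nn_integral_even even)
qed

text \<open>Tensorization: by the induction hypothesis for sections, the integrals over the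
  remaining coordinates satisfy the one-dimensional condition in coordinate \<open>i\<close>.
  Evenness restricts the condition to positive coordinates, and \<open>q\<close> selects the mean
  for each coordinate separately.\<close>

lemma prekopa_leindler_unconditional:
  fixes q :: "'i \<Rightarrow> bool" and f g h :: "('i \<Rightarrow> real) \<Rightarrow> ennreal"
  assumes "finite I"
    and "f \<in> borel_measurable (PiM I (\<lambda>_. lborel))" "g \<in> borel_measurable (PiM I (\<lambda>_. lborel))" "h \<in> borel_measurable (PiM I (\<lambda>_. lborel))"
    and "\<And>x i. x \<in> I \<rightarrow>\<^sub>E UNIV \<Longrightarrow> i \<in> I \<Longrightarrow> f (x(i := - x i)) = f x"
    and "\<And>x i. x \<in> I \<rightarrow>\<^sub>E UNIV \<Longrightarrow> i \<in> I \<Longrightarrow> g (x(i := - x i)) = g x"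
    and "\<And>x i. x \<in> I \<rightarrow>\<^sub>E UNIV \<Longrightarrow> i \<in> I \<Longrightarrow> h (x(i := - x i)) = h x"
    and "\<And>x y. x \<in> I \<rightarrow>\<^sub>E UNIV \<Longrightarrow> y \<in> I \<rightarrow>\<^sub>E UNIV \<Longrightarrow> (\<And>i. i \<in> I \<Longrightarrow> 0 < x i \<and> 0 < y i) \<Longrightarrow>
        f x * g y \<le> ennreal (\<Prod>i\<in>I. pl_gain (q i) (x i) (y i)) * (h (\<lambda>i\<in>I. pl_mean (q i) (x i) (y i)))\<^sup>2"
  shows "(\<integral>\<^sup>+x. f x \<partial>PiM I (\<lambda>_. lborel)) * (\<integral>\<^sup>+x. g x \<partial>PiM I (\<lambda>_. lborel)) \<le> (\<integral>\<^sup>+x. h x \<partial>PiM I (\<lambda>_. lborel))\<^sup>2"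
  using assms
proof (induction I arbitrary: f g h rule: finite_induct)
  case empty
  have "f (\<lambda>_. undefined) * g (\<lambda>_. undefined) \<le> (h (\<lambda>_. undefined))\<^sup>2"
    using empty(7)[of "\<lambda>_. undefined" "\<lambda>_. undefined"] by (simp add: restrict_def)
  then show ?case by (simp add: PiM_empty nn_integral_count_space_finite)
next
  case (insert i I)
  interpret product_sigma_finite "\<lambda>_::'i. lborel :: real measure" ..
  note [measurable] = insert.prems(1-3)
  let ?L = "PiM I (\<lambda>_::'i. lborel :: real measure)"
  let ?J = "insert i I \<rightarrow>\<^sub>E (UNIV :: real set)" and ?LJ = "PiM (insert i I) (\<lambda>_::'i. lborel :: real measure)"
  have ext: "x(i := s) \<in> ?J" if "x \<in> I \<rightarrow>\<^sub>E UNIV" for x and s :: real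
    using that by (auto simp: PiE_iff extensional_def)
  have even: "(\<integral>\<^sup>+x. u (x(i := - s)) \<partial>?L) = (\<integral>\<^sup>+x. u (x(i := s)) \<partial>?L)"
    if sym: "\<And>x j. x \<in> ?J \<Longrightarrow> j \<in> insert i I \<Longrightarrow> u (x(j := - x j)) = u x" for u :: "_ \<Rightarrow> ennreal" and s :: real
  proof (rule nn_integral_cong)
    fix x :: "'i \<Rightarrow> real" assume "x \<in> space ?L"
    then have "x(i := s) \<in> ?J" by (intro ext) (simp add: space_PiM)
    from sym[OF this, of i] show "u (x(i := - s)) = u (x(i := s))" by simp
  qed
  have sect: "(\<lambda>x. u (x(i := s))) \<in> borel_measurable ?L"
    if "u \<in> borel_measurable ?LJ" for u :: "_ \<Rightarrow> ennreal" and s :: real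
  proof -
    note [measurable] = that
    show ?thesis by measurable
  qed
  have marg: "(\<lambda>s. \<integral>\<^sup>+x. u (x(i := s)) \<partial>?L) \<in> borel_measurable borel"
    if "u \<in> borel_measurable ?LJ" for u :: "_ \<Rightarrow> ennreal"
  proof -
    note [measurable] = that
    have "(\<lambda>s. \<integral>\<^sup>+x. u (x(i := s)) \<partial>?L) \<in> borel_measurable lborel"
      by (rule sigma_finite_measure.borel_measurable_nn_integral) (auto intro: sigma_finite insert.hyps)
    then show ?thesis by simp
  qed
  have "(\<integral>\<^sup>+s. (\<integral>\<^sup>+x. f (x(i := s)) \<partial>?L) \<partial>lborel) * (\<integral>\<^sup>+s. (\<integral>\<^sup>+x. g (x(i := s)) \<partial>?L) \<partial>lborel)
      \<le> (\<integral>\<^sup>+s. (\<integral>\<^sup>+x. h (x(i := s)) \<partial>?L) \<partial>lborel)\<^sup>2"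
  proof (rule prekopa_leindler_even)
    fix s t :: real assume st: "0 < s" "0 < t"
    \<comment> \<open>The gain of coordinate \<open>i\<close> is carried through the induction
      hypothesis as a constant in front of \<open>h\<close>; as \<open>h\<close> enters squared, its
      square root is needed.\<close>
    define c where "c = sqrt (pl_gain (q i) s t)"
    define r where "r = pl_mean (q i) s t"
    have gain: "1 \<le> pl_gain (q i) s t" by (rule pl_gain_ge_1[OF st])
    then have c: "0 \<le> c" "c\<^sup>2 = pl_gain (q i) s t" by (auto simp: c_def)
    then have c2: "(ennreal c)\<^sup>2 = ennreal (pl_gain (q i) s t)" by (simp add: ennreal_power)
    have "(\<integral>\<^sup>+x. f (x(i := s)) \<partial>?L) * (\<integral>\<^sup>+x. g (x(i := t)) \<partial>?L) \<le> (\<integral>\<^sup>+x. ennreal c * h (x(i := r)) \<partial>?L)\<^sup>2"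
    proof (rule insert.IH)
      show "(\<lambda>x. ennreal c * h (x(i := r))) \<in> borel_measurable ?L"
        using sect[OF insert.prems(3)] by measurable
      fix x :: "'i \<Rightarrow> real" assume x: "x \<in> I \<rightarrow>\<^sub>E UNIV"
      have swap: "(x(j := - x j))(i := s) = (x(i := s))(j := - (x(i := s)) j)" if "j \<in> I" for j and s :: real
        using that insert.hyps by (auto simp: fun_eq_iff)
      show "f ((x(j := - x j))(i := s)) = f (x(i := s))" if "j \<in> I" for j
        unfolding swap[OF that] using that by (intro insert.prems ext x) auto
      show "g ((x(j := - x j))(i := t)) = g (x(i := t))" if "j \<in> I" for j
        unfolding swap[OF that] using that by (intro insert.prems ext x) auto
      show "ennreal c * h ((x(j := - x j))(i := r)) = ennreal c * h (x(i := r))" if "j \<in> I" for j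
      proof -
        have "h ((x(i := r))(j := - (x(i := r)) j)) = h (x(i := r))"
          using that by (intro insert.prems ext x) auto
        then show ?thesis by (simp only: swap[OF that])
      qed
      fix y :: "'i \<Rightarrow> real" assume y: "y \<in> I \<rightarrow>\<^sub>E UNIV" and pos: "\<And>j. j \<in> I \<Longrightarrow> 0 < x j \<and> 0 < y j"
      have "f (x(i := s)) * g (y(i := t)) \<le> ennreal (\<Prod>j\<in>insert i I. pl_gain (q j) ((x(i := s)) j) ((y(i := t)) j))
          * (h (\<lambda>j\<in>insert i I. pl_mean (q j) ((x(i := s)) j) ((y(i := t)) j)))\<^sup>2"
        using pos st by (intro insert.prems ext x y) auto
      also have "(\<lambda>j\<in>insert i I. pl_mean (q j) ((x(i := s)) j) ((y(i := t)) j)) = (\<lambda>j\<in>I. pl_mean (q j) (x j) (y j))(i := r)"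
        using insert.hyps by (auto simp: fun_eq_iff r_def)
      also have "(\<Prod>j\<in>insert i I. pl_gain (q j) ((x(i := s)) j) ((y(i := t)) j)) = c\<^sup>2 * (\<Prod>j\<in>I. pl_gain (q j) (x j) (y j))"
        using insert.hyps by (auto simp: c intro!: prod.cong)
      also have "ennreal (c\<^sup>2 * (\<Prod>j\<in>I. pl_gain (q j) (x j) (y j))) = ennreal (\<Prod>j\<in>I. pl_gain (q j) (x j) (y j)) * (ennreal c)\<^sup>2"
      proof -
        have "0 \<le> (\<Prod>j\<in>I. pl_gain (q j) (x j) (y j))"
          using pos by (intro prod_nonneg) (auto intro!: order_trans[OF zero_le_one pl_gain_ge_1])
        then show ?thesis using c(1) by (simp only: ennreal_mult zero_le_power2) (simp add: ennreal_power mult.commute)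
      qed
      finally show "f (x(i := s)) * g (y(i := t)) \<le> ennreal (\<Prod>j\<in>I. pl_gain (q j) (x j) (y j))
          * (ennreal c * h ((\<lambda>j\<in>I. pl_mean (q j) (x j) (y j))(i := r)))\<^sup>2"
        by (simp only: power_mult_distrib mult.assoc)
    qed (intro sect insert.prems)+
    also have "(\<integral>\<^sup>+x. ennreal c * h (x(i := r)) \<partial>?L) = ennreal c * (\<integral>\<^sup>+x. h (x(i := r)) \<partial>?L)"
      by (rule nn_integral_cmult) (rule sect[OF insert.prems(3)])
    finally show "(\<integral>\<^sup>+x. f (x(i := s)) \<partial>?L) * (\<integral>\<^sup>+x. g (x(i := t)) \<partial>?L)
       \<le> ennreal (pl_gain (q i) s t) * (\<integral>\<^sup>+x. h (x(i := pl_mean (q i) s t)) \<partial>?L)\<^sup>2"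
      by (simp only: power_mult_distrib c2 r_def)
  qed (intro marg even insert.prems | assumption)+
  then show ?case
    using insert.hyps by (simp add: product_nn_integral_insert_rev)
qed

section \<open>Unconditional log-concave measures\<close>

text \<open>Everything is phrased for a law on functions over a finite index set, so that the sample
  space of \<open>X\<close> disappears. The second moment is a nonnegative integral, which keeps
  questions of integrability out of the analysis.\<close>

locale uncond_log_concave =
  fixes I :: "'i set" and \<mu> :: "('i \<Rightarrow> real) measure"
  assumes finite_I: "finite I"
    and prob_\<mu>: "prob_space \<mu>"
    and sets_\<mu>: "sets \<mu> = sets (PiM I (\<lambda>_. borel))"
    and sign_invariant: "\<And>\<eta> A. (\<And>i. i \<in> I \<Longrightarrow> \<eta> i \<in> {-1, 1}) \<Longrightarrow> A \<in> sets \<mu> \<Longrightarrow>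
       measure \<mu> {x \<in> space \<mu>. (\<lambda>i\<in>I. \<eta> i * x i) \<in> A} = measure \<mu> A"
    and log_concave: "\<And>A B l. A \<in> sets \<mu> \<Longrightarrow> B \<in> sets \<mu> \<Longrightarrow> A \<noteq> {} \<Longrightarrow> B \<noteq> {} \<Longrightarrow> 0 < l \<Longrightarrow> l < 1 \<Longrightarrow>
       {(\<lambda>i\<in>I. l * a i + (1 - l) * b i) | a b. a \<in> A \<and> b \<in> B} \<in> sets \<mu> \<Longrightarrow>
       measure \<mu> A powr l * measure \<mu> B powr (1 - l)
         \<le> measure \<mu> {(\<lambda>i\<in>I. l * a i + (1 - l) * b i) | a b. a \<in> A \<and> b \<in> B}"
    and second_moment: "\<And>i. i \<in> I \<Longrightarrow> (\<integral>\<^sup>+x. ennreal ((x i)\<^sup>2) \<partial>\<mu>) \<le> 1"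
begin

sublocale \<mu>: prob_space \<mu> by (rule prob_\<mu>)

abbreviation \<Omega> :: "('i \<Rightarrow> real) set" where "\<Omega> \<equiv> I \<rightarrow>\<^sub>E UNIV"

abbreviation Leb :: "('i \<Rightarrow> real) measure" where "Leb \<equiv> PiM I (\<lambda>_. lborel)"

lemma space_Leb: "space Leb = \<Omega>"
  by (simp add: space_PiM)

lemma space_\<mu>: "space \<mu> = \<Omega>"
  using sets_eq_imp_space_eq[OF sets_\<mu>] by (simp add: space_PiM)

lemma sets_\<mu>_Leb: "sets \<mu> = sets Leb"
  unfolding sets_\<mu> by (rule sets_PiM_cong) auto

declare sets_\<mu>_Leb [measurable_cong]
declare finite_I [simp]

lemma component_measurable:
  assumes "i \<in> I" shows "(\<lambda>x. x i) \<in> borel_measurable Leb" "(\<lambda>x. x i) \<in> borel_measurable \<mu>"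
proof -
  show *: "(\<lambda>x. x i) \<in> borel_measurable Leb"
    using measurable_component_singleton[OF assms, of "\<lambda>_. lborel :: real measure"] by simp
  then show "(\<lambda>x. x i) \<in> borel_measurable \<mu>" by (simp cong: measurable_cong_sets add: sets_\<mu>_Leb)
qed
declare component_measurable [measurable (raw)]

lemma reflect:
  assumes "i \<in> I" "A \<in> sets \<mu>" shows "measure \<mu> {x \<in> space \<mu>. x(i := - x i) \<in> A} = measure \<mu> A"
proof -
  have "(\<lambda>j\<in>I. (if j = i then -1 else 1) * x j) = x(i := - x i)" if "x \<in> space \<mu>" for x
    using that assms(1) by (auto simp: space_\<mu> PiE_iff extensional_def fun_eq_iff)
  then have "{x \<in> space \<mu>. x(i := - x i) \<in> A} = {x \<in> space \<mu>. (\<lambda>j\<in>I. (if j = i then -1 else 1) * x j) \<in> A}"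
    by auto
  then show ?thesis using sign_invariant[of "\<lambda>j. if j = i then -1 else 1", OF _ assms(2)] by auto
qed

lemma sigma_finite_Leb: "sigma_finite_measure Leb"
proof -
  interpret product_sigma_finite "\<lambda>_::'i. lborel :: real measure" ..
  show ?thesis by (rule sigma_finite) (rule finite_I)
qed

section \<open>Masses of unit cubes as a density\<close>

definition cube :: "('i \<Rightarrow> real) \<Rightarrow> ('i \<Rightarrow> real) set" where
  "cube a = {x \<in> \<Omega>. \<forall>i\<in>I. \<bar>x i - a i\<bar> \<le> 1 / 2}"

lemma cube_sets [measurable]: "cube a \<in> sets Leb"
  unfolding cube_def space_Leb[symmetric] by measurable

definition F :: "('i \<Rightarrow> real) \<Rightarrow> real" where "F a = measure \<mu> (cube a)"

lemma F_nonneg: "0 \<le> F a" by (simp add: F_def)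

lemma F_cong: "(\<And>i. i \<in> I \<Longrightarrow> a i = b i) \<Longrightarrow> F a = F b"
  unfolding F_def cube_def by (rule arg_cong[where f="measure \<mu>"]) auto

text \<open>The Minkowski combination of two translates of a cube is again a translate of it, hence
  measurable. So the assumed inequality applies to cubes as it stands.\<close>

lemma F_convex_comb:
  assumes "0 < l" "l < 1"
  shows "F a powr l * F b powr (1 - l) \<le> F (\<lambda>i. l * a i + (1 - l) * b i)"
proof -
  let ?c = "\<lambda>i. l * a i + (1 - l) * b i"
  let ?m = "{(\<lambda>i\<in>I. l * x i + (1 - l) * y i) | x y. x \<in> cube a \<and> y \<in> cube b}"
  have "?m = cube ?c"
  proof (intro set_eqI iffI)
    fix z assume "z \<in> ?m"
    then obtain x y where z: "z = (\<lambda>i\<in>I. l * x i + (1 - l) * y i)" and xy: "x \<in> cube a" "y \<in> cube b"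
      by auto
    have "\<bar>l * x i + (1 - l) * y i - ?c i\<bar> \<le> 1 / 2" if "i \<in> I" for i
    proof -
      have "l * x i + (1 - l) * y i - ?c i = l * (x i - a i) + (1 - l) * (y i - b i)"
        by (simp add: algebra_simps)
      also have "\<bar>\<dots>\<bar> \<le> l * \<bar>x i - a i\<bar> + (1 - l) * \<bar>y i - b i\<bar>"
        using assms abs_triangle_ineq[of "l * (x i - a i)" "(1 - l) * (y i - b i)"] by (simp add: abs_mult)
      also have "\<dots> \<le> l * (1/2) + (1 - l) * (1/2)"
        using xy that assms by (intro add_mono mult_left_mono) (auto simp: cube_def)
      finally show ?thesis by (simp add: field_simps)
    qed
    then show "z \<in> cube ?c" by (auto simp: z cube_def)
  next
    fix z assume z: "z \<in> cube ?c"
    \<comment> \<open>Both centres are moved by the displacement of \<open>z\<close> from the centre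
      \<open>?c\<close>; the combination of the two translates is then \<open>z\<close>.\<close>
    define x y where "x = (\<lambda>i\<in>I. a i + (z i - ?c i))" and "y = (\<lambda>i\<in>I. b i + (z i - ?c i))"
    have "x \<in> cube a" "y \<in> cube b" using z by (auto simp: x_def y_def cube_def)
    moreover have "z = (\<lambda>i\<in>I. l * x i + (1 - l) * y i)"
    proof
      fix i
      show "z i = (\<lambda>i\<in>I. l * x i + (1 - l) * y i) i"
        using z by (cases "i \<in> I") (auto simp: x_def y_def cube_def PiE_iff extensional_def algebra_simps)
    qed
    ultimately show "z \<in> ?m" by blast
  qed
  moreover have "cube a \<noteq> {}" for a
  proof -
    have "restrict a I \<in> cube a" by (auto simp: cube_def)
    then show ?thesis by auto
  qed
  ultimately show ?thesis
    using log_concave[of "cube a" "cube b" l] assms unfolding F_def by (simp add: sets_\<mu>_Leb)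
qed

lemma F_flip:
  assumes i: "i \<in> I" shows "F (a(i := - a i)) = F a"
proof -
  have "cube (a(i := - a i)) = {x \<in> space \<mu>. x(i := - x i) \<in> cube a}"
  proof -
    have *: "\<bar>x i + a i\<bar> \<le> 1/2 \<longleftrightarrow> \<bar>- x i - a i\<bar> \<le> 1/2" for x :: "'i \<Rightarrow> real" by linarith
    have "x \<in> cube (a(i := - a i)) \<longleftrightarrow> x(i := - x i) \<in> cube a" if "x \<in> \<Omega>" for x
    proof -
      have "(\<forall>j\<in>I. \<bar>x j - (a(i := - a i)) j\<bar> \<le> 1/2) \<longleftrightarrow> (\<forall>j\<in>I. \<bar>(x(i := - x i)) j - a j\<bar> \<le> 1/2)"
        by (intro ball_cong refl) (use * in auto)
      moreover have "x(i := - x i) \<in> \<Omega>" using that i by (auto simp: PiE_iff extensional_def)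
      ultimately show ?thesis using that by (simp add: cube_def)
    qed
    moreover have "x \<in> \<Omega>" if "x \<in> cube b" for x b using that by (simp add: cube_def)
    ultimately show ?thesis unfolding space_\<mu> by blast
  qed
  then show ?thesis using reflect[OF i, of "cube a"] by (simp add: F_def sets_\<mu>_Leb)
qed

text \<open>The point \<open>a(i := c)\<close> lies between \<open>a\<close> and its reflection in
  coordinate \<open>i\<close>. \<open>F\<close> takes the same value at these two, and by
  log-concavity no smaller value in between.\<close>

lemma F_antimono_coord:
  assumes i: "i \<in> I" and c: "\<bar>c\<bar> \<le> \<bar>a i\<bar>" shows "F a \<le> F (a(i := c))"
proof (cases "c = a i \<or> c = - a i")
  case True
  then show ?thesis using F_flip[OF i, of a] by auto
next
  case False
  then have ai: "a i \<noteq> 0" using c by auto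
  define l where "l = (c / a i + 1) / 2"
  have "\<bar>c / a i\<bar> < 1" using c False ai by (auto simp: abs_divide field_simps abs_if split: if_splits)
  then have "- 1 < c / a i" "c / a i < 1" unfolding abs_less_iff by linarith+
  then have l: "0 < l" "l < 1" by (auto simp: l_def)
  have "F a = F a powr l * F (a(i := - a i)) powr (1 - l)"
    using F_nonneg[of a] by (simp add: F_flip[OF i] flip: powr_add)
  also have "\<dots> \<le> F (\<lambda>j. l * a j + (1 - l) * (a(i := - a i)) j)"
    by (rule F_convex_comb[OF l])
  also have "(\<lambda>j. l * a j + (1 - l) * (a(i := - a i)) j) = a(i := c)"
    using ai by (auto simp: fun_eq_iff l_def field_simps)
  finally show ?thesis .
qed

lemma F_antimono:
  assumes "\<And>i. i \<in> I \<Longrightarrow> \<bar>b i\<bar> \<le> \<bar>a i\<bar>" shows "F a \<le> F b"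
proof -
  have "F a \<le> F (\<lambda>i. if i \<in> J then b i else a i)" if "J \<subseteq> I" for J
    using finite_subset[OF that finite_I] that
  proof (induction J rule: finite_induct)
    case insert: (insert j J)
    let ?a = "\<lambda>i. if i \<in> J then b i else a i"
    have "F a \<le> F ?a" using insert by auto
    also have "\<dots> \<le> F (?a(j := b j))" using insert assms by (intro F_antimono_coord) auto
    also have "?a(j := b j) = (\<lambda>i. if i \<in> insert j J then b i else a i)" by auto
    finally show ?case .
  qed simp
  from this[of I] have "F a \<le> F (\<lambda>i. if i \<in> I then b i else a i)" by simp
  also have "\<dots> = F b" by (rule F_cong) simp
  finally show ?thesis .
qed

lemma F_midpoint: "F a * F b \<le> (F (\<lambda>i. (a i + b i) / 2))\<^sup>2"
proof -
  have "(F a powr (1/2) * F b powr (1 - 1/2))\<^sup>2 \<le> (F (\<lambda>i. 1/2 * a i + (1 - 1/2) * b i))\<^sup>2"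
    by (intro power_mono F_convex_comb) auto
  also have "(\<lambda>i. 1/2 * a i + (1 - 1/2) * b i) = (\<lambda>i. (a i + b i) / 2)" by (simp add: field_simps)
  finally show ?thesis using F_nonneg[of a] F_nonneg[of b]
    by (simp add: power_mult_distrib powr_half_sqrt)
qed

text \<open>The sections of this set of pairs are the cubes around either component. This symmetry
  yields both the measurability of \<open>F\<close> and the formula for
  \<open>emeasure \<nu>\<close> by Fubini.\<close>

lemma near_sets [measurable]: "{z \<in> space (Leb \<Otimes>\<^sub>M \<mu>). \<forall>i\<in>I. \<bar>snd z i - fst z i\<bar> \<le> 1 / 2} \<in> sets (Leb \<Otimes>\<^sub>M \<mu>)"
  by measurable

lemma F_measurable [measurable]: "F \<in> borel_measurable Leb"
proof -
  let ?Q = "{z \<in> space (Leb \<Otimes>\<^sub>M \<mu>). \<forall>i\<in>I. \<bar>snd z i - fst z i\<bar> \<le> 1 / 2}"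
  have "(\<lambda>a. emeasure \<mu> (Pair a -` ?Q)) \<in> borel_measurable Leb"
    by (rule \<mu>.measurable_emeasure_Pair) (rule near_sets)
  then have "(\<lambda>a. measure \<mu> (Pair a -` ?Q)) \<in> borel_measurable Leb"
    unfolding measure_def by measurable
  moreover have "measure \<mu> (Pair a -` ?Q) = F a" if "a \<in> space Leb" for a
    using that unfolding F_def by (intro arg_cong[where f="measure \<mu>"]) (auto simp: cube_def space_pair_measure space_\<mu>)
  ultimately show ?thesis by (simp cong: measurable_cong)
qed

text \<open>
  \<open>\<nu>\<close> is the law of \<open>X + U\<close> with \<open>U\<close> uniform on the cube \<open>cube 0\<close> and independent of \<open>X\<close>. Its density
  inherits log-concavity directly from the inequality for cubes, so that no density of \<open>\<mu>\<close> is needed.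
\<close>

definition \<nu> :: "('i \<Rightarrow> real) measure" where "\<nu> = density Leb (\<lambda>a. ennreal (F a))"

lemma sets_\<nu> [simp, measurable_cong]: "sets \<nu> = sets Leb" by (simp add: \<nu>_def)
lemma space_\<nu>: "space \<nu> = \<Omega>" by (simp add: \<nu>_def space_PiM)

lemma emeasure_Leb_cube: "emeasure Leb (cube x) = 1"
proof -
  interpret product_sigma_finite "\<lambda>_::'i. lborel :: real measure" ..
  have "cube x = (\<Pi>\<^sub>E i\<in>I. {x i - 1/2..x i + 1/2})"
  proof -
    have "\<bar>a - b\<bar> \<le> 1/2 \<longleftrightarrow> a \<in> {b - 1/2..b + 1/2}" for a b :: real
      unfolding abs_le_iff atLeastAtMost_iff by linarith
    then show ?thesis by (auto simp: cube_def PiE_iff extensional_def)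
  qed
  then show ?thesis by (simp add: emeasure_PiM finite_I)
qed

text \<open>Fubini for the pairs within distance 1/2 in every coordinate. The integrand is the
  conditional probability that \<open>X + U\<close> falls into \<open>E\<close>, given
  \<open>X = x\<close>.\<close>

lemma emeasure_\<nu>:
  assumes [measurable]: "E \<in> sets Leb"
  shows "emeasure \<nu> E = (\<integral>\<^sup>+x. emeasure Leb (E \<inter> cube x) \<partial>\<mu>)"
proof -
  interpret L: sigma_finite_measure Leb by (rule sigma_finite_Leb)
  interpret pair_sigma_finite Leb \<mu> ..
  let ?Q = "{z \<in> space (Leb \<Otimes>\<^sub>M \<mu>). \<forall>i\<in>I. \<bar>snd z i - fst z i\<bar> \<le> 1 / 2}"
  have "emeasure \<nu> E = (\<integral>\<^sup>+a. ennreal (F a) * indicator E a \<partial>Leb)"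
    unfolding \<nu>_def by (rule emeasure_density) auto
  also have "\<dots> = (\<integral>\<^sup>+a. (\<integral>\<^sup>+x. indicator ?Q (a, x) * indicator E a \<partial>\<mu>) \<partial>Leb)"
  proof (rule nn_integral_cong)
    fix a assume a: "a \<in> space Leb"
    have "(\<integral>\<^sup>+x. indicator ?Q (a, x) \<partial>\<mu>) = (\<integral>\<^sup>+x. indicator (cube a) x \<partial>\<mu>)"
      using a by (intro nn_integral_cong) (auto simp: cube_def space_pair_measure space_\<mu> split: split_indicator)
    also have "\<dots> = ennreal (F a)"
      by (simp add: F_def \<mu>.emeasure_eq_measure sets_\<mu>_Leb)
    finally have "(\<integral>\<^sup>+x. indicator ?Q (a, x) \<partial>\<mu>) = ennreal (F a)" .
    then show "ennreal (F a) * indicator E a = (\<integral>\<^sup>+x. indicator ?Q (a, x) * indicator E a \<partial>\<mu>)"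
    proof (subst nn_integral_multc)
      have [measurable]: "Pair a \<in> measurable \<mu> (Leb \<Otimes>\<^sub>M \<mu>)" by (rule measurable_Pair1'[OF a])
      show "(\<lambda>x. indicator ?Q (a, x)) \<in> borel_measurable \<mu>"
        by (rule measurable_compose[OF \<open>Pair a \<in> _\<close>]) (rule borel_measurable_indicator[OF near_sets])
    qed simp
  qed
  also have "\<dots> = (\<integral>\<^sup>+x. (\<integral>\<^sup>+a. indicator ?Q (a, x) * indicator E a \<partial>Leb) \<partial>\<mu>)"
    by (rule Fubini'[symmetric]) measurable
  also have "\<dots> = (\<integral>\<^sup>+x. emeasure Leb (E \<inter> cube x) \<partial>\<mu>)"
  proof (rule nn_integral_cong)
    fix x assume x: "x \<in> space \<mu>"
    have "(\<integral>\<^sup>+a. indicator ?Q (a, x) * indicator E a \<partial>Leb) = (\<integral>\<^sup>+a. indicator (E \<inter> cube x) a \<partial>Leb)"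
      using x by (intro nn_integral_cong) (auto simp: cube_def space_pair_measure space_\<mu> space_PiM abs_minus_commute split: split_indicator)
    then show "(\<integral>\<^sup>+a. indicator ?Q (a, x) * indicator E a \<partial>Leb) = emeasure Leb (E \<inter> cube x)" by simp
  qed
  finally show ?thesis .
qed

sublocale \<nu>: prob_space \<nu>
proof
  have "emeasure Leb (space Leb \<inter> cube x) = 1" for x
    using emeasure_Leb_cube[of x] by (simp add: cube_def space_Leb Int_absorb1 subset_eq)
  then show "emeasure \<nu> (space \<nu>) = 1"
    using emeasure_\<nu>[of "space Leb"] by (simp add: \<nu>_def \<mu>.emeasure_space_1)
qed

text \<open>If \<open>E\<close> contains all perturbations of points of \<open>E1\<close> by at most
  1/2 in each coordinate, then \<open>X\<close> in \<open>E1\<close> forces \<open>X + U\<close> in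
  \<open>E\<close>. Probability bounds pass between \<open>\<mu>\<close> and \<open>\<nu>\<close> in
  this way, at the price of a bounded change of thresholds.\<close>

lemma measure_le_\<nu>:
  assumes [measurable]: "E1 \<in> sets \<mu>" "E \<in> sets Leb"
    and near: "\<And>x a. x \<in> E1 \<Longrightarrow> a \<in> \<Omega> \<Longrightarrow> (\<And>i. i \<in> I \<Longrightarrow> \<bar>x i - a i\<bar> \<le> 1/2) \<Longrightarrow> a \<in> E"
  shows "measure \<mu> E1 \<le> measure \<nu> E"
proof -
  have "emeasure \<mu> E1 = (\<integral>\<^sup>+x. indicator E1 x \<partial>\<mu>)" by simp
  also have "\<dots> \<le> (\<integral>\<^sup>+x. emeasure Leb (E \<inter> cube x) \<partial>\<mu>)"
  proof (rule nn_integral_mono)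
    fix x
    show "indicator E1 x \<le> emeasure Leb (E \<inter> cube x)"
    proof (cases "x \<in> E1")
      case True
      then have "E \<inter> cube x = cube x" using near[of x] by (auto simp: cube_def abs_minus_commute)
      then show ?thesis by (simp add: emeasure_Leb_cube True)
    qed simp
  qed
  also have "\<dots> = emeasure \<nu> E" by (simp add: emeasure_\<nu>)
  finally show ?thesis by (simp add: \<mu>.emeasure_eq_measure \<nu>.emeasure_eq_measure)
qed

definition usym :: "('i \<Rightarrow> real) set \<Rightarrow> bool" where
  "usym E \<longleftrightarrow> (\<forall>x\<in>\<Omega>. \<forall>i\<in>I. x(i := - x i) \<in> E \<longleftrightarrow> x \<in> E)"

text \<open>
  Coordinates in which points of \<open>Y\<close> and \<open>B\<close> differ by a large factor make \<open>\<Gamma>\<close> exponentially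
  large in their number; this replaces independence of the coordinates.
\<close>

lemma gain_inequality:
  assumes [measurable]: "Y \<in> sets Leb" "B \<in> sets Leb" "Z \<in> sets Leb"
    and sym: "usym Y" "usym B" "usym Z"
    and \<Gamma>: "0 < \<Gamma>"
    and mean: "\<And>x y. x \<in> Y \<Longrightarrow> y \<in> B \<Longrightarrow> (\<And>i. i \<in> I \<Longrightarrow> 0 < x i \<and> 0 < y i) \<Longrightarrow>
       (\<lambda>i\<in>I. pl_mean (q i) (x i) (y i)) \<in> Z \<and> \<Gamma> \<le> (\<Prod>i\<in>I. pl_gain (q i) (x i) (y i))"
  shows "\<Gamma> * (measure \<nu> Y * measure \<nu> B) \<le> (measure \<nu> Z)\<^sup>2"
proof -
  define c where "c = 1 / sqrt \<Gamma>"
  have c: "0 < c" "c\<^sup>2 = 1 / \<Gamma>" using \<Gamma> by (auto simp: c_def power_divide)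
  define f g h where "f = (\<lambda>x. ennreal (F x * indicator Y x))" and "g = (\<lambda>x. ennreal (F x * indicator B x))"
    and "h = (\<lambda>x. ennreal (c * F x * indicator Z x))"
  have int: "(\<integral>\<^sup>+x. ennreal (F x * indicator E x) \<partial>Leb) = ennreal (measure \<nu> E)"
    if [measurable]: "E \<in> sets Leb" for E
  proof -
    have "ennreal (measure \<nu> E) = (\<integral>\<^sup>+x. ennreal (F x) * indicator E x \<partial>Leb)"
      unfolding \<nu>.emeasure_eq_measure[symmetric] unfolding \<nu>_def by (rule emeasure_density) auto
    then show ?thesis by (simp add: F_nonneg ennreal_mult ennreal_indicator)
  qed
  have flip: "F (x(i := - x i)) * indicator E (x(i := - x i)) = F x * (indicator E x :: real)"
    if "usym E" "x \<in> \<Omega>" "i \<in> I" for E x i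
    using that F_flip by (auto simp: usym_def split: split_indicator)
  have "(\<integral>\<^sup>+x. f x \<partial>Leb) * (\<integral>\<^sup>+x. g x \<partial>Leb) \<le> (\<integral>\<^sup>+x. h x \<partial>Leb)\<^sup>2"
  proof (rule prekopa_leindler_unconditional)
    fix x i assume xi: "x \<in> \<Omega>" "i \<in> I"
    show "f (x(i := - x i)) = f x" "g (x(i := - x i)) = g x" "h (x(i := - x i)) = h x"
      unfolding f_def g_def h_def mult.assoc using flip[OF _ xi] sym by simp_all
  next
    fix x y :: "'i \<Rightarrow> real"
    assume x: "x \<in> \<Omega>" and y: "y \<in> \<Omega>" and pos: "\<And>i. i \<in> I \<Longrightarrow> 0 < x i \<and> 0 < y i"
    let ?z = "\<lambda>i\<in>I. pl_mean (q i) (x i) (y i)" and ?G = "\<Prod>i\<in>I. pl_gain (q i) (x i) (y i)"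
    show "f x * g y \<le> ennreal ?G * (h ?z)\<^sup>2"
    proof (cases "x \<in> Y \<and> y \<in> B")
      case True
      then have z: "?z \<in> Z" "\<Gamma> \<le> ?G" using mean[of x y] pos by auto
      \<comment> \<open>Log-concavity controls \<open>F\<close> at the arithmetic mean;
        \<open>pl_mean\<close> is no larger, so monotonicity in each absolute value moves the bound
        there for free.\<close>
      have "F (\<lambda>i. (x i + y i) / 2) \<le> F ?z"
      proof (rule F_antimono)
        fix i assume i: "i \<in> I"
        then have "0 < pl_mean (q i) (x i) (y i)" "pl_mean (q i) (x i) (y i) \<le> (x i + y i) / 2"
          using pos[OF i] pl_mean_pos pl_mean_le_arith[of "x i" "y i" "q i"] by auto
        then show "\<bar>?z i\<bar> \<le> \<bar>(x i + y i) / 2\<bar>" using i by simp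
      qed
      then have "(F (\<lambda>i. (x i + y i) / 2))\<^sup>2 \<le> (F ?z)\<^sup>2" using F_nonneg by (intro power_mono)
      then have "F x * F y \<le> (F ?z)\<^sup>2" using F_midpoint[of x y] by simp
      also have "\<dots> = \<Gamma> * (c * F ?z)\<^sup>2" using \<Gamma> by (simp add: power_mult_distrib c)
      also have "\<dots> \<le> ?G * (c * F ?z)\<^sup>2" using z by (intro mult_right_mono) auto
      finally have "ennreal (F x * F y) \<le> ennreal (?G * (c * F ?z)\<^sup>2)" by (rule ennreal_leI)
      also have "\<dots> = ennreal ?G * (ennreal (c * F ?z))\<^sup>2"
        using c F_nonneg[of ?z] z \<Gamma> by (subst ennreal_mult) (auto simp: ennreal_power)
      finally show ?thesis using True z F_nonneg by (simp add: f_def g_def h_def ennreal_mult)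
    qed (auto simp: f_def g_def)
  qed (auto simp: f_def g_def h_def)
  moreover have "(\<integral>\<^sup>+x. h x \<partial>Leb) = ennreal (c * measure \<nu> Z)"
  proof -
    have "(\<integral>\<^sup>+x. h x \<partial>Leb) = (\<integral>\<^sup>+x. ennreal c * ennreal (F x * indicator Z x) \<partial>Leb)"
      using c F_nonneg unfolding h_def by (intro nn_integral_cong) (simp add: ennreal_mult[symmetric] mult.assoc)
    also have "\<dots> = ennreal c * ennreal (measure \<nu> Z)" by (subst nn_integral_cmult) (auto simp: int)
    finally show ?thesis using c by (simp add: ennreal_mult)
  qed
  ultimately have "ennreal (measure \<nu> Y) * ennreal (measure \<nu> B) \<le> (ennreal (c * measure \<nu> Z))\<^sup>2"
    by (simp add: f_def g_def int)
  then have "measure \<nu> Y * measure \<nu> B \<le> (c * measure \<nu> Z)\<^sup>2"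
    using c by (simp add: ennreal_power ennreal_mult[symmetric] ennreal_le_iff)
  then show ?thesis using \<Gamma> by (simp add: power_mult_distrib c field_simps)
qed

end

section \<open>Tails and moments\<close>

text \<open>Markov's inequality for the number of events that occur.\<close>

lemma (in prob_space) prob_card_ge_le:
  assumes "finite S" and [measurable]: "\<And>i. i \<in> S \<Longrightarrow> A i \<in> events" and "0 \<le> r"
  shows "r * prob {x \<in> space M. r \<le> real (card {i \<in> S. x \<in> A i})} \<le> (\<Sum>i\<in>S. prob (A i))"
proof -
  have card: "real (card {i \<in> S. x \<in> A i}) = (\<Sum>i\<in>S. indicator (A i) x)" for x
    using \<open>finite S\<close> by (simp add: indicator_def sum.If_cases Int_def)
  have [measurable]: "(\<lambda>x. \<Sum>i\<in>S. indicator (A i) x :: real) \<in> borel_measurable M" by measurable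
  have int: "integrable M (\<lambda>x. \<Sum>i\<in>S. indicator (A i) x :: real)"
    by (intro Bochner_Integration.integrable_sum integrable_indicator) (auto simp: emeasure_eq_measure)
  have "r * prob {x \<in> space M. r \<le> (\<Sum>i\<in>S. indicator (A i) x)}
      = (\<integral>x. r * indicator {x \<in> space M. r \<le> (\<Sum>i\<in>S. indicator (A i) x)} x \<partial>M)"
    by simp
  also have "\<dots> \<le> (\<integral>x. (\<Sum>i\<in>S. indicator (A i) x) \<partial>M)"
    using \<open>0 \<le> r\<close> by (intro integral_mono int integrable_mult_right integrable_real_indicator)
      (auto simp: emeasure_eq_measure sum_nonneg split: split_indicator)
  also have "\<dots> = (\<Sum>i\<in>S. prob (A i))"
    by (subst Bochner_Integration.integral_sum) (auto simp: emeasure_eq_measure)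
  finally show ?thesis by (simp add: card)
qed

context uncond_log_concave
begin

lemma usym_UNIV: "usym (\<Omega>)"
  by (auto simp: usym_def PiE_iff extensional_def split: if_splits)

lemma PiE_UNIV_sets [measurable]: "\<Omega> \<in> sets Leb"
  using sets.top[of Leb] by (simp add: space_Leb)

text \<open>The gain inequality with arithmetic means, \<open>\<Gamma> = 1\<close> and the whole
  space as second set. For superlevel sets it says that doubling the level squares the tail.\<close>

lemma measure_le_sq_of_half:
  assumes [measurable]: "Y \<in> sets Leb" "Z \<in> sets Leb" and sym: "usym Y" "usym Z"
    and half: "\<And>x y. x \<in> Y \<Longrightarrow> y \<in> \<Omega> \<Longrightarrow> (\<And>i. i \<in> I \<Longrightarrow> 0 < x i \<and> 0 < y i) \<Longrightarrow> (\<lambda>i\<in>I. (x i + y i) / 2) \<in> Z"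
  shows "measure \<nu> Y \<le> (measure \<nu> Z)\<^sup>2"
proof -
  have "1 * (measure \<nu> Y * measure \<nu> (\<Omega>)) \<le> (measure \<nu> Z)\<^sup>2"
    by (rule gain_inequality[where q="\<lambda>_. False"])
       (use half sym usym_UNIV in \<open>auto simp: pl_mean_def pl_gain_def\<close>)
  moreover have "measure \<nu> (\<Omega>) = 1" using \<nu>.prob_space by (simp add: space_\<nu>)
  ultimately show ?thesis by simp
qed

text \<open>By repeated doubling the tail at level \<open>2 ^ j * s\<close> is at most
  \<open>exp (- 4 * p * 2 ^ j)\<close>. This outweighs the factor \<open>(2 ^ (j + 2)) ^ p\<close>
  of the dyadic shells, whose total contribution is at most \<open>s ^ p\<close> besides the
  \<open>(2 * s) ^ p\<close> from small values.\<close>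

lemma moment_bound:
  fixes V :: "('i \<Rightarrow> real) \<Rightarrow> real" and p :: nat
  assumes V [measurable]: "V \<in> borel_measurable Leb" and nn: "\<And>x. 0 \<le> V x"
    and sym: "\<And>x i. x \<in> \<Omega> \<Longrightarrow> i \<in> I \<Longrightarrow> V (x(i := - x i)) = V x"
    and half: "\<And>x y. (\<And>i. i \<in> I \<Longrightarrow> 0 < x i \<and> 0 < y i) \<Longrightarrow> V x \<le> 2 * V (\<lambda>i\<in>I. (x i + y i) / 2)"
    and near: "\<And>x a. (\<And>i. i \<in> I \<Longrightarrow> \<bar>x i - a i\<bar> \<le> 1/2) \<Longrightarrow> V x \<le> V a + s"
    and s: "0 < s" and p: "1 \<le> p"
    and tail: "measure \<nu> {x \<in> \<Omega>. s \<le> V x} \<le> exp (- 4 * real p)"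
  shows "(\<integral>\<^sup>+x. ennreal (V x ^ p) \<partial>\<mu>) \<le> ennreal ((3 * s) ^ p)"
proof -
  have [measurable]: "V \<in> borel_measurable \<mu>" using V by (simp cong: measurable_cong_sets add: sets_\<mu>_Leb)
  let ?Y = "\<lambda>r. {x \<in> \<Omega>. r \<le> V x}"
  have Y [measurable]: "?Y r \<in> sets Leb" for r
    unfolding space_Leb[symmetric] by measurable
  have usym: "usym (?Y r)" for r
    unfolding usym_def using sym by (auto simp: PiE_iff extensional_def split: if_splits)
  have tails: "measure \<nu> (?Y (2 ^ j * s)) \<le> exp (- 4 * real p * 2 ^ j)" for j
  proof (induction j)
    case (Suc j)
    have "measure \<nu> (?Y (2 ^ Suc j * s)) \<le> (measure \<nu> (?Y (2 ^ j * s)))\<^sup>2"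
    proof (rule measure_le_sq_of_half[OF Y Y usym usym])
      fix x y :: "'i \<Rightarrow> real"
      assume x: "x \<in> ?Y (2 ^ Suc j * s)" and pos: "\<And>i. i \<in> I \<Longrightarrow> 0 < x i \<and> 0 < y i"
      have "2 ^ Suc j * s \<le> 2 * V (\<lambda>i\<in>I. (x i + y i) / 2)"
        using x half[of x y, OF pos] by simp
      then show "(\<lambda>i\<in>I. (x i + y i) / 2) \<in> ?Y (2 ^ j * s)" by simp
    qed
    also have "\<dots> \<le> (exp (- 4 * real p * 2 ^ j))\<^sup>2" using Suc by (intro power_mono) auto
    also have "\<dots> = exp (- 4 * real p * 2 ^ Suc j)" by (simp add: power2_eq_square flip: exp_add)
    finally show ?case .
  qed (use tail in simp)
  \<comment> \<open>Passing from \<open>\<mu>\<close> to \<open>\<nu>\<close> costs one power of 2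
    in the level: smoothing changes \<open>V\<close> by at most \<open>s\<close>, and
    \<open>s \<le> 2 ^ j * s\<close>.\<close>
  let ?A = "\<lambda>j. {x \<in> space \<mu>. 2 ^ Suc j * s \<le> V x}"
  have prob: "emeasure \<mu> (?A j) \<le> ennreal (exp (- 4 * real p * 2 ^ j))" for j
  proof -
    have "measure \<mu> (?A j) \<le> measure \<nu> (?Y (2 ^ j * s))"
    proof (rule measure_le_\<nu>)
      fix x a assume x: "x \<in> ?A j" and a: "a \<in> \<Omega>" and "\<And>i. i \<in> I \<Longrightarrow> \<bar>x i - a i\<bar> \<le> 1/2"
      then have "V x \<le> V a + s" by (intro near)
      moreover have "1 * s \<le> 2 ^ j * s" using s by (intro mult_right_mono) auto
      ultimately show "a \<in> ?Y (2 ^ j * s)" using x a by auto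
    qed auto
    then show ?thesis using tails[of j] by (simp add: \<mu>.emeasure_eq_measure ennreal_leI)
  qed
  have pt: "ennreal (V x ^ p) \<le> ennreal ((2 * s) ^ p) + (\<Sum>j. ennreal ((2 ^ (j + 2) * s) ^ p) * indicator (?A j) x)"
    if x: "x \<in> space \<mu>" for x
  proof (cases "V x \<le> 2 * s")
    case True
    then have "ennreal (V x ^ p) \<le> ennreal ((2 * s) ^ p)" using nn by (intro ennreal_leI power_mono)
    then show ?thesis by (simp add: add_increasing2)
  next
    case False
    obtain k where "V x / s < 2 ^ k" using real_arch_pow[of 2] by auto
    \<comment> \<open>As \<open>V x\<close> exceeds \<open>2 * s\<close>, the least exponent is at
      least 2; writing it as \<open>i + 2\<close> places \<open>V x\<close> between
      \<open>2 ^ (i + 1) * s\<close> and \<open>2 ^ (i + 2) * s\<close>.\<close>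
    define j where "j = (LEAST k. V x < 2 ^ k * s)"
    have ex: "V x < 2 ^ k * s" using \<open>V x / s < 2 ^ k\<close> s by (simp add: field_simps)
    then have j: "V x < 2 ^ j * s" unfolding j_def by (rule LeastI)
    have "1 < j"
    proof (rule ccontr)
      assume "\<not> 1 < j"
      then have "(2::real) ^ j * s \<le> 2 ^ 1 * s" using s by (intro mult_right_mono power_increasing) auto
      then show False using j False by simp
    qed
    then obtain i where i: "j = i + 2" by (metis add_2_eq_Suc' less_natE plus_1_eq_Suc)
    have "\<not> V x < 2 ^ (i + 1) * s" using not_less_Least[of "i + 1" "\<lambda>k. V x < 2 ^ k * s"] i by (simp add: j_def)
    then have "x \<in> ?A i" using x by simp
    have "ennreal (V x ^ p) \<le> ennreal ((2 ^ (i + 2) * s) ^ p)"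
      using j i nn by (intro ennreal_leI power_mono) auto
    also have "\<dots> = ennreal ((2 ^ (i + 2) * s) ^ p) * indicator (?A i) x" using \<open>x \<in> ?A i\<close> by simp
    also have "\<dots> \<le> (\<Sum>j. ennreal ((2 ^ (j + 2) * s) ^ p) * indicator (?A j) x)"
    proof -
      have "f i \<le> suminf f" for f :: "nat \<Rightarrow> ennreal" using sum_le_suminf[of f "{i}"] by simp
      then show ?thesis .
    qed
    finally show ?thesis by (simp add: add_increasing)
  qed
  have geom: "(2 ^ (j + 2) * s) ^ p * exp (- 4 * real p * 2 ^ j) \<le> s ^ p * (1/2) ^ Suc j" for j
  proof -
    have "real (Suc j) \<le> 2 ^ j" by (induction j) auto
    then have "exp (- (4 * 2 ^ j)) \<le> exp (- (4 * real (Suc j)))" by simp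
    also have "\<dots> = exp (- 4) ^ Suc j" by (subst exp_of_nat_mult[symmetric]) (simp add: algebra_simps)
    also have "\<dots> \<le> (1/16) ^ Suc j"
    proof (rule power_mono)
      have "(2::real) ^ 4 \<le> exp 1 ^ 4" using exp_ge_add_one_self[of 1] by (intro power_mono) auto
      then have "16 \<le> exp (4::real)" by (simp flip: exp_of_nat_mult)
      then show "exp (- 4) \<le> (1 / 16 :: real)" by (simp add: exp_minus field_simps)
    qed simp
    finally have e: "exp (- (4 * 2 ^ j)) \<le> (1/16 :: real) ^ Suc j" .
    have "(2 ^ (j + 2) * s) ^ p * exp (- 4 * real p * 2 ^ j) = s ^ p * (2 ^ (j + 2) * exp (- (4 * 2 ^ j))) ^ p"
      by (simp add: power_mult_distrib exp_of_nat_mult[symmetric] mult_ac)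
    also have "\<dots> \<le> s ^ p * ((1/2) ^ Suc j) ^ p"
    proof (intro mult_left_mono power_mono)
      have "2 ^ (j + 2) * exp (- (4 * 2 ^ j)) \<le> 2 ^ (j + 2) * (1/16 :: real) ^ Suc j" using e by simp
      also have "\<dots> \<le> (1/2) ^ Suc j"
      proof -
        have "2 ^ (j + 2) * (1/16 :: real) ^ Suc j = 2 * (1/8) ^ Suc j" by (simp add: power_divide power_add field_simps flip: power_mult_distrib)
        also have "\<dots> \<le> 4 ^ Suc j * (1/8) ^ Suc j"
        proof (rule mult_right_mono)
          have "(1::real) \<le> 4 ^ j" by (rule one_le_power) simp
          then have "(2::real) \<le> 4 * 4 ^ j" by linarith
          then show "(2::real) \<le> 4 ^ Suc j" by (simp only: power_Suc)
        qed simp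
        also have "\<dots> = (1/2 :: real) ^ Suc j" by (simp flip: power_mult_distrib)
        finally show ?thesis .
      qed
      finally show "2 ^ (j + 2) * exp (- (4 * 2 ^ j)) \<le> (1/2 :: real) ^ Suc j" .
    qed (use s in auto)
    also have "((1/2 :: real) ^ Suc j) ^ p \<le> ((1/2) ^ Suc j) ^ 1" 
    proof (rule power_decreasing[OF p])
      show "(1/2 :: real) ^ Suc j \<le> 1" by (rule power_le_one) auto
    qed simp
    finally show ?thesis using s by simp
  qed
  have "(\<integral>\<^sup>+x. ennreal (V x ^ p) \<partial>\<mu>) \<le> (\<integral>\<^sup>+x. ennreal ((2 * s) ^ p) + (\<Sum>j. ennreal ((2 ^ (j + 2) * s) ^ p) * indicator (?A j) x) \<partial>\<mu>)"
    by (rule nn_integral_mono) (rule pt)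
  also have "\<dots> = ennreal ((2 * s) ^ p) + (\<Sum>j. ennreal ((2 ^ (j + 2) * s) ^ p) * emeasure \<mu> (?A j))"
    by (subst nn_integral_add) (auto simp: nn_integral_suminf nn_integral_cmult \<mu>.emeasure_space_1)
  also have "\<dots> \<le> ennreal ((2 * s) ^ p) + (\<Sum>j. ennreal (s ^ p * (1/2) ^ Suc j))"
  proof (intro add_left_mono suminf_le allI summableI)
    fix j
    have "ennreal ((2 ^ (j + 2) * s) ^ p) * emeasure \<mu> (?A j) \<le> ennreal ((2 ^ (j + 2) * s) ^ p) * ennreal (exp (- 4 * real p * 2 ^ j))"
      by (intro mult_left_mono prob) simp
    also have "\<dots> \<le> ennreal (s ^ p * (1/2) ^ Suc j)"
      using geom[of j] s by (subst ennreal_mult[symmetric]) (auto intro: ennreal_leI)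
    finally show "ennreal ((2 ^ (j + 2) * s) ^ p) * emeasure \<mu> (?A j) \<le> ennreal (s ^ p * (1/2) ^ Suc j)" .
  qed
  also have "(\<Sum>j. ennreal (s ^ p * (1/2) ^ Suc j)) = ennreal (s ^ p)"
  proof -
    have "(\<lambda>j. s ^ p * (1/2 :: real) ^ Suc j) sums (s ^ p * 1)" by (intro sums_mult power_half_series)
    then show ?thesis using s by (subst suminf_ennreal_eq) auto
  qed
  also have "ennreal ((2 * s) ^ p) + ennreal (s ^ p) \<le> ennreal ((3 * s) ^ p)"
  proof -
    have "(2::real) ^ p + 1 \<le> 3 ^ p" using p
    proof (induction p rule: dec_induct)
      case (step k)
      have "(2::real) ^ Suc k + 1 \<le> 3 * (2 ^ k + 1)" by simp
      also have "\<dots> \<le> 3 ^ Suc k" using step by simp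
      finally show ?case .
    qed simp
    then have "((2::real) ^ p + 1) * s ^ p \<le> 3 ^ p * s ^ p" using s by (intro mult_right_mono) auto
    then show ?thesis using s by (simp add: power_mult_distrib algebra_simps ennreal_leI flip: ennreal_plus)
  qed
  finally show ?thesis .
qed

section \<open>Coordinates, orthants and sums of coordinates\<close>

text \<open>Chebyshev's inequality at 9/2, whose square exceeds 20; smoothing moves the coordinate
  by at most 1/2. Since \<open>measure_le_\<nu>\<close> bounds \<open>\<nu>\<close> from below, it
  is applied to complements.\<close>

lemma \<nu>_coord_tail:
  assumes i: "i \<in> I" shows "measure \<nu> {x \<in> \<Omega>. 5 \<le> \<bar>x i\<bar>} \<le> 1 / 20"
proof -
  note [measurable] = component_measurable[OF i]
  let ?A = "{x \<in> \<Omega>. 5 \<le> \<bar>x i\<bar>}" and ?B = "{x \<in> space \<mu>. 9/2 \<le> \<bar>x i\<bar>}"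
  have A [measurable]: "?A \<in> sets Leb" unfolding space_Leb[symmetric] by measurable
  have "ennreal 20 * emeasure \<mu> ?B = (\<integral>\<^sup>+x. ennreal 20 * indicator ?B x \<partial>\<mu>)"
    by (simp add: nn_integral_cmult)
  also have "\<dots> \<le> (\<integral>\<^sup>+x. ennreal ((x i)\<^sup>2) \<partial>\<mu>)"
  proof (rule nn_integral_mono)
    fix x assume "x \<in> space \<mu>"
    have "20 \<le> (x i)\<^sup>2" if "9/2 \<le> \<bar>x i\<bar>"
      using power_mono[OF that, of 2] by (simp add: power2_eq_square)
    then have "ennreal 20 \<le> ennreal ((x i)\<^sup>2)" if "9/2 \<le> \<bar>x i\<bar>" using that by (intro ennreal_leI) auto
    then show "ennreal 20 * indicator ?B x \<le> ennreal ((x i)\<^sup>2)" by (auto split: split_indicator)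
  qed
  also have "\<dots> \<le> 1" by (rule second_moment[OF i])
  finally have "ennreal (20 * measure \<mu> ?B) \<le> ennreal 1" by (simp add: \<mu>.emeasure_eq_measure ennreal_mult)
  then have B: "measure \<mu> ?B \<le> 1 / 20" by (subst (asm) ennreal_le_iff) auto
  have [measurable]: "space \<nu> - ?A \<in> sets Leb"
    using sets.Diff[OF PiE_UNIV_sets A] by (simp add: space_\<nu>)
  have "measure \<mu> (space \<mu> - ?B) \<le> measure \<nu> (space \<nu> - ?A)"
  proof (rule measure_le_\<nu>)
    fix x a :: "'i \<Rightarrow> real"
    assume x: "x \<in> space \<mu> - ?B" and a: "a \<in> \<Omega>" and near: "\<And>i. i \<in> I \<Longrightarrow> \<bar>x i - a i\<bar> \<le> 1/2"
    have "\<not> 9/2 \<le> \<bar>x i\<bar>" using x by auto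
    then have "\<not> 5 \<le> \<bar>a i\<bar>" using near[OF i] by linarith
    then show "a \<in> space \<nu> - ?A" using a by (simp add: space_\<nu>)
  qed auto
  then show ?thesis using B A by (simp add: \<mu>.prob_compl \<nu>.prob_compl)
qed

text \<open>The dyadic thresholds 0, 1, 2, 4, and so on: halving one of them lowers the index by
  one, except that 1 drops to 0.\<close>

definition level :: "nat \<Rightarrow> nat" where "level l = (if l = 0 then 0 else 2 ^ (l - 1))"

lemma level_rec: "level l = 2 * level (l - 1) + of_bool (l = 1)"
  by (cases l; cases "l - 1") (auto simp: level_def)

lemma le_level: "l \<le> level l"
proof (cases l)
  case (Suc k)
  have "Suc k \<le> 2 ^ k" by (induction k) auto
  then show ?thesis by (simp add: Suc level_def)
qed simp

text \<open>
  Halving the thresholds squares the probability; the coordinates whose threshold drops to 0 are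
  averaged through square roots, and there the gain of the Prekopa-Leindler inequality provides
  the factor that the squaring loses.
\<close>

lemma measure_orthant_levels:
  fixes l :: "'i \<Rightarrow> nat"
  shows "measure \<nu> {x \<in> \<Omega>. \<forall>i\<in>I. 80 * real (level (l i)) \<le> \<bar>x i\<bar>} \<le> (8/9) ^ (\<Sum>i\<in>I. level (l i))"
proof (induction "\<Sum>i\<in>I. l i" arbitrary: l rule: less_induct)
  case less
  let ?O = "\<lambda>l. {x \<in> \<Omega>. \<forall>i\<in>I. 80 * real (level (l i)) \<le> \<bar>x i\<bar>}"
  have O [measurable]: "?O l \<in> sets Leb" for l unfolding space_Leb[symmetric] by measurable
  have symO: "usym (?O l)" for l
    by (auto simp: usym_def PiE_iff extensional_def split: if_splits)
  show ?case
  proof (cases "\<forall>i\<in>I. l i = 0")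
    case True
    then have "(\<Sum>i\<in>I. level (l i)) = 0" by (simp add: level_def)
    then show ?thesis by simp
  next
    case False
    define l' where "l' = (\<lambda>i. l i - 1)"
    define S where "S = {i \<in> I. l i = 1}"
    have S: "S \<subseteq> I" "finite S" by (auto simp: S_def)
    have IH: "measure \<nu> (?O l') \<le> (8/9) ^ (\<Sum>i\<in>I. level (l' i))"
    proof (rule less.hyps)
      from False obtain i where "i \<in> I" "l i \<noteq> 0" by auto
      then show "(\<Sum>i\<in>I. l' i) < (\<Sum>i\<in>I. l i)"
        by (intro sum_strict_mono_ex1) (auto simp: l'_def intro!: bexI[of _ i])
    qed
    have sum: "(\<Sum>i\<in>I. level (l i)) = 2 * (\<Sum>i\<in>I. level (l' i)) + card S"
    proof -
      have "(\<Sum>i\<in>I. level (l i)) = (\<Sum>i\<in>I. 2 * level (l' i) + of_bool (l i = 1))"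
        by (intro sum.cong refl) (simp only: l'_def level_rec[symmetric])
      also have "\<dots> = 2 * (\<Sum>i\<in>I. level (l' i)) + (\<Sum>i\<in>I. of_bool (l i = 1))"
        by (simp add: sum.distrib sum_distrib_left)
      also have "(\<Sum>i\<in>I. of_bool (l i = 1)) = card S"
        by (simp add: S_def of_bool_def sum.If_cases Int_def)
      finally show ?thesis .
    qed
    let ?A = "\<lambda>i. {x \<in> \<Omega>. 5 \<le> \<bar>x i\<bar>}"
    have A [measurable]: "?A i \<in> sets Leb" if "i \<in> I" for i
      using component_measurable[OF that] unfolding space_Leb[symmetric] by measurable
    \<comment> \<open>Since \<open>80 = 16 * 5\<close>, every positive point of \<open>?O l\<close>
      exceeds every positive point of \<open>B\<close> by the factor 16 in at least half of the
      coordinates in \<open>S\<close>.\<close>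
    define B where "B = {x \<in> \<Omega>. 2 * real (card {i \<in> S. x \<in> ?A i}) \<le> real (card S)}"
    have card: "real (card {i \<in> S. x \<in> ?A i}) = (\<Sum>i\<in>S. indicator (?A i) x)" for x
      using S by (simp add: indicator_def sum.If_cases Int_def)
    have AS [measurable]: "(\<lambda>x. indicator (?A i) x :: real) \<in> borel_measurable Leb" if "i \<in> S" for i
      using A that S by (intro borel_measurable_indicator) auto
    have B [measurable]: "B \<in> sets Leb"
    proof -
      have "B = {x \<in> space Leb. 2 * (\<Sum>i\<in>S. indicator (?A i) x) \<le> real (card S)}"
        by (simp only: B_def card space_Leb)
      also have "\<dots> \<in> sets Leb" by measurable
      finally show ?thesis .
    qed
    have symB: "usym B"
      unfolding usym_def
    proof (intro ballI)
      fix x i assume x: "x \<in> \<Omega>" and i: "i \<in> I"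
      have x': "x(i := - x i) \<in> \<Omega>" using x i by (auto simp: PiE_iff extensional_def)
      have "{j \<in> S. x(i := - x i) \<in> ?A j} = {j \<in> S. x \<in> ?A j}" using x x' by auto
      then show "x(i := - x i) \<in> B \<longleftrightarrow> x \<in> B" using x x' by (simp add: B_def)
    qed
    \<comment> \<open>Half of \<open>S\<close> or more lies above 5 with probability at most 1/10.
      One factor 10/9 makes up for this, and for empty \<open>S\<close> there is nothing to make up
      for.\<close>
    have PB: "1 \<le> (10/9) ^ card S * measure \<nu> B"
    proof (cases "S = {}")
      case True
      then have "B = space \<nu>" by (auto simp: B_def space_\<nu>)
      then show ?thesis using True \<nu>.prob_space by simp
    next
      case False
      then have cS: "0 < card S" using S by (simp add: card_gt_0_iff)
      have "real (card S) / 2 * measure \<nu> {x \<in> space \<nu>. real (card S) / 2 \<le> real (card {i \<in> S. x \<in> ?A i})} \<le> (\<Sum>i\<in>S. measure \<nu> (?A i))"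
        by (rule \<nu>.prob_card_ge_le) (use S A in auto)
      also have "\<dots> \<le> (\<Sum>i\<in>S. 1/20)" using S \<nu>_coord_tail by (intro sum_mono) auto
      finally have "measure \<nu> {x \<in> space \<nu>. real (card S) / 2 \<le> real (card {i \<in> S. x \<in> ?A i})} \<le> 1/10"
        using cS by (simp add: field_simps)
      moreover have "measure \<nu> (space \<nu> - B) \<le> measure \<nu> {x \<in> space \<nu>. real (card S) / 2 \<le> real (card {i \<in> S. x \<in> ?A i})}"
      proof (rule \<nu>.finite_measure_mono)
        show "space \<nu> - B \<subseteq> {x \<in> space \<nu>. real (card S) / 2 \<le> real (card {i \<in> S. x \<in> ?A i})}"
          unfolding B_def space_\<nu> by auto
        show "{x \<in> space \<nu>. real (card S) / 2 \<le> real (card {i \<in> S. x \<in> ?A i})} \<in> sets \<nu>"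
        proof -
          have "{x \<in> space \<nu>. real (card S) / 2 \<le> real (card {i \<in> S. x \<in> ?A i})}
              = {x \<in> space Leb. real (card S) / 2 \<le> (\<Sum>i\<in>S. indicator (?A i) x)}"
            by (simp only: card space_\<nu> space_Leb)
          also have "\<dots> \<in> sets Leb" by measurable
          finally show ?thesis by (simp only: sets_\<nu>)
        qed
      qed
      ultimately have "9/10 \<le> measure \<nu> B" using B by (simp add: \<nu>.prob_compl)
      then have "(10/9) ^ 1 * (9/10) \<le> (10/9) ^ card S * measure \<nu> B"
        using cS by (intro mult_mono power_increasing) auto
      then show ?thesis by simp
    qed
    \<comment> \<open>A gain of 25/16 in half of the coordinates amounts to 5/4 for each element of
      \<open>S\<close>. Split as 9/8 times 10/9, it pays for \<open>B\<close> and leaves 9/8 for the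
      decay.\<close>
    have "(5/4) ^ card S * (measure \<nu> (?O l) * measure \<nu> B) \<le> (measure \<nu> (?O l'))\<^sup>2"
    proof (rule gain_inequality[where q="\<lambda>i. l i = 1", OF O B O symO symB symO])
      fix x y assume x: "x \<in> ?O l" and y: "y \<in> B" and pos: "\<And>i. i \<in> I \<Longrightarrow> 0 < x i \<and> 0 < y i"
      let ?z = "\<lambda>i\<in>I. pl_mean (l i = 1) (x i) (y i)"
      have "80 * real (level (l' i)) \<le> \<bar>?z i\<bar>" if i: "i \<in> I" for i
      proof (cases "l i \<le> 1")
        case True
        then show ?thesis by (simp add: l'_def level_def)
      next
        case False
        then have "real (level (l i)) = 2 * real (level (l' i))" using level_rec[of "l i"] by (simp add: l'_def)
        moreover have "80 * real (level (l i)) \<le> x i" using x pos i by force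
        ultimately show ?thesis using False i pos[OF i] by (simp add: pl_mean_def)
      qed
      then have Z: "?z \<in> ?O l'" by auto
      define G where "G = {i \<in> S. \<not> 5 \<le> \<bar>y i\<bar>}"
      have yB: "y \<in> \<Omega>" and "2 * real (card {i \<in> S. y \<in> ?A i}) \<le> real (card S)"
        using y by (auto simp: B_def)
      moreover have "card S = card G + card {i \<in> S. y \<in> ?A i}"
        unfolding G_def using S yB by (subst card_Un_disjoint[symmetric]) (auto intro!: arg_cong[where f=card])
      ultimately have cG: "card S \<le> 2 * card G" by linarith
      have G: "G \<subseteq> I" using S by (auto simp: G_def)
      have "(5/4 :: real) ^ card S \<le> (5/4) ^ (2 * card G)" using cG by (intro power_increasing) auto
      also have "\<dots> = (\<Prod>i\<in>G. 25/16)" by (simp add: power_mult power2_eq_square)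
      also have "\<dots> \<le> (\<Prod>i\<in>G. pl_gain (l i = 1) (x i) (y i))"
      proof (rule prod_mono)
        fix i assume i: "i \<in> G"
        then have l1: "l i = 1" "i \<in> I" by (auto simp: G_def S_def)
        then have "80 \<le> x i" using x pos[of i] by (force simp: level_def)
        moreover have "y i \<le> 5" using i pos[of i] l1 by (auto simp: G_def)
        ultimately show "0 \<le> (25/16::real) \<and> 25/16 \<le> pl_gain (l i = 1) (x i) (y i)"
          using pl_gain_ge_of_ratio[of "y i" "x i"] pos[of i] l1 by auto
      qed
      also have "\<dots> \<le> (\<Prod>i\<in>I. pl_gain (l i = 1) (x i) (y i))"
      proof (rule prod_mono2)
        fix i assume "i \<in> I - G"
        then show "1 \<le> pl_gain (l i = 1) (x i) (y i)" using pos[of i] pl_gain_ge_1 by auto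
      next
        fix i assume "i \<in> G"
        then show "0 \<le> pl_gain (l i = 1) (x i) (y i)"
          using pos[of i] G pl_gain_ge_1[of "x i" "y i" "l i = 1"] by fastforce
      qed (use G in auto)
      finally show "?z \<in> ?O l' \<and> (5/4 :: real) ^ card S \<le> (\<Prod>i\<in>I. pl_gain (l i = 1) (x i) (y i))"
        using Z by blast
    qed simp
    then have key: "(9/8) ^ card S * measure \<nu> (?O l) * ((10/9) ^ card S * measure \<nu> B) \<le> (measure \<nu> (?O l'))\<^sup>2"
    proof -
      have "(5/4 :: real) ^ card S = (9/8) ^ card S * (10/9) ^ card S" by (simp flip: power_mult_distrib)
      then show ?thesis using \<open>(5/4) ^ card S * _ \<le> _\<close> by (simp add: mult_ac)
    qed
    have "(9/8) ^ card S * measure \<nu> (?O l) * 1 \<le> (9/8) ^ card S * measure \<nu> (?O l) * ((10/9) ^ card S * measure \<nu> B)"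
      using PB by (intro mult_left_mono) auto
    also have "\<dots> \<le> (measure \<nu> (?O l'))\<^sup>2" by (rule key)
    also have "\<dots> \<le> ((8/9) ^ (\<Sum>i\<in>I. level (l' i)))\<^sup>2" using IH by (intro power_mono) auto
    finally have "(8/9) ^ card S * ((9/8) ^ card S * measure \<nu> (?O l)) \<le> (8/9) ^ card S * ((8/9) ^ (\<Sum>i\<in>I. level (l' i)))\<^sup>2"
      by (intro mult_left_mono) auto
    also have "(8/9) ^ card S * ((9/8) ^ card S * measure \<nu> (?O l)) = measure \<nu> (?O l)"
    proof -
      have "(8/9 :: real) ^ card S * (9/8) ^ card S = 1" by (simp flip: power_mult_distrib)
      then show ?thesis by (simp add: mult.assoc[symmetric])
    qed
    also have "(8/9 :: real) ^ card S * ((8/9) ^ (\<Sum>i\<in>I. level (l' i)))\<^sup>2 = (8/9) ^ (\<Sum>i\<in>I. level (l i))"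
      unfolding sum by (simp add: power_add power_even_eq mult.commute)
    finally show ?thesis .
  qed
qed

text \<open>Union bound over the level patterns on \<open>J\<close>. Because
  \<open>8/9 \<le> (19/20)\<^sup>2\<close>, one half of the decay gives \<open>(19/20) ^ m\<close>,
  and the other half turns the sum over patterns into a product of geometric sums, each at most
  20.\<close>

lemma measure_sum_abs_tail:
  assumes J: "J \<subseteq> I"
  shows "measure \<nu> {x \<in> \<Omega>. 80 * real (card J) + 160 * real m \<le> (\<Sum>i\<in>J. \<bar>x i\<bar>)} \<le> 20 ^ card J * (19/20) ^ m"
proof -
  have fJ: "finite J" by (rule finite_subset[OF J finite_I])
  \<comment> \<open>The cap leaves finitely many patterns; a coordinate that reaches it has level at
    least \<open>m\<close> all by itself.\<close>
  define N where "N = Suc m"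
  define P where "P = (PiE J (\<lambda>_. {..N}))"
  have fP: "finite P" using fJ by (simp add: P_def finite_PiE)
  define U where "U = (\<lambda>l :: 'i \<Rightarrow> nat. {x \<in> \<Omega>. \<forall>i\<in>I. 80 * real (level (if i \<in> J then l i else 0)) \<le> \<bar>x i\<bar>})"
  have U [measurable]: "U l \<in> sets Leb" for l unfolding U_def space_Leb[symmetric] by measurable
  let ?E = "\<lambda>l. \<Sum>i\<in>J. level (l i)"
  have PO: "measure \<nu> (U l) \<le> (8/9) ^ ?E l" for l
  proof -
    have "(\<Sum>i\<in>I. level (if i \<in> J then l i else 0)) = ?E l"
      using J by (intro sum.mono_neutral_cong_right) (auto simp: level_def)
    then show ?thesis using measure_orthant_levels[of "\<lambda>i. if i \<in> J then l i else 0"] by (simp add: U_def)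
  qed
  let ?X = "{x \<in> \<Omega>. 80 * real (card J) + 160 * real m \<le> (\<Sum>i\<in>J. \<bar>x i\<bar>)}"
  have sub: "?X \<subseteq> (\<Union>l\<in>{l \<in> P. m \<le> ?E l}. U l)"
  proof
    fix x assume x: "x \<in> ?X"
    define l where "l = (\<lambda>i\<in>J. Max {k. k \<le> N \<and> 80 * real (level k) \<le> \<bar>x i\<bar>})"
    have l: "l i \<le> N" "80 * real (level (l i)) \<le> \<bar>x i\<bar>" and lmax: "\<And>k. k \<le> N \<Longrightarrow> 80 * real (level k) \<le> \<bar>x i\<bar> \<Longrightarrow> k \<le> l i"
      if "i \<in> J" for i
    proof -
      let ?K = "{k. k \<le> N \<and> 80 * real (level k) \<le> \<bar>x i\<bar>}"
      have "finite ?K" "0 \<in> ?K" by (auto simp: level_def)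
      then have "Max ?K \<in> ?K" using Max_in[of ?K] by blast
      then show "l i \<le> N" "80 * real (level (l i)) \<le> \<bar>x i\<bar>" using that by (auto simp: l_def)
      show "k \<le> l i" if "k \<le> N" "80 * real (level k) \<le> \<bar>x i\<bar>" for k
        using that \<open>i \<in> J\<close> Max_ge[OF \<open>finite ?K\<close>, of k] by (simp add: l_def)
    qed
    have "l \<in> P" using l by (auto simp: P_def l_def PiE_iff)
    moreover have "level 0 = 0" by (simp add: level_def)
    moreover have "x \<in> U l" using l(2) x \<open>level 0 = 0\<close> by (auto simp: U_def)
    moreover have "m \<le> ?E l"
    proof (cases "\<exists>i\<in>J. l i = N")
      case True
      then obtain i where i: "i \<in> J" "l i = N" by auto
      have "m \<le> level (l i)" using le_level[of N] i by (simp add: N_def)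
      also have "\<dots> \<le> ?E l" using i fJ by (intro member_le_sum) auto
      finally show ?thesis .
    next
      case False
      \<comment> \<open>Below the cap the choice of \<open>l i\<close> is maximal, so the next
        threshold is missed, and that one is about twice the present one; the additive 80 covers
        level 0.\<close>
      have "\<bar>x i\<bar> \<le> 80 + 160 * real (level (l i))" if i: "i \<in> J" for i
      proof -
        have "Suc (l i) \<le> N" using False l(1)[OF i] i by (metis le_neq_implies_less Suc_leI)
        then have "\<bar>x i\<bar> < 80 * real (level (Suc (l i)))" using lmax[OF i, of "Suc (l i)"] by linarith
        also have "\<dots> \<le> 80 + 160 * real (level (l i))" using level_rec[of "Suc (l i)"] by simp
        finally show ?thesis by simp
      qed
      then have "(\<Sum>i\<in>J. \<bar>x i\<bar>) \<le> (\<Sum>i\<in>J. 80 + 160 * real (level (l i)))" by (rule sum_mono)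
      also have "\<dots> = 80 * real (card J) + 160 * real (?E l)" by (simp add: sum.distrib sum_distrib_left)
      finally have "(\<Sum>i\<in>J. \<bar>x i\<bar>) \<le> 80 * real (card J) + 160 * real (?E l)" .
      moreover have "80 * real (card J) + 160 * real m \<le> (\<Sum>i\<in>J. \<bar>x i\<bar>)" using x by simp
      ultimately have "real m \<le> real (?E l)" by linarith
      then show ?thesis by (simp only: of_nat_le_iff)
    qed
    ultimately show "x \<in> (\<Union>l\<in>{l \<in> P. m \<le> ?E l}. U l)" by blast
  qed
  have "measure \<nu> ?X \<le> measure \<nu> (\<Union>l\<in>{l \<in> P. m \<le> ?E l}. U l)"
    using fP by (intro \<nu>.finite_measure_mono sub) (auto intro!: sets.finite_UN)
  also have "\<dots> \<le> (\<Sum>l\<in>{l \<in> P. m \<le> ?E l}. measure \<nu> (U l))"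
    using fP by (intro \<nu>.finite_measure_subadditive_finite) auto
  also have "\<dots> \<le> (\<Sum>l\<in>{l \<in> P. m \<le> ?E l}. (19/20) ^ m * (19/20) ^ ?E l)"
  proof (rule sum_mono)
    fix l assume l: "l \<in> {l \<in> P. m \<le> ?E l}"
    have "measure \<nu> (U l) \<le> (8/9) ^ ?E l" by (rule PO)
    also have "\<dots> \<le> ((19/20)\<^sup>2) ^ ?E l" by (intro power_mono) (auto simp: power2_eq_square)
    also have "\<dots> = (19/20) ^ ?E l * (19/20) ^ ?E l" by (simp only: power2_eq_square power_mult_distrib)
    also have "\<dots> \<le> (19/20) ^ m * (19/20) ^ ?E l"
      using l by (intro mult_right_mono power_decreasing) auto
    finally show "measure \<nu> (U l) \<le> (19/20) ^ m * (19/20) ^ ?E l" .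
  qed
  also have "\<dots> \<le> (\<Sum>l\<in>P. (19/20) ^ m * (19/20) ^ ?E l)"
    using fP by (intro sum_mono2) auto
  also have "\<dots> = (19/20) ^ m * (\<Sum>l\<in>P. \<Prod>i\<in>J. (19/20) ^ level (l i))"
    by (simp add: sum_distrib_left power_sum)
  also have "(\<Sum>l\<in>P. \<Prod>i\<in>J. (19/20 :: real) ^ level (l i)) = (\<Prod>i\<in>J. \<Sum>k\<le>N. (19/20) ^ level k)"
    unfolding P_def using fJ by (intro prod_sum_PiE[symmetric]) auto
  also have "\<dots> \<le> (\<Prod>i\<in>J. 20)"
  proof (rule prod_mono)
    have "(\<Sum>k\<le>N. (19/20 :: real) ^ level k) \<le> (\<Sum>k\<le>N. (19/20) ^ k)"
      by (intro sum_mono power_decreasing le_level) auto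
    also have "\<dots> \<le> 20" by (simp add: sum_gp0)
    finally show "0 \<le> (\<Sum>k\<le>N. (19/20 :: real) ^ level k) \<and> (\<Sum>k\<le>N. (19/20 :: real) ^ level k) \<le> 20"
      by (simp add: sum_nonneg)
  qed
  finally show ?thesis by (simp add: mult.commute)
qed

text \<open>Tail bound with \<open>m = 150 * p\<close>: here \<open>24080 = 80 + 160 * 150\<close>
  and \<open>72240 = 3 * 24080\<close>, and \<open>20 * (19/20) ^ 150 \<le> exp (- 4)\<close> gives
  the tail required by \<open>moment_bound\<close>.\<close>

lemma sum_abs_moment:
  fixes p :: nat
  assumes J: "J \<subseteq> I" "card J \<le> p" and p: "1 \<le> p"
  shows "(\<integral>\<^sup>+x. ennreal ((\<Sum>i\<in>J. \<bar>x i\<bar>) ^ p) \<partial>\<mu>) \<le> ennreal ((72240 * real p) ^ p)"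
proof -
  have fJ: "finite J" by (rule finite_subset[OF J(1) finite_I])
  let ?Y = "{x \<in> \<Omega>. 24080 * real p \<le> (\<Sum>i\<in>J. \<bar>x i\<bar>)}"
  let ?Z = "{x \<in> \<Omega>. 80 * real (card J) + 160 * real (150 * p) \<le> (\<Sum>i\<in>J. \<bar>x i\<bar>)}"
  have "(\<integral>\<^sup>+x. ennreal ((\<Sum>i\<in>J. \<bar>x i\<bar>) ^ p) \<partial>\<mu>) \<le> ennreal ((3 * (24080 * real p)) ^ p)"
  proof (rule moment_bound)
    show "(\<lambda>x. \<Sum>i\<in>J. \<bar>x i\<bar>) \<in> borel_measurable Leb" using J by (intro borel_measurable_sum) (auto intro!: component_measurable borel_measurable_abs)
    show "(\<Sum>j\<in>J. \<bar>(x(i := - x i)) j\<bar>) = (\<Sum>j\<in>J. \<bar>x j\<bar>)" for x :: "'i \<Rightarrow> real" and i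
      by (intro sum.cong) auto
    show "(\<Sum>i\<in>J. \<bar>x i\<bar>) \<le> 2 * (\<Sum>i\<in>J. \<bar>(\<lambda>i\<in>I. (x i + y i) / 2) i\<bar>)"
      if pos: "\<And>i. i \<in> I \<Longrightarrow> 0 < x i \<and> 0 < y i" for x y :: "'i \<Rightarrow> real"
      unfolding sum_distrib_left
    proof (rule sum_mono)
      fix i assume "i \<in> J"
      then show "\<bar>x i\<bar> \<le> 2 * \<bar>(\<lambda>i\<in>I. (x i + y i) / 2) i\<bar>" using pos[of i] J by auto
    qed
    show "(\<Sum>i\<in>J. \<bar>x i\<bar>) \<le> (\<Sum>i\<in>J. \<bar>a i\<bar>) + 24080 * real p"
      if near: "\<And>i. i \<in> I \<Longrightarrow> \<bar>x i - a i\<bar> \<le> 1/2" for x a :: "'i \<Rightarrow> real"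
    proof -
      have "(\<Sum>i\<in>J. \<bar>x i\<bar>) \<le> (\<Sum>i\<in>J. \<bar>a i\<bar> + 1)"
      proof (rule sum_mono)
        fix i assume "i \<in> J"
        then have "i \<in> I" using J by auto
        then show "\<bar>x i\<bar> \<le> \<bar>a i\<bar> + 1" using near[of i] by linarith
      qed
      then show ?thesis using J by (simp add: sum.distrib)
    qed
    have "measure \<nu> ?Y
        \<le> measure \<nu> ?Z"
    proof (rule \<nu>.finite_measure_mono)
      show "?Y \<subseteq> ?Z"
        using J by auto
      have [measurable]: "(\<lambda>x. \<Sum>i\<in>J. \<bar>x i\<bar>) \<in> borel_measurable Leb" using J by (intro borel_measurable_sum) (auto intro!: component_measurable borel_measurable_abs)
      show "?Z \<in> sets \<nu>"
        unfolding sets_\<nu> space_Leb[symmetric] by measurable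
    qed
    also have "\<dots> \<le> 20 ^ card J * (19/20) ^ (150 * p)" by (rule measure_sum_abs_tail[OF J(1)])
    also have "\<dots> \<le> 20 ^ p * ((19/20) ^ 150) ^ p"
      using J by (intro mult_mono power_increasing) (auto simp: power_mult)
    also have "\<dots> \<le> exp (- 4 * real p)"
    proof -
      have e: "exp (1::real) \<le> 3" by (rule exp_le)
      have "exp (4::real) = exp 1 ^ 4" by (simp flip: exp_of_nat_mult)
      also have "\<dots> \<le> 3 ^ 4" using e by (intro power_mono) auto
      finally have "(81::real) * exp (- 4) \<ge> 1" by (simp add: exp_minus field_simps)
      moreover have "20 * (19/20 :: real) ^ 150 * 81 \<le> 1" by (simp add: power_divide)
      ultimately have "20 * (19/20 :: real) ^ 150 \<le> exp (- 4)" by linarith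
      then have "(20 * (19/20 :: real) ^ 150) ^ p \<le> exp (- 4) ^ p" by (intro power_mono) auto
      then show ?thesis by (simp add: power_mult_distrib exp_of_nat_mult[symmetric] mult.commute)
    qed
    finally show "measure \<nu> ?Y \<le> exp (- 4 * real p)" .
  qed (use p in \<open>auto simp: sum_nonneg\<close>)
  then show ?thesis by simp
qed

end

section \<open>Contraction of coefficients and moments of differences\<close>

lemma power_convex_comb:
  fixes x y l :: real
  assumes "0 \<le> x" "0 \<le> y" "0 \<le> l" "l \<le> 1"
  shows "(l * x + (1 - l) * y) ^ p \<le> l * x ^ p + (1 - l) * y ^ p"
proof -
  have "convex_on {0..} (\<lambda>x::real. x ^ p)"
  proof (cases "even p")
    case True
    then show ?thesis using convex_power_even[of p] convex_on_subset by blast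
  qed (rule convex_power_odd)
  from convex_onD[OF this, of "1 - l" x y] assms show ?thesis by simp
qed

lemma add3_power_le:
  fixes x y z :: real
  assumes "0 \<le> x" "0 \<le> y" "0 \<le> z"
  shows "(x + y + z) ^ p \<le> 3 ^ p * (x ^ p + y ^ p + z ^ p)"
proof -
  define m where "m = max x (max y z)"
  have m: "x \<le> m" "y \<le> m" "z \<le> m" by (auto simp: m_def)
  have "(x + y + z) ^ p \<le> (3 * m) ^ p" using assms m by (intro power_mono) auto
  also have "\<dots> = 3 ^ p * m ^ p" by (rule power_mult_distrib)
  also have "m ^ p \<le> x ^ p + y ^ p + z ^ p"
  proof -
    have "m = x \<or> m = y \<or> m = z" by (auto simp: m_def max_def)
    then show ?thesis using assms by (auto intro: add_increasing add_increasing2)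
  qed
  finally show ?thesis by simp
qed

context uncond_log_concave
begin

lemma nn_integral_reflect:
  assumes i: "i \<in> I" and [measurable]: "g \<in> borel_measurable \<mu>"
  shows "(\<integral>\<^sup>+x. g (x(i := - x i)) \<partial>\<mu>) = (\<integral>\<^sup>+x. g x \<partial>\<mu>)"
proof -
  let ?f = "\<lambda>x :: 'i \<Rightarrow> real. x(i := - x i)"
  have "(\<lambda>x. \<lambda>j\<in>I. if j = i then - x j else x j) \<in> measurable \<mu> Leb"
  proof (intro measurable_restrict)
    fix j assume "j \<in> I"
    then show "(\<lambda>x. if j = i then - x j else x j) \<in> \<mu> \<rightarrow>\<^sub>M lborel"
      by (cases "j = i") (auto intro: component_measurable borel_measurable_uminus)
  qed
  then have "(\<lambda>x. \<lambda>j\<in>I. if j = i then - x j else x j) \<in> measurable \<mu> \<mu>"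
    by (simp cong: measurable_cong_sets add: sets_\<mu>_Leb)
  moreover have "(\<lambda>j\<in>I. if j = i then - x j else x j) = ?f x" if "x \<in> space \<mu>" for x
    using that i by (auto simp: space_\<mu> PiE_iff extensional_def fun_eq_iff)
  ultimately have f [measurable]: "?f \<in> measurable \<mu> \<mu>" by (simp cong: measurable_cong)
  have "distr \<mu> \<mu> ?f = \<mu>"
  proof (rule measure_eqI)
    fix A assume "A \<in> sets (distr \<mu> \<mu> ?f)"
    then have A: "A \<in> sets \<mu>" by simp
    have "emeasure (distr \<mu> \<mu> ?f) A = emeasure \<mu> (?f -` A \<inter> space \<mu>)" by (rule emeasure_distr[OF f A])
    also have "?f -` A \<inter> space \<mu> = {x \<in> space \<mu>. x(i := - x i) \<in> A}" by blast
    also have "emeasure \<mu> {x \<in> space \<mu>. x(i := - x i) \<in> A} = emeasure \<mu> A"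
      unfolding \<mu>.emeasure_eq_measure reflect[OF i A] ..
    finally show "emeasure (distr \<mu> \<mu> ?f) A = emeasure \<mu> A" .
  qed simp
  then have "(\<integral>\<^sup>+x. g x \<partial>\<mu>) = (\<integral>\<^sup>+x. g x \<partial>distr \<mu> \<mu> ?f)" by simp
  also have "\<dots> = (\<integral>\<^sup>+x. g (?f x) \<partial>\<mu>)" by (rule nn_integral_distr) auto
  finally show ?thesis ..
qed

lemma lin_measurable:
  assumes "J \<subseteq> I"
  shows "(\<lambda>x. \<Sum>i\<in>J. w i * x i) \<in> borel_measurable \<mu>" "(\<lambda>x. \<Sum>i\<in>J. w i * \<bar>x i\<bar>) \<in> borel_measurable \<mu>"
    "(\<lambda>x. \<Sum>i\<in>J. w i * \<bar>x i\<bar>) \<in> borel_measurable Leb"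
  using assms by (auto intro!: borel_measurable_sum borel_measurable_times borel_measurable_abs component_measurable)

text \<open>Replacing \<open>w j\<close> by \<open>c\<close> averages the form with the one in which
  \<open>w j\<close> has the opposite sign. By reflection both have the same moment, and the
  \<open>p\<close>-th power is convex.\<close>

lemma contraction_coord:
  fixes w :: "'i \<Rightarrow> real" and p :: nat
  assumes J: "J \<subseteq> I" and j: "j \<in> I" and c: "\<bar>c\<bar> \<le> \<bar>w j\<bar>"
  shows "(\<integral>\<^sup>+x. ennreal (\<bar>\<Sum>i\<in>J. (w(j := c)) i * x i\<bar> ^ p) \<partial>\<mu>) \<le> (\<integral>\<^sup>+x. ennreal (\<bar>\<Sum>i\<in>J. w i * x i\<bar> ^ p) \<partial>\<mu>)"
proof (cases "w j = 0")
  case True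
  then have "w(j := c) = w" using c by auto
  then show ?thesis by simp
next
  case False
  define l where "l = (c / w j + 1) / 2"
  have "\<bar>c / w j\<bar> \<le> 1" using c False by (simp add: abs_divide)
  then have "- 1 \<le> c / w j" "c / w j \<le> 1" by (auto simp only: abs_le_iff)
  then have l: "0 \<le> l" "l \<le> 1" by (auto simp: l_def)
  let ?L = "\<lambda>w x. \<Sum>i\<in>J. w i * x i :: real"
  let ?w = "w(j := - w j)"
  let ?N = "\<lambda>w. \<integral>\<^sup>+x. ennreal (\<bar>?L w x\<bar> ^ p) \<partial>\<mu>"
  note [measurable] = lin_measurable(1)[OF J]
  have "?N (w(j := c)) \<le> (\<integral>\<^sup>+x. ennreal l * ennreal (\<bar>?L w x\<bar> ^ p) + ennreal (1 - l) * ennreal (\<bar>?L ?w x\<bar> ^ p) \<partial>\<mu>)"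
  proof (rule nn_integral_mono)
    fix x
    have cl: "c = l * w j + (1 - l) * (- w j)" using False by (simp add: l_def field_simps)
    have "?L (w(j := c)) x = l * ?L w x + (1 - l) * ?L ?w x"
      unfolding sum_distrib_left sum.distrib[symmetric]
      by (intro sum.cong refl) (auto simp: cl algebra_simps)
    then have "\<bar>?L (w(j := c)) x\<bar> \<le> l * \<bar>?L w x\<bar> + (1 - l) * \<bar>?L ?w x\<bar>"
      using l abs_triangle_ineq[of "l * ?L w x" "(1 - l) * ?L ?w x"] by (simp add: abs_mult)
    then have "\<bar>?L (w(j := c)) x\<bar> ^ p \<le> (l * \<bar>?L w x\<bar> + (1 - l) * \<bar>?L ?w x\<bar>) ^ p" by (intro power_mono) auto
    also have "\<dots> \<le> l * \<bar>?L w x\<bar> ^ p + (1 - l) * \<bar>?L ?w x\<bar> ^ p" using l by (intro power_convex_comb) auto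
    finally have "ennreal (\<bar>?L (w(j := c)) x\<bar> ^ p) \<le> ennreal (l * \<bar>?L w x\<bar> ^ p + (1 - l) * \<bar>?L ?w x\<bar> ^ p)"
      by (rule ennreal_leI)
    also have "\<dots> = ennreal l * ennreal (\<bar>?L w x\<bar> ^ p) + ennreal (1 - l) * ennreal (\<bar>?L ?w x\<bar> ^ p)"
      using l by (simp add: ennreal_mult)
    finally show "ennreal (\<bar>?L (w(j := c)) x\<bar> ^ p) \<le> ennreal l * ennreal (\<bar>?L w x\<bar> ^ p) + ennreal (1 - l) * ennreal (\<bar>?L ?w x\<bar> ^ p)" .
  qed
  also have "\<dots> = ennreal l * ?N w + ennreal (1 - l) * ?N ?w"
    by (subst nn_integral_add) (auto simp: nn_integral_cmult)
  also have "?N ?w = (\<integral>\<^sup>+x. ennreal (\<bar>?L w (x(j := - x j))\<bar> ^ p) \<partial>\<mu>)"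
  proof (rule nn_integral_cong)
    fix x
    have "?L ?w x = ?L w (x(j := - x j))" by (intro sum.cong) auto
    then show "ennreal (\<bar>?L ?w x\<bar> ^ p) = ennreal (\<bar>?L w (x(j := - x j))\<bar> ^ p)" by simp
  qed
  also have "\<dots> = ?N w" by (rule nn_integral_reflect[OF j]) measurable
  also have "ennreal l * ?N w + ennreal (1 - l) * ?N w
     = ?N w"
    using l by (simp add: distrib_right[symmetric] flip: ennreal_plus)
  finally show ?thesis .
qed

lemma contraction:
  fixes a c :: "'i \<Rightarrow> real" and p :: nat
  assumes J: "J \<subseteq> I" and c: "\<And>i. i \<in> J \<Longrightarrow> \<bar>c i\<bar> \<le> \<bar>a i\<bar>"
  shows "(\<integral>\<^sup>+x. ennreal (\<bar>\<Sum>i\<in>J. c i * x i\<bar> ^ p) \<partial>\<mu>) \<le> (\<integral>\<^sup>+x. ennreal (\<bar>\<Sum>i\<in>J. a i * x i\<bar> ^ p) \<partial>\<mu>)"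
proof -
  let ?N = "\<lambda>w. \<integral>\<^sup>+x. ennreal (\<bar>\<Sum>i\<in>J. w i * x i\<bar> ^ p) \<partial>\<mu>"
  have "?N (\<lambda>i. if i \<in> D then c i else a i) \<le> ?N a" if "D \<subseteq> J" for D
    using finite_subset[OF subset_trans[OF that J] finite_I] that
  proof (induction D rule: finite_induct)
    case ins: (insert j D)
    let ?w = "\<lambda>i. if i \<in> D then c i else a i"
    have eq: "(if i \<in> insert j D then c i else a i) = (?w(j := c j)) i" for i by auto
    have "?N (?w(j := c j)) \<le> ?N ?w"
      using ins J c[of j] by (intro contraction_coord) auto
    also have "?N ?w \<le> ?N a" using ins by blast
    finally show ?case by (simp only: eq)
  qed simp
  from this[of J] have "?N (\<lambda>i. if i \<in> J then c i else a i) \<le> ?N a" by simp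
  moreover have "(\<Sum>i\<in>J. (if i \<in> J then c i else a i) * x i) = (\<Sum>i\<in>J. c i * x i)" for x :: "'i \<Rightarrow> real"
    by (intro sum.cong) auto
  ultimately show ?thesis by simp
qed

text \<open>Shows that two points of \<open>T\<close> cannot be near each other in both directions:
  main parts of norm at most \<open>p / 8\<close> and a remainder with small coefficients do not
  reach norm \<open>p / 2\<close>. Relative to \<open>p / 2\<close>, and including the factor 3 from
  adding three powers, the parts are at most 3/4, 3/4 and 1/2; for \<open>4 \<le> p\<close> the sum
  of their \<open>p\<close>-th powers is below 1.\<close>

lemma moment_lt_of_parts:
  fixes a1 a2 c1 c2 :: "'i \<Rightarrow> real" and p :: nat and \<eta> :: real
  assumes J: "J1 \<subseteq> I" "J2 \<subseteq> I" "J \<subseteq> I" "card J \<le> p" and p: "4 \<le> p" and \<eta>: "0 \<le> \<eta>" "72240 * \<eta> \<le> 1/12"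
    and c: "\<And>i. i \<in> J1 \<Longrightarrow> \<bar>c1 i\<bar> \<le> \<bar>a1 i\<bar>" "\<And>i. i \<in> J2 \<Longrightarrow> \<bar>c2 i\<bar> \<le> \<bar>a2 i\<bar>"
    and small: "(\<integral>\<^sup>+x. ennreal (\<bar>\<Sum>i\<in>J1. a1 i * x i\<bar> ^ p) \<partial>\<mu>) \<le> ennreal ((real p / 8) ^ p)"
      "(\<integral>\<^sup>+x. ennreal (\<bar>\<Sum>i\<in>J2. a2 i * x i\<bar> ^ p) \<partial>\<mu>) \<le> ennreal ((real p / 8) ^ p)"
    and g: "\<And>x. \<bar>g x\<bar> \<le> \<bar>\<Sum>i\<in>J1. c1 i * x i\<bar> + \<bar>\<Sum>i\<in>J2. c2 i * x i\<bar> + \<eta> * (\<Sum>i\<in>J. \<bar>x i\<bar>)"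
  shows "(\<integral>\<^sup>+x. ennreal (\<bar>g x\<bar> ^ p) \<partial>\<mu>) < ennreal ((real p / 2) ^ p)"
proof -
  let ?P1 = "\<lambda>x. \<bar>\<Sum>i\<in>J1. c1 i * x i\<bar>" and ?P2 = "\<lambda>x. \<bar>\<Sum>i\<in>J2. c2 i * x i\<bar>" and ?P3 = "\<lambda>x :: 'i \<Rightarrow> real. \<Sum>i\<in>J. \<bar>x i\<bar>"
  note [measurable] = lin_measurable(1)[OF J(1)] lin_measurable(1)[OF J(2)] lin_measurable(2)[OF J(3), of "\<lambda>_. 1", simplified]
  have "(\<integral>\<^sup>+x. ennreal (\<bar>g x\<bar> ^ p) \<partial>\<mu>)
     \<le> (\<integral>\<^sup>+x. ennreal (3 ^ p) * (ennreal (?P1 x ^ p) + ennreal (?P2 x ^ p) + ennreal (\<eta> ^ p) * ennreal (?P3 x ^ p)) \<partial>\<mu>)"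
  proof (rule nn_integral_mono)
    fix x
    have P3: "0 \<le> ?P3 x" by (simp add: sum_nonneg)
    have "\<bar>g x\<bar> ^ p \<le> (?P1 x + ?P2 x + \<eta> * ?P3 x) ^ p" using g by (intro power_mono) auto
    also have "\<dots> \<le> 3 ^ p * (?P1 x ^ p + ?P2 x ^ p + (\<eta> * ?P3 x) ^ p)"
      using P3 \<eta> by (intro add3_power_le) auto
    finally have "ennreal (\<bar>g x\<bar> ^ p) \<le> ennreal (3 ^ p * (?P1 x ^ p + ?P2 x ^ p + \<eta> ^ p * ?P3 x ^ p))"
      by (intro ennreal_leI) (simp add: power_mult_distrib)
    also have "\<dots> = ennreal (3 ^ p) * (ennreal (?P1 x ^ p) + ennreal (?P2 x ^ p) + ennreal (\<eta> ^ p) * ennreal (?P3 x ^ p))"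
      using P3 \<eta> by (simp add: ennreal_mult)
    finally show "ennreal (\<bar>g x\<bar> ^ p) \<le> ennreal (3 ^ p) * (ennreal (?P1 x ^ p) + ennreal (?P2 x ^ p) + ennreal (\<eta> ^ p) * ennreal (?P3 x ^ p))" .
  qed
  also have "\<dots> = ennreal (3 ^ p) * ((\<integral>\<^sup>+x. ennreal (?P1 x ^ p) \<partial>\<mu>) + (\<integral>\<^sup>+x. ennreal (?P2 x ^ p) \<partial>\<mu>) + ennreal (\<eta> ^ p) * (\<integral>\<^sup>+x. ennreal (?P3 x ^ p) \<partial>\<mu>))"
    by (simp add: nn_integral_cmult nn_integral_add)
  also have "\<dots> \<le> ennreal (3 ^ p) * (ennreal ((real p / 8) ^ p) + ennreal ((real p / 8) ^ p) + ennreal (\<eta> ^ p) * ennreal ((72240 * real p) ^ p))"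
    using p J(3,4) by (intro mult_left_mono add_mono order_trans[OF contraction small(1)] order_trans[OF contraction small(2)] sum_abs_moment J c) auto
  also have "\<dots> = ennreal (3 ^ p * ((real p / 8) ^ p + (real p / 8) ^ p + \<eta> ^ p * (72240 * real p) ^ p))"
  proof -
    have "ennreal W * (ennreal X + ennreal X + ennreal Y * ennreal Z) = ennreal (W * (X + X + Y * Z))"
      if "0 \<le> W" "0 \<le> X" "0 \<le> Y" "0 \<le> Z" for W X Y Z
      using that by (simp add: ennreal_mult[symmetric] ennreal_plus[symmetric] del: ennreal_plus)
    then show ?thesis using \<eta> by simp
  qed
  also have "\<dots> < ennreal ((real p / 2) ^ p)"
  proof (rule ennreal_lessI)
    have "3 ^ p * ((real p / 8) ^ p + (real p / 8) ^ p + \<eta> ^ p * (72240 * real p) ^ p)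
        = (real p / 2) ^ p * (2 * (3/4) ^ p + (6 * (72240 * \<eta>)) ^ p)"
    proof -
      have "3 * (real p / 8) = real p / 2 * (3/4)" "3 * (\<eta> * (72240 * real p)) = real p / 2 * (6 * (72240 * \<eta>))"
        by simp_all
      then have "3 ^ p * (real p / 8) ^ p = (real p / 2) ^ p * (3/4) ^ p"
        "3 ^ p * (\<eta> ^ p * (72240 * real p) ^ p) = (real p / 2) ^ p * (6 * (72240 * \<eta>)) ^ p"
        by (simp_all only: power_mult_distrib[symmetric])
      then show ?thesis unfolding distrib_left by linarith
    qed
    also have "\<dots> < (real p / 2) ^ p * 1"
    proof (rule mult_strict_left_mono)
      have "(3/4 :: real) ^ p \<le> (3/4) ^ 4" using p by (intro power_decreasing) auto
      moreover have "(6 * (72240 * \<eta>)) ^ p \<le> (1/2) ^ p" using \<eta> by (intro power_mono) auto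
      moreover have "(1/2 :: real) ^ p \<le> (1/2) ^ 4" using p by (intro power_decreasing) auto
      moreover have "2 * (3/4) ^ 4 + (1/2) ^ 4 < (1 :: real)" by (simp add: power_divide)
      ultimately show "2 * (3/4) ^ p + (6 * (72240 * \<eta>)) ^ p < 1" by linarith
    qed (use p in auto)
    finally show "3 ^ p * ((real p / 8) ^ p + (real p / 8) ^ p + \<eta> ^ p * (72240 * real p) ^ p) < (real p / 2) ^ p" by simp
  qed (use p in auto)
  finally show ?thesis .
qed

text \<open>Contraposition of \<open>moment_bound\<close> for the minimum of the sums with absolute
  values. The bound on \<open>(\<Sum>i\<in>A. a i) / 2\<close> says that smoothing changes each of
  these sums by at most \<open>u\<close>.\<close>

lemma min_tail:
  fixes B :: "'s \<Rightarrow> 'i set" and a :: "'i \<Rightarrow> real" and p :: nat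
  assumes S: "finite S" "S \<noteq> {}" and B: "\<And>s. s \<in> S \<Longrightarrow> B s \<subseteq> A" "A \<subseteq> I"
    and a: "\<And>i. i \<in> I \<Longrightarrow> 0 \<le> a i" and sum: "(\<Sum>i\<in>A. a i) / 2 \<le> u" and u: "0 < u" and p: "1 \<le> p"
    and large: "ennreal ((3 * u) ^ p) < (\<integral>\<^sup>+x. ennreal ((Min ((\<lambda>s. \<Sum>i\<in>B s. a i * \<bar>x i\<bar>) ` S)) ^ p) \<partial>\<mu>)"
  shows "exp (- 4 * real p) \<le> measure \<nu> {y \<in> \<Omega>. \<forall>s\<in>S. u \<le> (\<Sum>i\<in>B s. a i * \<bar>y i\<bar>)}"
proof (rule ccontr)
  assume neg: "\<not> ?thesis"
  define V where "V = (\<lambda>x :: 'i \<Rightarrow> real. Min ((\<lambda>s. \<Sum>i\<in>B s. a i * \<bar>x i\<bar>) ` S))"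
  have BI: "B s \<subseteq> I" if "s \<in> S" for s using B that by blast
  have a': "0 \<le> a i" if "i \<in> B s" "s \<in> S" for i s using a BI that by blast
  have ge: "r \<le> V x \<longleftrightarrow> (\<forall>s\<in>S. r \<le> (\<Sum>i\<in>B s. a i * \<bar>x i\<bar>))" for r x
    unfolding V_def using S by (subst Min_ge_iff) auto
  have le: "V x \<le> (\<Sum>i\<in>B s. a i * \<bar>x i\<bar>)" if "s \<in> S" for s x using ge[of "V x" x] that by blast
  have "(\<integral>\<^sup>+x. ennreal (V x ^ p) \<partial>\<mu>) \<le> ennreal ((3 * u) ^ p)"
  proof (rule moment_bound)
    show "V \<in> borel_measurable Leb"
      unfolding V_def using S by (intro borel_measurable_Min lin_measurable BI) auto
    show "0 \<le> V x" for x unfolding ge using a' by (auto intro!: sum_nonneg)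
    show "V (x(i := - x i)) = V x" for x i
      unfolding V_def by (intro arg_cong[where f=Min] image_cong refl sum.cong) auto
    show "V x \<le> 2 * V (\<lambda>i\<in>I. (x i + y i) / 2)" if pos: "\<And>i. i \<in> I \<Longrightarrow> 0 < x i \<and> 0 < y i" for x y
    proof -
      have "V x / 2 \<le> (\<Sum>i\<in>B s. a i * \<bar>(\<lambda>i\<in>I. (x i + y i) / 2) i\<bar>)" if s: "s \<in> S" for s
      proof -
        have "V x / 2 \<le> (\<Sum>i\<in>B s. a i * \<bar>x i\<bar>) / 2" using le[OF s, of x] by simp
        also have "\<dots> = (\<Sum>i\<in>B s. a i * (\<bar>x i\<bar> / 2))" by (simp add: sum_divide_distrib)
        also have "\<dots> \<le> (\<Sum>i\<in>B s. a i * \<bar>(\<lambda>i\<in>I. (x i + y i) / 2) i\<bar>)"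
        proof (rule sum_mono)
          fix i assume i: "i \<in> B s"
          then have "i \<in> I" using BI[OF s] by blast
          then show "a i * (\<bar>x i\<bar> / 2) \<le> a i * \<bar>(\<lambda>i\<in>I. (x i + y i) / 2) i\<bar>"
            using pos[of i] a'[OF i s] by (intro mult_left_mono) auto
        qed
        finally show ?thesis .
      qed
      then have "V x / 2 \<le> V (\<lambda>i\<in>I. (x i + y i) / 2)" unfolding ge by blast
      then show ?thesis by simp
    qed
    show "V x \<le> V z + u" if near: "\<And>i. i \<in> I \<Longrightarrow> \<bar>x i - z i\<bar> \<le> 1/2" for x z
    proof -
      have "V x - u \<le> (\<Sum>i\<in>B s. a i * \<bar>z i\<bar>)" if s: "s \<in> S" for s
      proof -
        have "V x \<le> (\<Sum>i\<in>B s. a i * \<bar>x i\<bar>)" by (rule le[OF s])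
        also have "\<dots> \<le> (\<Sum>i\<in>B s. a i * \<bar>z i\<bar> + a i / 2)"
        proof (rule sum_mono)
          fix i assume i: "i \<in> B s"
          then have "i \<in> I" using BI[OF s] by blast
          then have "\<bar>x i\<bar> \<le> \<bar>z i\<bar> + 1/2" using near[of i] by linarith
          then have "a i * \<bar>x i\<bar> \<le> a i * (\<bar>z i\<bar> + 1/2)" using a'[OF i s] by (rule mult_left_mono)
          then show "a i * \<bar>x i\<bar> \<le> a i * \<bar>z i\<bar> + a i / 2" by (simp add: algebra_simps)
        qed
        also have "\<dots> = (\<Sum>i\<in>B s. a i * \<bar>z i\<bar>) + (\<Sum>i\<in>B s. a i) / 2" by (simp add: sum.distrib sum_divide_distrib)
        also have "(\<Sum>i\<in>B s. a i) \<le> (\<Sum>i\<in>A. a i)"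
          using B(1)[OF s] B(2) a by (intro sum_mono2) (auto intro: finite_subset[OF B(2) finite_I])
        finally show ?thesis using sum by simp
      qed
      then have "V x - u \<le> V z" unfolding ge by blast
      then show ?thesis by simp
    qed
    show "measure \<nu> {x \<in> \<Omega>. u \<le> V x} \<le> exp (- 4 * real p)" using neg by (simp add: ge)
  qed (use u p in auto)
  then show False using large by (simp add: V_def)
qed

end

section \<open>Counting separated sets\<close>

context uncond_log_concave
begin

text \<open>By invariance each fixed sign vector moves a random point out of \<open>E\<close> with
  probability at most 1/4. Markov's inequality for the number of such sign vectors gives the
  claim.\<close>

lemma prob_half_signs:
  assumes E: "E \<in> sets \<mu>" "3/4 \<le> measure \<mu> E"
  shows "1/2 \<le> measure \<mu> {x \<in> space \<mu>. card (signs I) \<le> 2 * card {e \<in> signs I. (\<lambda>i\<in>I. e i * x i) \<in> E}}"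
proof -
  have natle: "(real a \<le> 2 * real b) = (a \<le> 2 * b)" for a b :: nat by linarith
  define N where "N = card (signs I)"
  have N: "0 < N" by (simp add: N_def card_signs)
  have fin: "finite (signs I)" by (simp add: finite_signs)
  let ?g = "\<lambda>e. {x \<in> space \<mu>. (\<lambda>i\<in>I. e i * x i) \<in> E}"
  let ?bad = "\<lambda>e. space \<mu> - ?g e"
  have meas: "?g e \<in> sets \<mu>" for e
  proof -
    have "(\<lambda>x. \<lambda>i\<in>I. e i * x i) \<in> measurable \<mu> Leb"
      by (intro measurable_restrict) (auto intro!: borel_measurable_times component_measurable)
    then have "(\<lambda>x. \<lambda>i\<in>I. e i * x i) \<in> measurable \<mu> \<mu>" by (simp cong: measurable_cong_sets add: sets_\<mu>_Leb)
    from measurable_sets[OF this E(1)]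
    have "(\<lambda>x. \<lambda>i\<in>I. e i * x i) -` E \<inter> space \<mu> \<in> sets \<mu>" .
    also have "(\<lambda>x. \<lambda>i\<in>I. e i * x i) -` E \<inter> space \<mu> = ?g e" by blast
    finally show ?thesis .
  qed
  have inv: "measure \<mu> (?g e) = measure \<mu> E" if "e \<in> signs I" for e
    using that E by (intro sign_invariant) (auto simp: signs_def)
  have pbad: "measure \<mu> (?bad e) \<le> 1/4" if "e \<in> signs I" for e
    using inv[OF that] E meas by (simp add: \<mu>.prob_compl)
  let ?c = "\<lambda>x. card {e \<in> signs I. x \<in> ?bad e}"
  have "real N / 2 * measure \<mu> {x \<in> space \<mu>. real N / 2 \<le> real (?c x)} \<le> (\<Sum>e\<in>signs I. measure \<mu> (?bad e))"
    by (rule \<mu>.prob_card_ge_le[OF fin]) (use meas in auto)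
  also have "\<dots> \<le> (\<Sum>e\<in>signs I. 1/4)" by (intro sum_mono pbad)
  finally have le: "measure \<mu> {x \<in> space \<mu>. real N / 2 \<le> real (?c x)} \<le> 1/2"
    using N by (simp add: N_def field_simps)
  let ?H = "{x \<in> space \<mu>. real N / 2 \<le> real (?c x)}"
  let ?G = "{x \<in> space \<mu>. real N \<le> 2 * real (card {e \<in> signs I. x \<in> ?g e})}"
  have cm: "(\<lambda>x. real (?c x)) \<in> borel_measurable \<mu>" "(\<lambda>x. real (card {e \<in> signs I. x \<in> ?g e})) \<in> borel_measurable \<mu>"
  proof -
    have "real (card {e \<in> signs I. x \<in> D e}) = (\<Sum>e\<in>signs I. indicator (D e) x)" for x and D :: "('i \<Rightarrow> real) \<Rightarrow> ('i \<Rightarrow> real) set"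
      using fin by (simp add: indicator_def sum.If_cases Int_def)
    then show "(\<lambda>x. real (?c x)) \<in> borel_measurable \<mu>" "(\<lambda>x. real (card {e \<in> signs I. x \<in> ?g e})) \<in> borel_measurable \<mu>"
      using meas by (simp_all only:) (intro borel_measurable_sum borel_measurable_indicator sets.Diff sets.top; simp)+
  qed
  have "?H \<in> sets \<mu>" using cm(1) by measurable
  then have "1/2 \<le> measure \<mu> (space \<mu> - ?H)"
    using le by (simp add: \<mu>.prob_compl)
  also have "\<dots> \<le> measure \<mu> ?G"
  proof (rule \<mu>.finite_measure_mono)
    show "?G \<in> sets \<mu>"
      using cm(2) by measurable
    show "space \<mu> - ?H \<subseteq> ?G"
    proof
      fix x assume x: "x \<in> space \<mu> - ?H"
      have "N = ?c x + card {e \<in> signs I. x \<in> ?g e}"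
        unfolding N_def using x fin
        by (subst card_Un_disjoint[symmetric]) (auto intro!: arg_cong[where f=card])
      then have "real N = real (?c x) + real (card {e \<in> signs I. x \<in> ?g e})" by linarith
      moreover have "x \<in> space \<mu>" "\<not> real N / 2 \<le> real (?c x)" using x by blast+
      ultimately have "real N \<le> 2 * real (card {e \<in> signs I. x \<in> ?g e})" by linarith
      with \<open>x \<in> space \<mu>\<close> show "x \<in> ?G" by blast
    qed
  qed
  also have "?G
     = {x \<in> space \<mu>. card (signs I) \<le> 2 * card {e \<in> signs I. (\<lambda>i\<in>I. e i * x i) \<in> E}}"
    unfolding N_def by (intro Collect_cong conj_cong refl) (simp add: natle)
  finally show ?thesis .
qed

text \<open>The tails add up over \<open>t\<close> to the expected number of \<open>t\<close> that
  are big at a \<open>\<nu>\<close>-random \<open>y\<close>. This number is at most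
  \<open>m0\<close> off the exceptional set \<open>Y\<close>, and the gain inequality makes
  \<open>Y\<close> negligible. The coefficients \<open>a\<close> belong to the witness,
  \<open>b t\<close> to the supremum; of the far sets only inclusion in \<open>T\<close> and the
  alternative \<open>pairs\<close> are kept.\<close>

lemma packing_bound:
  fixes T :: "'t set" and A :: "'t \<Rightarrow> 'i set" and S :: "'t \<Rightarrow> 't set" and a :: "'i \<Rightarrow> real" and b :: "'t \<Rightarrow> 'i \<Rightarrow> real"
    and u r q :: real and v d j :: nat
  assumes T: "finite T" and A: "\<And>t. t \<in> T \<Longrightarrow> A t \<subseteq> I" "\<And>t. t \<in> T \<Longrightarrow> card (A t) \<le> d"
    and S: "\<And>t. t \<in> T \<Longrightarrow> S t \<subseteq> T"
    and pairs: "\<And>t s. t \<in> T \<Longrightarrow> s \<in> T \<Longrightarrow> t \<noteq> s \<Longrightarrow> s \<in> S t \<or> t \<in> S s"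
    and a: "\<And>i. i \<in> I \<Longrightarrow> 0 \<le> a i" and b: "\<And>t i. t \<in> T \<Longrightarrow> i \<in> A t \<Longrightarrow> a i \<le> 2 * b t i"
    and traces: "\<And>J. J \<subseteq> I \<Longrightarrow> card ((\<lambda>B. B \<inter> J) ` A ` T) \<le> (card J + 1) ^ v"
    and tail: "\<And>t. t \<in> T \<Longrightarrow> q \<le> measure \<nu> {y \<in> \<Omega>. \<forall>s\<in>S t. u \<le> (\<Sum>i\<in>A t - A s. a i * \<bar>y i\<bar>)}"
    and small: "3/4 \<le> measure \<mu> {x \<in> space \<mu>. \<forall>t\<in>T. \<forall>s\<in>S t. \<bar>\<Sum>i\<in>A t - A s. b t i * x i\<bar> < r}"
    and u: "0 < u" and r: "\<And>t. t \<in> T \<Longrightarrow> r + (\<Sum>i\<in>A t. \<bar>b t i\<bar>) / 2 \<le> u / 32"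
  shows "real (card T) * q \<le> real ((j + 1) ^ v * 2 ^ (d + 1)) + 2 * real (card T) * (16/25) ^ j"
proof -
  have natle: "(real a \<le> 2 * real b) = (a \<le> 2 * b)" for a b :: nat by linarith
  have fA: "finite (A t)" if "t \<in> T" for t using A(1)[OF that] finite_I finite_subset by blast
  define big where "big = (\<lambda>t (y :: 'i \<Rightarrow> real). \<forall>s\<in>S t. u \<le> (\<Sum>i\<in>A t - A s. a i * \<bar>y i\<bar>))"
  define sm where "sm = (\<lambda>r' (x :: 'i \<Rightarrow> real). \<forall>t\<in>T. \<forall>s\<in>S t. \<bar>\<Sum>i\<in>A t - A s. b t i * x i\<bar> < r')"
  define half where "half = (\<lambda>r' x. card (signs I) \<le> 2 * card {e \<in> signs I. sm r' (\<lambda>i\<in>I. e i * x i)})"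
  define m0 where "m0 = (j + 1) ^ v * 2 ^ (d + 1)"
  have fS: "finite (S t)" if "t \<in> T" for t using S[OF that] T finite_subset by blast
  have lin_meas: "(\<lambda>x. \<Sum>i\<in>A t - A s. c i * x i) \<in> borel_measurable Leb" "(\<lambda>x. \<Sum>i\<in>A t - A s. c i * \<bar>x i\<bar>) \<in> borel_measurable Leb"
    if "t \<in> T" for t s and c :: "'i \<Rightarrow> real"
    using A(1)[OF that] by (auto intro!: borel_measurable_sum borel_measurable_times borel_measurable_abs component_measurable)
  have sm_sets: "{x \<in> \<Omega>. sm r' x} \<in> sets Leb" for r'
  proof -
    have "{x \<in> space Leb. sm r' x} \<in> sets Leb"
      unfolding sm_def
    proof (intro sets.sets_Collect_finite_All T fS)
      fix t s assume "t \<in> T" "s \<in> S t"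
      note [measurable] = lin_meas[OF \<open>t \<in> T\<close>]
      show "{x \<in> space Leb. \<bar>\<Sum>i\<in>A t - A s. b t i * x i\<bar> < r'} \<in> sets Leb" by measurable
    qed
    then show ?thesis by (simp add: space_Leb)
  qed
  have big_sets: "{y \<in> \<Omega>. big t y} \<in> sets Leb" if "t \<in> T" for t
  proof -
    have "{y \<in> space Leb. big t y} \<in> sets Leb"
      unfolding big_def
    proof (intro sets.sets_Collect_finite_All fS that)
      fix s assume "s \<in> S t"
      note [measurable] = lin_meas[OF that]
      show "{y \<in> space Leb. u \<le> (\<Sum>i\<in>A t - A s. a i * \<bar>y i\<bar>)} \<in> sets Leb" by measurable
    qed
    then show ?thesis by (simp add: space_Leb)
  qed
  \<comment> \<open>On \<open>A t\<close> the signs are set to those of \<open>k\<close>. If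
    \<open>t\<close> and \<open>s\<close> produce a common pattern, the sign vector used for
    \<open>s\<close> agrees with \<open>k\<close> on \<open>A t - A s\<close>, so its sum there is a
    sum of absolute values: large by \<open>far\<close>, small by membership in
    \<open>?G\<close>.\<close>
  have cluster: "card C \<le> 2 ^ (d + 1)"
    if C: "C \<subseteq> T" and half: "half (u/32) k"
      and far: "\<And>t s. t \<in> C \<Longrightarrow> s \<in> C \<Longrightarrow> s \<in> S t \<Longrightarrow> u / 32 \<le> (\<Sum>i\<in>A t - A s. b t i * \<bar>k i\<bar>)" for C k
  proof (rule card_le_of_disjoint_sign_changes[where I=I and A=A
        and \<sigma>="\<lambda>i. if 0 \<le> k i then 1 else - 1" and G="{e \<in> signs I. sm (u/32) (\<lambda>i\<in>I. e i * k i)}"])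
    let ?\<sigma> = "\<lambda>i. if 0 \<le> k i then 1 else - 1 :: real"
    let ?G = "{e \<in> signs I. sm (u/32) (\<lambda>i\<in>I. e i * k i)}"
    show "finite C" using C T finite_subset by blast
    show "A t \<subseteq> I \<and> card (A t) \<le> d" if "t \<in> C" for t using that C A by blast
    show "?G \<subseteq> signs I" by blast
    show "card (signs I) \<le> 2 * card ?G" using half by (simp add: half_def)
    have no: False
      if t: "t \<in> C" "s \<in> C" "s \<in> S t" and e: "e' \<in> ?G"
        and eq: "(\<lambda>i\<in>I. if i \<in> A t then ?\<sigma> i else e i) = (\<lambda>i\<in>I. if i \<in> A s then ?\<sigma> i else e' i)" for t s e e'
    proof -
      have "e' i * k i = \<bar>k i\<bar>" if i: "i \<in> A t - A s" for i
      proof -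
        have iI: "i \<in> I" using i A(1)[of t] t(1) C by blast
        have "?\<sigma> i = e' i" using fun_cong[OF eq, of i] i iI by simp
        then show ?thesis by (metis abs_of_nonneg abs_of_neg mult_1 mult_minus1 not_le)
      qed
      then have "(\<Sum>i\<in>A t - A s. b t i * (\<lambda>i\<in>I. e' i * k i) i) = (\<Sum>i\<in>A t - A s. b t i * \<bar>k i\<bar>)"
        using A(1)[of t] t(1) C by (intro sum.cong refl) auto
      moreover have "\<bar>\<Sum>i\<in>A t - A s. b t i * (\<lambda>i\<in>I. e' i * k i) i\<bar> < u / 32"
        using e t C unfolding sm_def by blast
      ultimately show False using far[OF t] by linarith
    qed
    show "(\<lambda>i\<in>I. if i \<in> A t then ?\<sigma> i else e i) \<noteq> (\<lambda>i\<in>I. if i \<in> A t' then ?\<sigma> i else e' i)"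
      if t: "t \<in> C" "t' \<in> C" "t \<noteq> t'" and e: "e \<in> ?G" "e' \<in> ?G" for t t' e e'
    proof
      assume eq: "(\<lambda>i\<in>I. if i \<in> A t then ?\<sigma> i else e i) = (\<lambda>i\<in>I. if i \<in> A t' then ?\<sigma> i else e' i)"
      from pairs[of t t'] t C consider "t' \<in> S t" | "t \<in> S t'" by blast
      then show False
      proof cases
        case 1
        from no[OF t(1,2) 1 e(2) eq] show False .
      next
        case 2
        from no[OF t(2,1) 2 e(1) eq[symmetric]] show False .
      qed
    qed
  qed auto
  have count: "card {t \<in> T. big t y} \<le> m0"
    if half: "half (u/32) k" and J: "card {i \<in> I. 16 * \<bar>k i\<bar> < \<bar>y i\<bar>} \<le> j" for k y
  proof -
    \<comment> \<open>Points with equal traces on \<open>J\<close> differ only off \<open>J\<close>.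
      There \<open>y\<close> is at most 16 times \<open>k\<close> in absolute value; with the factor
      2 between \<open>a\<close> and \<open>b t\<close> this turns \<open>u\<close> into
      \<open>u / 32\<close>.\<close>
    define J where "J = {i \<in> I. 16 * \<bar>k i\<bar> < \<bar>y i\<bar>}"
    let ?R = "(\<lambda>B. B \<inter> J) ` A ` T"
    let ?C = "\<lambda>D. {t \<in> T. big t y \<and> A t \<inter> J = D}"
    have "card {t \<in> T. big t y} \<le> card (\<Union>D\<in>?R. ?C D)"
      using T by (intro card_mono) auto
    also have "\<dots> \<le> (\<Sum>D\<in>?R. card (?C D))" using T by (intro card_UN_le) auto
    also have "\<dots> \<le> (\<Sum>D\<in>?R. 2 ^ (d + 1))"
    proof (intro sum_mono cluster)
      fix D t s assume ts: "t \<in> ?C D" "s \<in> ?C D" "s \<in> S t"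
      have "u \<le> (\<Sum>i\<in>A t - A s. a i * \<bar>y i\<bar>)" using ts by (auto simp: big_def)
      also have "\<dots> \<le> (\<Sum>i\<in>A t - A s. 32 * (b t i * \<bar>k i\<bar>))"
      proof (rule sum_mono)
        fix i assume i: "i \<in> A t - A s"
        have iI: "i \<in> I" using i ts A(1)[of t] by blast
        have "i \<notin> J" using i ts by blast
        then have "\<bar>y i\<bar> \<le> 16 * \<bar>k i\<bar>" using iI by (simp add: J_def not_less)
        moreover have "a i \<le> 2 * b t i" using b[of t i] i ts by blast
        ultimately have "a i * \<bar>y i\<bar> \<le> (2 * b t i) * (16 * \<bar>k i\<bar>)"
          using a[OF iI] by (intro mult_mono) auto
        then show "a i * \<bar>y i\<bar> \<le> 32 * (b t i * \<bar>k i\<bar>)" by simp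
      qed
      finally show "u / 32 \<le> (\<Sum>i\<in>A t - A s. b t i * \<bar>k i\<bar>)" by (simp add: sum_distrib_left[symmetric])
    qed (use half in auto)
    also have "\<dots> = card ?R * 2 ^ (d + 1)" by simp
    also have "\<dots> \<le> (j + 1) ^ v * 2 ^ (d + 1)"
    proof (rule mult_right_mono)
      have "card ?R \<le> (card J + 1) ^ v" by (rule traces) (auto simp: J_def)
      also have "\<dots> \<le> (j + 1) ^ v" using J by (intro power_mono) (auto simp: J_def)
      finally show "card ?R \<le> (j + 1) ^ v" .
    qed simp
    finally show ?thesis by (simp add: m0_def)
  qed
  define Y where "Y = {y \<in> \<Omega>. m0 < card {t \<in> T. big t y}}"
  define B where "B = {k \<in> \<Omega>. half (u/32) k}"
  have flip: "x(i := - x i) \<in> \<Omega>" if "x \<in> \<Omega>" "i \<in> I" for x i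
    using that by (auto simp: PiE_iff extensional_def)
  have card_sum: "real (card {t \<in> Q. y \<in> D t}) = (\<Sum>t\<in>Q. indicator (D t) y)"
    if "finite Q" for Q :: "'z set" and D :: "'z \<Rightarrow> ('i \<Rightarrow> real) set" and y
    using that by (simp add: indicator_def sum.If_cases Int_def)
  have Y: "Y \<in> sets Leb"
  proof -
    let ?D = "\<lambda>t. {y \<in> \<Omega>. big t y}"
    have [measurable]: "(\<lambda>y. \<Sum>t\<in>T. indicator (?D t) y :: real) \<in> borel_measurable Leb"
      by (intro borel_measurable_sum borel_measurable_indicator big_sets)
    have "Y = {y \<in> space Leb. real m0 < real (card {t \<in> T. y \<in> ?D t})}"
      by (auto simp: Y_def space_Leb)
    also have "\<dots> = {y \<in> space Leb. real m0 < (\<Sum>t\<in>T. indicator (?D t) y)}"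
      by (simp only: card_sum[OF T])
    also have "\<dots> \<in> sets Leb" by measurable
    finally show ?thesis .
  qed
  have symY: "usym Y"
    unfolding usym_def
  proof (intro ballI)
    fix x i assume x: "x \<in> \<Omega>" and i: "i \<in> I"
    have "big t (x(i := - x i)) = big t x" for t
      unfolding big_def by (intro ball_cong refl arg_cong[where f="\<lambda>z. u \<le> z"] sum.cong) auto
    then show "x(i := - x i) \<in> Y \<longleftrightarrow> x \<in> Y" using flip[OF x i] x by (simp add: Y_def)
  qed
  have B: "B \<in> sets Leb"
  proof -
    let ?D = "\<lambda>e. {k \<in> space Leb. (\<lambda>i\<in>I. e i * k i) \<in> {x \<in> \<Omega>. sm (u/32) x}}"
    have D: "?D e \<in> sets Leb" for e
    proof -
      have "(\<lambda>x. \<lambda>i\<in>I. e i * x i) \<in> measurable Leb Leb"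
        by (intro measurable_restrict) (auto intro!: borel_measurable_times component_measurable)
      from measurable_sets[OF this sm_sets[of "u/32"]]
      have "(\<lambda>x. \<lambda>i\<in>I. e i * x i) -` {x \<in> \<Omega>. sm (u/32) x} \<inter> space Leb \<in> sets Leb" .
      also have "(\<lambda>x. \<lambda>i\<in>I. e i * x i) -` {x \<in> \<Omega>. sm (u/32) x} \<inter> space Leb = ?D e" by blast
      finally show ?thesis .
    qed
    have [measurable]: "(\<lambda>y. \<Sum>e\<in>signs I. indicator (?D e) y :: real) \<in> borel_measurable Leb"
      by (intro borel_measurable_sum borel_measurable_indicator D)
    have "B = {k \<in> space Leb. real (card (signs I)) \<le> 2 * real (card {e \<in> signs I. k \<in> ?D e})}"
    proof -
      have "{e \<in> signs I. k \<in> ?D e} = {e \<in> signs I. sm (u/32) (\<lambda>i\<in>I. e i * k i)}" if "k \<in> space Leb" for k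
        using that by auto
      then show ?thesis
        unfolding B_def half_def space_Leb[symmetric]
        by (intro Collect_cong conj_cong refl) (simp add: natle)
    qed
    also have "\<dots> = {k \<in> space Leb. real (card (signs I)) \<le> 2 * (\<Sum>e\<in>signs I. indicator (?D e) k)}"
      by (simp only: card_sum[OF finite_signs[OF finite_I]])
    also have "\<dots> \<in> sets Leb" by measurable
    finally show ?thesis .
  qed
  have symB: "usym B"
    unfolding usym_def
  proof (intro ballI)
    fix x i assume x: "x \<in> \<Omega>" and i: "i \<in> I"
    let ?f = "\<lambda>e :: 'i \<Rightarrow> real. e(i := - e i)"
    \<comment> \<open>A flip of \<open>x\<close> can be moved to the sign vector, and flipping
      permutes the sign vectors.\<close>
    have eq: "(\<lambda>j\<in>I. e j * (x(i := - x i)) j) = (\<lambda>j\<in>I. ?f e j * x j)" for e by auto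
    have fs: "?f e \<in> signs I" if "e \<in> signs I" for e
      using that i by (auto simp: signs_def PiE_iff extensional_def)
    have "bij_betw ?f {e \<in> signs I. sm (u/32) (\<lambda>j\<in>I. e j * (x(i := - x i)) j)} {e \<in> signs I. sm (u/32) (\<lambda>j\<in>I. e j * x j)}"
    proof (rule bij_betw_byWitness[where f'="?f"])
      show "?f ` {e \<in> signs I. sm (u/32) (\<lambda>j\<in>I. e j * (x(i := - x i)) j)} \<subseteq> {e \<in> signs I. sm (u/32) (\<lambda>j\<in>I. e j * x j)}"
        using fs by (auto simp only: eq mem_Collect_eq)
      have "(\<lambda>j\<in>I. e j * x j) = (\<lambda>j\<in>I. ?f e j * (x(i := - x i)) j)" for e by auto
      then show "?f ` {e \<in> signs I. sm (u/32) (\<lambda>j\<in>I. e j * x j)} \<subseteq> {e \<in> signs I. sm (u/32) (\<lambda>j\<in>I. e j * (x(i := - x i)) j)}"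
        using fs by auto
    qed auto
    then have "half (u/32) (x(i := - x i)) = half (u/32) x"
      unfolding half_def by (simp add: bij_betw_same_card)
    then show "x(i := - x i) \<in> B \<longleftrightarrow> x \<in> B" using flip[OF x i] x by (simp add: B_def)
  qed
  have PB: "1/2 \<le> measure \<nu> B"
  proof -
    let ?E = "{x \<in> space \<mu>. sm r x}"
    have E: "?E \<in> sets \<mu>" using sm_sets[of r] by (simp add: sets_\<mu>_Leb space_\<mu>)
    let ?H = "{x \<in> space \<mu>. card (signs I) \<le> 2 * card {e \<in> signs I. (\<lambda>i\<in>I. e i * x i) \<in> ?E}}"
    have "1/2 \<le> measure \<mu> ?H"
      by (rule prob_half_signs[OF E]) (use small in \<open>simp add: sm_def\<close>)
    also have "\<dots> \<le> measure \<nu> B"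
    proof (rule measure_le_\<nu>[OF _ B])
      \<comment> \<open>A nonmeasurable set would have measure 0, so the lower bound just obtained
        proves measurability.\<close>
      show "?H \<in> sets \<mu>" using \<open>1/2 \<le> measure \<mu> ?H\<close> measure_notin_sets[of ?H \<mu>] by force
      fix x k :: "'i \<Rightarrow> real"
      assume x: "x \<in> ?H" and k: "k \<in> \<Omega>" and near: "\<And>i. i \<in> I \<Longrightarrow> \<bar>x i - k i\<bar> \<le> 1/2"
      have "sm (u/32) (\<lambda>i\<in>I. e i * k i)" if e: "e \<in> signs I" "sm r (\<lambda>i\<in>I. e i * x i)" for e
        unfolding sm_def
      proof (intro ballI)
        fix t s assume t: "t \<in> T" "s \<in> S t"
        have sub: "A t - A s \<subseteq> I" using A(1)[OF t(1)] by blast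
        have "\<bar>(\<Sum>i\<in>A t - A s. b t i * (\<lambda>i\<in>I. e i * k i) i) - (\<Sum>i\<in>A t - A s. b t i * (\<lambda>i\<in>I. e i * x i) i)\<bar>
            = \<bar>\<Sum>i\<in>A t - A s. b t i * (e i * (k i - x i))\<bar>"
          unfolding sum_subtractf[symmetric] using sub
          by (intro arg_cong[where f=abs] sum.cong refl) (auto simp: algebra_simps)
        also have "\<dots> \<le> (\<Sum>i\<in>A t - A s. \<bar>b t i\<bar> * (1/2))"
        proof (rule order_trans[OF sum_abs sum_mono])
          fix i assume "i \<in> A t - A s"
          then have iI: "i \<in> I" using sub by blast
          have "\<bar>e i\<bar> = 1" using e(1) iI by (force simp: signs_def PiE_iff)
          then have "\<bar>b t i * (e i * (k i - x i))\<bar> = \<bar>b t i\<bar> * \<bar>x i - k i\<bar>" by (simp add: abs_mult abs_minus_commute)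
          also have "\<dots> \<le> \<bar>b t i\<bar> * (1/2)" by (intro mult_left_mono near iI) auto
          finally show "\<bar>b t i * (e i * (k i - x i))\<bar> \<le> \<bar>b t i\<bar> * (1/2)" .
        qed
        also have "\<dots> \<le> (\<Sum>i\<in>A t. \<bar>b t i\<bar> * (1/2))" using fA[OF t(1)] by (intro sum_mono2) auto
        also have "\<dots> = (\<Sum>i\<in>A t. \<bar>b t i\<bar>) / 2" by (simp add: sum_divide_distrib)
        also have "\<dots> \<le> u / 32 - r" using r[OF t(1)] by linarith
        finally show "\<bar>\<Sum>i\<in>A t - A s. b t i * (\<lambda>i\<in>I. e i * k i) i\<bar> < u / 32"
          using e(2) t unfolding sm_def by fastforce
      qed
      then have "card {e \<in> signs I. (\<lambda>i\<in>I. e i * x i) \<in> ?E} \<le> card {e \<in> signs I. sm (u/32) (\<lambda>i\<in>I. e i * k i)}"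
        by (intro card_mono) (auto simp: finite_signs)
      then show "k \<in> B" using x k by (auto simp: B_def half_def)
    qed
    finally show ?thesis .
  qed
  \<comment> \<open>Were the ratio above 16 in fewer than \<open>j\<close> coordinates,
    \<open>count\<close> would contradict membership in \<open>Y\<close>.\<close>
  have gain: "(25/16) ^ j * (measure \<nu> Y * measure \<nu> B) \<le> (measure \<nu> (\<Omega>))\<^sup>2"
  proof (rule gain_inequality[where q="\<lambda>_. True", OF Y B PiE_UNIV_sets symY symB usym_UNIV])
    fix x y assume x: "x \<in> Y" and y: "y \<in> B" and pos: "\<And>i. i \<in> I \<Longrightarrow> 0 < x i \<and> 0 < y i"
    let ?J = "{i \<in> I. 16 * \<bar>y i\<bar> < \<bar>x i\<bar>}"
    have "j \<le> card ?J"
    proof (rule ccontr)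
      assume "\<not> j \<le> card ?J"
      then have "card {t \<in> T. big t x} \<le> m0" using y by (intro count[of y]) (auto simp: B_def)
      then show False using x by (simp add: Y_def)
    qed
    then have "(25/16 :: real) ^ j \<le> (25/16) ^ card ?J" by (intro power_increasing) auto
    also have "\<dots> = (\<Prod>i\<in>?J. 25/16)" by simp
    also have "\<dots> \<le> (\<Prod>i\<in>?J. pl_gain True (x i) (y i))"
    proof (rule prod_mono)
      fix i assume "i \<in> ?J"
      then show "0 \<le> (25/16 :: real) \<and> 25/16 \<le> pl_gain True (x i) (y i)"
        using pos[of i] pl_gain_ge_of_ratio[of "y i" "x i"] by auto
    qed
    also have "\<dots> \<le> (\<Prod>i\<in>I. pl_gain True (x i) (y i))"
    proof (rule prod_mono2)
      show "1 \<le> pl_gain True (x i) (y i)" if "i \<in> I - ?J" for i using pos[of i] that pl_gain_ge_1 by auto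
      show "0 \<le> pl_gain True (x i) (y i)" if "i \<in> ?J" for i using pos[of i] that pl_gain_ge_1[of "x i" "y i" True] by auto
    qed auto
    finally show "(\<lambda>i\<in>I. pl_mean True (x i) (y i)) \<in> \<Omega> \<and> (25/16 :: real) ^ j \<le> (\<Prod>i\<in>I. pl_gain True (x i) (y i))"
      by auto
  qed simp
  have PY: "measure \<nu> Y \<le> 2 * (16/25) ^ j"
  proof -
    have "measure \<nu> Y * (1/2) \<le> measure \<nu> Y * measure \<nu> B" using PB by (intro mult_left_mono) auto
    then have "(25/16) ^ j * (measure \<nu> Y * (1/2)) \<le> (25/16) ^ j * (measure \<nu> Y * measure \<nu> B)"
      by (rule mult_left_mono) simp
    also have "\<dots> \<le> 1" using gain power_le_one[of "measure \<nu> (\<Omega>)" 2] by simp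
    finally have "(16/25) ^ j * ((25/16) ^ j * (measure \<nu> Y * (1/2))) \<le> (16/25) ^ j * 1"
      by (intro mult_left_mono) auto
    moreover have "(16/25 :: real) ^ j * (25/16) ^ j = 1" by (simp flip: power_mult_distrib)
    ultimately show ?thesis by (simp add: mult.assoc[symmetric])
  qed
  let ?D = "\<lambda>t. {y \<in> \<Omega>. big t y}"
  have "real (card T) * q = (\<Sum>t\<in>T. q)" by simp
  also have "\<dots> \<le> (\<Sum>t\<in>T. measure \<nu> (?D t))" using tail by (intro sum_mono) (simp add: big_def)
  also have "\<dots> = (\<integral>y. (\<Sum>t\<in>T. indicator (?D t) y) \<partial>\<nu>)"
    using big_sets by (subst Bochner_Integration.integral_sum) (auto simp: \<nu>.emeasure_eq_measure)
  also have "\<dots> \<le> (\<integral>y. real m0 + real (card T) * indicator Y y \<partial>\<nu>)"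
  proof (rule integral_mono)
    show "integrable \<nu> (\<lambda>y. \<Sum>t\<in>T. indicator (?D t) y :: real)"
      using big_sets by (intro Bochner_Integration.integrable_sum integrable_real_indicator) (auto simp: \<nu>.emeasure_eq_measure)
    show "integrable \<nu> (\<lambda>y. real m0 + real (card T) * indicator Y y)"
      using Y by (intro Bochner_Integration.integrable_add integrable_mult_right integrable_real_indicator) (auto simp: \<nu>.emeasure_eq_measure)
    fix y assume "y \<in> space \<nu>"
    then have y: "y \<in> \<Omega>" by (simp add: space_\<nu>)
    have eq: "(\<Sum>t\<in>T. indicator (?D t) y) = real (card {t \<in> T. big t y})"
      using card_sum[OF T, of y ?D] y by simp
    have "card {t \<in> T. big t y} \<le> card T" using T by (intro card_mono) auto
    then show "(\<Sum>t\<in>T. indicator (?D t) y) \<le> real m0 + real (card T) * indicator Y y"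
      unfolding eq using y by (auto simp: Y_def split: split_indicator)
  qed
  also have "\<dots> = real m0 + real (card T) * measure \<nu> Y"
    using Y by (subst Bochner_Integration.integral_add) (auto simp: \<nu>.emeasure_eq_measure \<nu>.prob_space)
  also have "\<dots> \<le> real m0 + real (card T) * (2 * (16/25) ^ j)"
    using PY by (intro add_left_mono mult_left_mono) auto
  finally show ?thesis by (simp add: m0_def)
qed

end

section \<open>The minoration\<close>

lemma law_uncond_log_concave:
  assumes rv: "random_vector n M X" and iso: "isotropic n M X" and unc: "one_unconditional n M X"
    and lc: "log_concave_measure n (law n M X)"
  shows "uncond_log_concave {1..n} (law n M X)"
proof -
  interpret M: prob_space M using rv by (simp add: random_vector_def)
  have X: "X \<in> measurable M (Rn n)" using rv by (simp add: random_vector_def)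
  have sets: "sets (law n M X) = sets (Rn n)" by (simp add: law_def)
  have space: "space (law n M X) = space (Rn n)" by (simp add: law_def)
  have comp: "(\<lambda>x. x i) \<in> borel_measurable (Rn n)" if "i \<in> {1..n}" for i
    unfolding Rn_def using that by (rule measurable_component_singleton)
  show ?thesis
  proof (rule uncond_log_concave.intro)
    show "finite {1..n}" by simp
    show "prob_space (law n M X)" unfolding law_def by (rule M.prob_space_distr[OF X])
    show "sets (law n M X) = sets (PiM {1..n} (\<lambda>_. borel))" by (simp add: sets Rn_def)
  next
    fix \<eta> :: "nat \<Rightarrow> real" and A
    assume \<eta>: "\<And>i. i \<in> {1..n} \<Longrightarrow> \<eta> i \<in> {-1, 1}" and "A \<in> sets (law n M X)"
    then have A: "A \<in> sets (Rn n)" by (simp add: sets)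
    let ?f = "\<lambda>x. \<lambda>i\<in>{1..n}. \<eta> i * x i"
    have f: "?f \<in> measurable (Rn n) (Rn n)"
    proof -
      have "?f \<in> measurable (Rn n) (PiM {1..n} (\<lambda>_. borel))"
        by (intro measurable_restrict borel_measurable_times borel_measurable_const comp)
      then show ?thesis by (simp add: Rn_def)
    qed
    have "law n M (\<lambda>\<omega>. ?f (X \<omega>)) = law n M X" using unc \<eta> unfolding one_unconditional_def by blast
    moreover have "law n M (\<lambda>\<omega>. ?f (X \<omega>)) = distr (law n M X) (Rn n) ?f"
      unfolding law_def using X f by (subst distr_distr) (auto simp: comp_def)
    ultimately have "measure (law n M X) A = measure (distr (law n M X) (Rn n) ?f) A" by simp
    also have "\<dots> = measure (law n M X) (?f -` A \<inter> space (law n M X))"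
      using f A by (intro measure_distr) (auto simp: law_def)
    also have "?f -` A \<inter> space (law n M X) = {x \<in> space (law n M X). ?f x \<in> A}" by blast
    finally show "measure (law n M X) {x \<in> space (law n M X). ?f x \<in> A} = measure (law n M X) A" ..
  next
    fix A B and l :: real
    assume "A \<in> sets (law n M X)" "B \<in> sets (law n M X)" "A \<noteq> {}" "B \<noteq> {}" "0 < l" "l < 1"
      "{(\<lambda>i\<in>{1..n}. l * a i + (1 - l) * b i) | a b. a \<in> A \<and> b \<in> B} \<in> sets (law n M X)"
    then show "measure (law n M X) A powr l * measure (law n M X) B powr (1 - l)
         \<le> measure (law n M X) {(\<lambda>i\<in>{1..n}. l * a i + (1 - l) * b i) | a b. a \<in> A \<and> b \<in> B}"
      using lc unfolding log_concave_measure_def minkowski_comb_def sets by blast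
  next
    fix i assume i: "i \<in> {1..n}"
    have "(\<integral>\<^sup>+x. ennreal ((x i)\<^sup>2) \<partial>law n M X) = (\<integral>\<^sup>+\<omega>. ennreal ((X \<omega> i)\<^sup>2) \<partial>M)"
      unfolding law_def using X comp[OF i] by (subst nn_integral_distr) auto
    also have "\<dots> = ennreal (\<integral>\<omega>. (X \<omega> i)\<^sup>2 \<partial>M)"
    proof (rule nn_integral_eq_integral)
      \<comment> \<open>The Bochner integral of a nonintegrable function is 0, so the value 1
        implies integrability.\<close>
      have "(\<integral>\<omega>. (X \<omega> i)\<^sup>2 \<partial>M) \<noteq> 0" using iso i unfolding isotropic_def power2_eq_square by auto
      then show "integrable M (\<lambda>\<omega>. (X \<omega> i)\<^sup>2)" using not_integrable_integral_eq by blast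
    qed simp
    also have "(\<integral>\<omega>. (X \<omega> i)\<^sup>2 \<partial>M) = 1" using iso i unfolding isotropic_def power2_eq_square by auto
    finally show "(\<integral>\<^sup>+x. ennreal ((x i)\<^sup>2) \<partial>law n M X) \<le> 1" by simp
  qed
qed

lemma Lp_norm_ge_iff:
  assumes "1 \<le> p" "0 \<le> c"
  shows "ennreal c \<le> Lp_norm M p Y \<longleftrightarrow> ennreal (c ^ p) \<le> (\<integral>\<^sup>+\<omega>. Y \<omega> ^ p \<partial>M)"
proof (cases "(\<integral>\<^sup>+\<omega>. Y \<omega> ^ p \<partial>M)")
  case (real r)
  have "c \<le> root p r \<longleftrightarrow> c ^ p \<le> r"
  proof
    assume "c \<le> root p r"
    then have "c ^ p \<le> root p r ^ p" using assms by (intro power_mono) auto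
    then show "c ^ p \<le> r" using assms real by simp
  next
    assume "c ^ p \<le> r"
    then have "root p (c ^ p) \<le> root p r" using assms by simp
    then show "c \<le> root p r" using assms by (simp add: real_root_power_cancel)
  qed
  then show ?thesis using real assms by (simp add: Lp_norm_def ennreal_le_iff)
qed (simp add: Lp_norm_def)

section \<open>The choice of the constants\<close>

text \<open>Since \<open>ln (1 / \<rho>) \<le> 1 / \<rho>\<close>, one has \<open>\<rho>\<^sup>2
  \<le> \<rho> / ln (1 / \<rho>) = 4 * C0 * \<delta>\<close>; a small \<open>\<delta>\<close>
  therefore forces a small \<open>\<rho>\<close>.\<close>

lemma rho_le:
  assumes "0 < \<rho>" "\<rho> \<le> exp (-1)" "\<rho> / ln (1 / \<rho>) = 4 * C0 * \<delta>" "0 < C0" "0 < r" "\<delta> \<le> r\<^sup>2 / (4 * C0)"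
  shows "\<rho> \<le> (r :: real)"
proof -
  have L: "ln (1 / \<rho>) \<ge> 1"
  proof -
    have "ln \<rho> \<le> ln (exp (-1))" using assms by (intro ln_mono) auto
    then show ?thesis using assms by (simp add: ln_div)
  qed
  have "ln (1 / \<rho>) \<le> 1 / \<rho> - 1" using assms by (intro ln_le_minus_one) auto
  then have "\<rho> * ln (1 / \<rho>) \<le> \<rho> * (1 / \<rho>)" using assms by (intro mult_left_mono) auto
  then have "\<rho> * ln (1 / \<rho>) \<le> 1" using assms by simp
  then have "\<rho> * (\<rho> * ln (1 / \<rho>)) \<le> \<rho> * 1" using assms by (intro mult_left_mono) auto
  then have "\<rho>\<^sup>2 \<le> \<rho> / ln (1 / \<rho>)" using L by (simp add: power2_eq_square field_simps)
  also have "\<dots> \<le> 4 * C0 * (r\<^sup>2 / (4 * C0))"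
    unfolding assms(3) using assms(4,6) by (intro mult_left_mono) auto
  also have "\<dots> = r\<^sup>2" using assms(4) by simp
  finally show ?thesis by (rule power2_le_imp_le) (use assms(5) in simp)
qed

text \<open>With \<open>j = 15 * p\<close> the exceptional term is at most half of the left side,
  because \<open>(16/25) ^ 5 \<le> exp (- 2)\<close>. What remains is
  \<open>N \<le> exp (7 * p + 4 * v * ln (1 + p))\<close>, which \<open>C \<ge> 12 > 7 + 4\<close>
  excludes, whichever of \<open>p\<close> and \<open>v * ln (1 + p)\<close> is larger.\<close>

lemma card_bound_contradiction:
  fixes N p v :: nat and C :: real
  assumes p: "4 \<le> p" and C: "12 \<le> C" and N: "exp (card_exponent C v p) \<le> real N"
    and le: "real N * exp (- 4 * real p) \<le> real ((15 * p + 1) ^ v * 2 ^ (p + 1)) + 2 * real N * (16/25) ^ (15 * p)"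
  shows False
proof -
  define L where "L = ln (1 + real p)"
  have L: "0 < L" using p by (simp add: L_def)
  have e1: "exp (1::real) \<le> 3" by (rule exp_le)
  have two: "(2::real) \<le> exp 1" using exp_ge_add_one_self[of 1] by simp
  have N0: "0 < real N" using N by (rule less_le_trans[OF exp_gt_zero])
  have "2 * (16/25 :: real) ^ (15 * p) \<le> exp (- 4 * real p) / 2"
  proof -
    have "exp (2::real) \<le> 3 ^ 2"
    proof -
      have "exp (2::real) = exp 1 ^ 2" by (simp flip: exp_of_nat_mult)
      also have "\<dots> \<le> 3 ^ 2" using e1 by (intro power_mono) auto
      finally show ?thesis .
    qed
    then have "1/9 \<le> exp (-2 :: real)" by (simp add: exp_minus field_simps)
    then have "(16/25 :: real) ^ 5 \<le> exp (-2)" by (simp add: power_divide)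
    then have "((16/25 :: real) ^ 5) ^ (3 * p) \<le> exp (-2) ^ (3 * p)" by (intro power_mono) auto
    also have "\<dots> = exp (- 6 * real p)" by (simp flip: exp_of_nat_mult)
    finally have 1: "(16/25 :: real) ^ (15 * p) \<le> exp (- 6 * real p)" by (simp flip: power_mult)
    have "(4::real) \<le> exp (2 * real p)"
    proof -
      have "(4::real) \<le> 1 + 2 * real p" using p by simp
      also have "\<dots> \<le> exp (2 * real p)" by (rule exp_ge_add_one_self)
      finally show ?thesis .
    qed
    then have "4 * exp (- 6 * real p) \<le> exp (2 * real p) * exp (- 6 * real p)" by (intro mult_right_mono) auto
    also have "\<dots> = exp (- 4 * real p)" by (simp flip: exp_add)
    finally show ?thesis using 1 by simp
  qed
  then have "real N * (2 * (16/25 :: real) ^ (15 * p)) \<le> real N * (exp (- 4 * real p) / 2)" using N0 by (intro mult_left_mono) auto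
  then have "real N * exp (- 4 * real p) \<le> 2 * real ((15 * p + 1) ^ v * 2 ^ (p + 1))" using le by linarith
  then have "exp (4 * real p) * (real N * exp (- 4 * real p)) \<le> exp (4 * real p) * (2 * real ((15 * p + 1) ^ v * 2 ^ (p + 1)))"
    by (intro mult_left_mono) auto
  also have "exp (4 * real p) * (real N * exp (- 4 * real p)) = real N" by (simp add: exp_minus)
  also have "exp (4 * real p) * (2 * real ((15 * p + 1) ^ v * 2 ^ (p + 1))) = exp (4 * real p) * (4 * 2 ^ p) * real ((15 * p + 1) ^ v)"
    by simp
  also have "\<dots> \<le> exp (4 * real p) * exp (3 * real p) * exp (4 * real v * L)"
  proof (intro mult_mono)
    have "(2::real) ^ p \<le> exp 1 ^ p" using two by (intro power_mono) auto
    also have "\<dots> = exp (real p)" by (simp flip: exp_of_nat_mult)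
    finally have a: "(2::real) ^ p \<le> exp (real p)" .
    have "(4::real) \<le> 1 + 2 * real p" using p by simp
    also have "\<dots> \<le> exp (2 * real p)" by (rule exp_ge_add_one_self)
    finally have "4 * 2 ^ p \<le> exp (2 * real p) * exp (real p)" using a by (intro mult_mono) auto
    then show "4 * 2 ^ p \<le> exp (3 * real p)" by (simp flip: exp_add)
    have "real (15 * p + 1) \<le> (1 + real p) ^ 4"
    proof -
      have "(1 + real p) ^ 4 = 1 + 4 * real p + 6 * real p ^ 2 + 4 * real p ^ 3 + real p ^ 4" by (simp add: power4_eq_xxxx power2_eq_square power3_eq_cube algebra_simps)
      moreover have "4 * real p \<le> real p ^ 2" using p by (simp add: power2_eq_square)
      moreover have "0 \<le> real p" "0 \<le> real p ^ 3" "0 \<le> real p ^ 4" "real (15 * p + 1) = 15 * real p + 1" by auto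
      ultimately show ?thesis by linarith
    qed
    also have "\<dots> = exp L ^ 4" using p by (simp add: L_def)
    finally have "real (15 * p + 1) ^ v \<le> (exp L ^ 4) ^ v" by (intro power_mono) auto
    also have "\<dots> = exp (4 * real v * L)" by (simp add: mult_ac flip: exp_of_nat_mult power_mult)
    finally show "real ((15 * p + 1) ^ v) \<le> exp (4 * real v * L)" by simp
  qed auto
  also have "\<dots> = exp (7 * real p + 4 * real v * L)" by (simp flip: exp_add)
  finally have "exp (card_exponent C v p) \<le> exp (7 * real p + 4 * real v * L)" using N by linarith
  then have le': "card_exponent C v p \<le> 7 * real p + 4 * real v * L" by simp
  show False
  proof (cases "real v \<le> real p / L")
    case True
    then have "real v * L \<le> real p" using L by (simp add: field_simps)
    moreover have "12 * real p \<le> C * real p" using C by (intro mult_right_mono) auto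
    moreover have "C * real p \<le> 7 * real p + 4 * (real v * L)"
      using le' True by (simp add: card_exponent_def L_def mult.assoc)
    ultimately show False using p by linarith
  next
    case False
    then have "real p < real v * L" using L by (simp add: field_simps)
    moreover have "12 * (real v * L) \<le> C * (real v * L)" using C L by (intro mult_right_mono) auto
    moreover have "C * (real v * L) \<le> 7 * real p + 4 * (real v * L)"
      using le' False by (simp add: card_exponent_def L_def mult.assoc)
    ultimately show False using p by linarith
  qed
qed


lemma minoration:
  fixes C0 Cbar c \<delta> \<rho> C :: real and p n v :: nat and k :: "nat \<Rightarrow> real" and T :: "(nat \<Rightarrow> real) set"
    and X :: "'a \<Rightarrow> nat \<Rightarrow> real"
  assumes C0: "1 \<le> C0" and Cbar: "0 < Cbar" and c: "0 < c" and C: "12 \<le> C" and \<delta>: "0 < \<delta>" "\<delta> \<le> 1 / (256 * Cbar * C0)"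
    and \<delta>_small: "\<delta> \<le> (min (1 / 4000000) (exp (- (1 / (2 * c)))))\<^sup>2 / (4 * C0)" and p: "4 \<le> p"
    and X: "random_vector n M X" "isotropic n M X" "one_unconditional n M X" "log_concave_measure n (law n M X)"
    and sf: "simplified_form n M X C0 \<delta> \<rho> p k f T"
    and vc: "has_vc_dim n (supp n ` T) v"
    and N: "real (card T) \<ge> exp (card_exponent C v p)"
    and wit: "\<And>t. t \<in> T \<Longrightarrow> common_witness n M X Cbar \<rho> p k T t"
  shows "real v \<le> c * real p \<and>
      (\<integral>\<^sup>+ \<omega>. (SUP t\<in>T. SUP s\<in>far_set n M X \<rho> p k T t.
          ennreal \<bar>lin_comb (supp n t - supp n s) t (X \<omega>)\<bar>) \<partial>M) \<ge> ennreal (real p / (1024 * Cbar))"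
proof -
  define \<mu> where "\<mu> = law n M X"
  interpret uncond_log_concave "{1..n}" \<mu> unfolding \<mu>_def by (rule law_uncond_log_concave[OF X])
  have X_meas: "X \<in> measurable M (Rn n)" using X(1) by (simp add: random_vector_def)
  have tr: "(\<integral>\<^sup>+x. g x \<partial>\<mu>) = (\<integral>\<^sup>+\<omega>. g (X \<omega>) \<partial>M)" if "g \<in> borel_measurable \<mu>" for g :: "_ \<Rightarrow> ennreal"
    using that X_meas unfolding \<mu>_def law_def by (subst nn_integral_distr) auto
  have p1: "1 \<le> p" using p by simp

  have sf': "0 < \<rho>" "\<rho> \<le> exp (-1)" "\<rho> / ln (1 / \<rho>) = 4 * C0 * \<delta>" "\<forall>i\<in>{1..n}. k i \<ge> \<rho>" "finite T"
    "\<forall>t\<in>T. \<forall>i\<in>{1..n}. t i \<in> {max 0 (k i - 2 * \<rho>)<..<k i} \<union> {0}"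
    "\<forall>t\<in>T. (\<Sum>i\<in>{1..n}. k i * of_bool (t i \<noteq> 0)) \<le> 2 * C0 * \<delta> * real p"
    "\<forall>t\<in>T. \<forall>s\<in>T. s \<noteq> t \<longrightarrow>
        Lp_norm M p (\<lambda>\<omega>. ennreal \<bar>lin_comb {1..n} t (X \<omega>) - lin_comb {1..n} s (X \<omega>)\<bar>) \<ge> ennreal (real p / 2)"
    by (insert sf[unfolded simplified_form_def]) (elim conjE, assumption)+
  note \<rho>0 = sf'(1,3) and finT = sf'(5)
  \<comment> \<open>The numerical bound serves \<open>72240 * (4 * \<rho>) \<le> 1/12\<close> in
    \<open>moment_lt_of_parts\<close>, the exponential one the bound of the supports by
    \<open>c * p\<close>.\<close>
  have \<rho>: "\<rho> \<le> 1 / 4000000" "\<rho> \<le> exp (- (1 / (2 * c)))"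
    using rho_le[OF sf'(1-3) _ _ \<delta>_small] C0 by auto
  have k: "\<rho> \<le> k i" if "i \<in> {1..n}" for i using sf'(4) that by blast
  have tk: "t i \<in> {max 0 (k i - 2 * \<rho>)<..<k i} \<union> {0}" if "t \<in> T" "i \<in> {1..n}" for t i
    using sf'(6) that by blast
  have ksum: "(\<Sum>i\<in>{1..n}. k i * of_bool (t i \<noteq> 0)) \<le> 2 * C0 * \<delta> * real p" if "t \<in> T" for t
    using sf'(7) that by blast
  have sep: "ennreal (real p / 2) \<le> Lp_norm M p (\<lambda>\<omega>. ennreal \<bar>lin_comb {1..n} t (X \<omega>) - lin_comb {1..n} s (X \<omega>)\<bar>)"
    if "t \<in> T" "s \<in> T" "s \<noteq> t" for t s using sf'(8) that by blast
  define L where "L = ln (1 / \<rho>)"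
  have L: "1 \<le> L" "1 / (2 * c) \<le> L"
  proof -
    have "ln \<rho> \<le> ln (exp (-1))" using sf'(1,2) by (intro ln_mono) auto
    then show "1 \<le> L" using \<rho>0 by (simp add: L_def ln_div)
    have "ln \<rho> \<le> ln (exp (- (1 / (2 * c))))" using \<rho> \<rho>0 by (intro ln_mono) auto
    then show "1 / (2 * c) \<le> L" using \<rho>0 by (simp add: L_def ln_div)
  qed
  have supp: "supp n t \<subseteq> {1..n}" "finite (supp n t)" for t by (auto simp: supp_def)
  have ts: "max 0 (k i - 2 * \<rho>) < t i \<and> t i < k i" if "t \<in> T" "i \<in> supp n t" for t i
    using tk[OF that(1), of i] that(2) by (auto simp: supp_def)
  have t0: "t i = 0" if "i \<in> {1..n}" "i \<notin> supp n t" for t i using that by (auto simp: supp_def)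
  have ksum': "(\<Sum>i\<in>supp n t. k i) \<le> 2 * C0 * \<delta> * real p" if "t \<in> T" for t
  proof -
    have "(\<Sum>i\<in>supp n t. k i) = (\<Sum>i\<in>{1..n}. k i * of_bool (t i \<noteq> 0))"
      by (intro sum.mono_neutral_cong_left) (auto simp: supp_def)
    then show ?thesis using ksum[OF that] by simp
  qed
  \<comment> \<open>Each coordinate of a support uses up at least \<open>\<rho>\<close> of the
    budget \<open>2 * C0 * \<delta> * p\<close>, which equals
    \<open>\<rho> * p / (2 * L)\<close>.\<close>
  have card_supp: "real (card (supp n t)) \<le> real p / (2 * L)" if t: "t \<in> T" for t
  proof -
    have "real (card (supp n t)) * \<rho> = (\<Sum>i\<in>supp n t. \<rho>)" by simp
    also have "\<dots> \<le> (\<Sum>i\<in>supp n t. k i)" using supp k by (intro sum_mono) blast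
    also have "\<dots> \<le> 2 * C0 * \<delta> * real p" by (rule ksum'[OF t])
    also have "\<dots> = (\<rho> / L) / 2 * real p" using \<rho>0 by (simp add: L_def)
    finally have "real (card (supp n t)) * \<rho> \<le> (real p / (2 * L)) * \<rho>" by (simp add: mult_ac)
    then show ?thesis using \<rho>0(1) by (rule mult_right_le_imp_le)
  qed
  have card_half: "2 * card (supp n t) \<le> p" if t: "t \<in> T" for t
  proof -
    have "real p / (2 * L) \<le> real p / 2" using L by (intro divide_left_mono) auto
    then have "2 * real (card (supp n t)) \<le> real p" using card_supp[OF t] by linarith
    then show ?thesis by linarith
  qed
  \<comment> \<open>A shattered set is itself one of its cut-out subsets and hence lies in a single
    support.\<close>
  have v: "real v \<le> c * real p"
  proof -
    obtain D where D: "D \<subseteq> {1..n}" "shatters (supp n ` T) D" "card D = v" using vc by (auto simp: has_vc_dim_def)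
    then obtain t where t: "t \<in> T" "supp n t \<inter> D = D" unfolding shatters_def by blast
    then have "v \<le> card (supp n t)" using D supp card_mono[of "supp n t" D] by blast
    then have "real v \<le> real p / (2 * L)" using card_supp[OF t(1)] by linarith
    also have "\<dots> \<le> c * real p"
    proof -
      have "1 \<le> c * (2 * L)" using L(2) c by (simp add: field_simps)
      then have "real p * 1 \<le> real p * (c * (2 * L))" by (intro mult_left_mono) auto
      then show ?thesis using L by (simp add: field_simps)
    qed
    finally show ?thesis .
  qed

  let ?S = "far_set n M X \<rho> p k T" and ?A = "supp n" and ?a = "big_part \<rho> k"
  \<comment> \<open>With this \<open>u\<close> the norm \<open>p / Cbar\<close> of the witness
    exceeds \<open>3 * u\<close>, and \<open>r = u / 64\<close> together with a smoothing error of
    \<open>u / 64\<close> gives the \<open>u / 32\<close> of \<open>packing_bound\<close>. The final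
    constant arises as \<open>r / 4 = p / (1024 * Cbar)\<close>.\<close>
  define u r where "u = real p / (4 * Cbar)" and "r = u / 64"
  have u: "0 < u" using p Cbar by (simp add: u_def)
  have a: "0 \<le> ?a i" "?a i \<le> k i" if "i \<in> {1..n}" for i using k[OF that] \<rho>0 by (auto simp: big_part_def)
  have tol: "C0 * \<delta> * real p \<le> u / 64"
  proof -
    have "C0 * \<delta> \<le> C0 * (1 / (256 * Cbar * C0))" using \<delta> C0 by (intro mult_left_mono) auto
    also have "\<dots> = 1 / (256 * Cbar)" using C0 by simp
    finally have "C0 * \<delta> * real p \<le> 1 / (256 * Cbar) * real p" by (rule mult_right_mono) simp
    then show ?thesis by (simp add: u_def)
  qed
  have S_iff: "s \<in> ?S t \<longleftrightarrow> s \<in> T \<and> ennreal ((real p / 8) ^ p) \<le> (\<integral>\<^sup>+x. ennreal (\<bar>\<Sum>i\<in>?A t - ?A s. ?a i * x i\<bar> ^ p) \<partial>\<mu>)" for s t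
  proof -
    have "?A t - ?A s \<subseteq> {1..n}" using supp by blast
    note [measurable] = lin_measurable(1)[OF this]
    have "(\<integral>\<^sup>+x. ennreal (\<bar>\<Sum>i\<in>?A t - ?A s. ?a i * x i\<bar> ^ p) \<partial>\<mu>) = (\<integral>\<^sup>+\<omega>. ennreal \<bar>lin_comb (?A t - ?A s) ?a (X \<omega>)\<bar> ^ p \<partial>M)"
      by (subst tr) (auto simp: lin_comb_def ennreal_power)
    then show ?thesis by (simp add: far_set_def Lp_norm_ge_iff[OF p1])
  qed
  have ST: "?S t \<subseteq> T" "finite (?S t)" for t using finT by (auto simp: far_set_def)
  have pairs: "s \<in> ?S t \<or> t \<in> ?S s" if t: "t \<in> T" and s: "s \<in> T" and ne: "t \<noteq> s" for t s
  proof (rule ccontr)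
    assume "\<not> ?thesis"
    then have sm: "(\<integral>\<^sup>+x. ennreal (\<bar>\<Sum>i\<in>?A t - ?A s. ?a i * x i\<bar> ^ p) \<partial>\<mu>) \<le> ennreal ((real p / 8) ^ p)"
      "(\<integral>\<^sup>+x. ennreal (\<bar>\<Sum>i\<in>?A s - ?A t. ?a i * x i\<bar> ^ p) \<partial>\<mu>) \<le> ennreal ((real p / 8) ^ p)"
      using t s by (auto simp: S_iff)
    let ?J = "?A t \<union> ?A s" and ?g = "\<lambda>x. (\<Sum>i\<in>{1..n}. t i * x i) - (\<Sum>i\<in>{1..n}. s i * x i)"
    \<comment> \<open>These coefficients lie below \<open>k i\<close>, so contraction reduces them
      to \<open>big_part\<close>. The rest \<open>?e\<close> is at most \<open>4 * \<rho>\<close>: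
      on the common support \<open>t\<close> and \<open>s\<close> differ by less than
      \<open>2 * \<rho>\<close>, and the other remaining coordinates have
      \<open>k i \<le> 4 * \<rho>\<close>.\<close>
    define c1 c2 where "c1 = (\<lambda>i. if 4 * \<rho> < k i then t i else 0)" and "c2 = (\<lambda>i. if 4 * \<rho> < k i then s i else 0)"
    have "(\<integral>\<^sup>+x. ennreal (\<bar>?g x\<bar> ^ p) \<partial>\<mu>) < ennreal ((real p / 2) ^ p)"
    proof (rule moment_lt_of_parts[where \<eta>="4 * \<rho>" and ?J1.0="?A t - ?A s" and ?J2.0="?A s - ?A t" and J="?J" and ?c1.0=c1 and ?c2.0=c2, OF _ _ _ _ p _ _ _ _ sm])
      show "?A t - ?A s \<subseteq> {1..n}" "?A s - ?A t \<subseteq> {1..n}" "?J \<subseteq> {1..n}" using supp by blast+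
      have "card ?J \<le> card (?A t) + card (?A s)" by (rule card_Un_le)
      then show "card ?J \<le> p" using card_half[OF t] card_half[OF s] by linarith
      show "0 \<le> 4 * \<rho>" "72240 * (4 * \<rho>) \<le> 1/12" using \<rho> \<rho>0 by auto
      show "\<bar>c1 i\<bar> \<le> \<bar>?a i\<bar>" if "i \<in> ?A t - ?A s" for i
        using ts[OF t, of i] that by (auto simp: c1_def big_part_def)
      show "\<bar>c2 i\<bar> \<le> \<bar>?a i\<bar>" if "i \<in> ?A s - ?A t" for i
        using ts[OF s, of i] that by (auto simp: c2_def big_part_def)
    next
      fix x :: "nat \<Rightarrow> real"
      let ?d1 = "\<lambda>i. if i \<in> ?A t - ?A s then c1 i else 0" and ?d2 = "\<lambda>i. if i \<in> ?A s - ?A t then c2 i else 0"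
      let ?e = "\<lambda>i. t i - s i - ?d1 i + ?d2 i"
      have ext: "(\<Sum>i\<in>{1..n}. w i * x i) = (\<Sum>i\<in>?J. w i * x i)" if "\<And>i. i \<in> {1..n} \<Longrightarrow> i \<notin> ?J \<Longrightarrow> w i = 0" for w :: "nat \<Rightarrow> real"
        using that supp by (intro sum.mono_neutral_right) auto
      have P1: "(\<Sum>i\<in>?A t - ?A s. c1 i * x i) = (\<Sum>i\<in>?J. ?d1 i * x i)"
        by (intro sum.mono_neutral_cong_left) (auto simp: supp(2))
      have P2: "(\<Sum>i\<in>?A s - ?A t. c2 i * x i) = (\<Sum>i\<in>?J. ?d2 i * x i)"
        by (intro sum.mono_neutral_cong_left) (auto simp: supp(2))
      have e: "\<bar>?e i\<bar> \<le> 4 * \<rho>" if i: "i \<in> ?J" for i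
      proof -
        have iI: "i \<in> {1..n}" using i supp by blast
        consider "i \<in> ?A t" "i \<in> ?A s" | "i \<in> ?A t" "i \<notin> ?A s" | "i \<notin> ?A t" "i \<in> ?A s" using i by blast
        then show ?thesis
        proof cases
          case 1
          then have "max 0 (k i - 2 * \<rho>) < t i \<and> t i < k i" "max 0 (k i - 2 * \<rho>) < s i \<and> s i < k i" using ts t s by blast+
          then show ?thesis using 1 \<rho>0(1) by auto
        next
          case 2
          then have "max 0 (k i - 2 * \<rho>) < t i \<and> t i < k i" "s i = 0" using ts[OF t] t0[OF iI] by blast+
          then show ?thesis using 2 \<rho>0(1) by (auto simp: c1_def)
        next
          case 3
          then have "max 0 (k i - 2 * \<rho>) < s i \<and> s i < k i" "t i = 0" using ts[OF s] t0[OF iI] by blast+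
          then show ?thesis using 3 \<rho>0(1) by (auto simp: c2_def)
        qed
      qed
      have "?g x = (\<Sum>i\<in>?J. t i * x i) - (\<Sum>i\<in>?J. s i * x i)"
        using t0 by (subst (1 2) ext) auto
      also have "\<dots> = (\<Sum>i\<in>?J. ?d1 i * x i) - (\<Sum>i\<in>?J. ?d2 i * x i) + (\<Sum>i\<in>?J. ?e i * x i)"
        unfolding sum_subtractf[symmetric] sum.distrib[symmetric] by (intro sum.cong refl) (simp only: ring_distribs)
      finally have "\<bar>?g x\<bar> \<le> \<bar>\<Sum>i\<in>?J. ?d1 i * x i\<bar> + \<bar>\<Sum>i\<in>?J. ?d2 i * x i\<bar> + \<bar>\<Sum>i\<in>?J. ?e i * x i\<bar>"
        by linarith
      also have "\<bar>\<Sum>i\<in>?J. ?e i * x i\<bar> \<le> (\<Sum>i\<in>?J. 4 * \<rho> * \<bar>x i\<bar>)"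
      proof (rule order_trans[OF sum_abs sum_mono])
        fix i assume "i \<in> ?J"
        from e[OF this] show "\<bar>?e i * x i\<bar> \<le> 4 * \<rho> * \<bar>x i\<bar>"
          unfolding abs_mult by (rule mult_right_mono) simp
      qed
      finally show "\<bar>?g x\<bar> \<le> \<bar>\<Sum>i\<in>?A t - ?A s. c1 i * x i\<bar> + \<bar>\<Sum>i\<in>?A s - ?A t. c2 i * x i\<bar> + 4 * \<rho> * (\<Sum>i\<in>?J. \<bar>x i\<bar>)"
        unfolding P1 P2 by (simp add: sum_distrib_left)
    qed
    moreover have "ennreal ((real p / 2) ^ p) \<le> (\<integral>\<^sup>+x. ennreal (\<bar>?g x\<bar> ^ p) \<partial>\<mu>)"
    proof -
      note [measurable] = lin_measurable(1)[OF subset_refl]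
      have "(\<integral>\<^sup>+x. ennreal (\<bar>?g x\<bar> ^ p) \<partial>\<mu>) = (\<integral>\<^sup>+\<omega>. ennreal \<bar>lin_comb {1..n} t (X \<omega>) - lin_comb {1..n} s (X \<omega>)\<bar> ^ p \<partial>M)"
        by (subst tr) (auto simp: lin_comb_def ennreal_power)
      then show ?thesis using sep[OF t s] ne by (simp add: Lp_norm_ge_iff[OF p1])
    qed
    ultimately show False by simp
  qed
  have tail: "exp (- 4 * real p) \<le> measure \<nu> {y \<in> {1..n} \<rightarrow>\<^sub>E UNIV. \<forall>s\<in>?S t. u \<le> (\<Sum>i\<in>?A t - ?A s. ?a i * \<bar>y i\<bar>)}"
    if t: "t \<in> T" for t
  proof (cases "?S t = {}")
    \<comment> \<open>An empty far set, whose minimum is infinite, imposes no condition, so the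
      event is the whole space.\<close>
    case True
    then have eq: "{y \<in> {1..n} \<rightarrow>\<^sub>E UNIV. \<forall>s\<in>?S t. u \<le> (\<Sum>i\<in>?A t - ?A s. ?a i * \<bar>y i\<bar>)} = space \<nu>"
      unfolding space_\<nu> by blast
    show ?thesis unfolding eq \<nu>.prob_space by simp
  next
    case False
    define V where "V = (\<lambda>x :: nat \<Rightarrow> real. Min ((\<lambda>s. \<Sum>i\<in>?A t - ?A s. ?a i * \<bar>x i\<bar>) ` ?S t))"
    let ?Z = "\<lambda>\<omega>. INF s\<in>?S t. ennreal \<bar>lin_comb (?A t - ?A s) ?a (X \<omega>)\<bar>"
    have sub: "?A t - ?A s \<subseteq> {1..n}" for s using supp by blast
    have V: "V \<in> borel_measurable \<mu>"
      unfolding V_def using ST by (intro borel_measurable_Min lin_measurable sub) auto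
    show ?thesis
    proof (rule min_tail[where A="?A t"])
      show "(\<Sum>i\<in>?A t. ?a i) / 2 \<le> u"
      proof -
        have "(\<Sum>i\<in>?A t. ?a i) \<le> (\<Sum>i\<in>?A t. k i)" using a supp by (intro sum_mono) blast
        then show ?thesis using ksum'[OF t] tol u by linarith
      qed
      have "ennreal ((3 * u) ^ p) < ennreal ((real p / Cbar) ^ p)"
      proof (rule ennreal_lessI)
        show "(3 * u) ^ p < (real p / Cbar) ^ p"
          using p Cbar by (intro power_strict_mono) (auto simp: u_def field_simps)
      qed (use p Cbar in auto)
      also have "\<dots> \<le> (\<integral>\<^sup>+\<omega>. ?Z \<omega> ^ p \<partial>M)"
        using wit[OF t] Cbar by (simp add: common_witness_def Lp_norm_ge_iff[OF p1])
      \<comment> \<open>The witness speaks of signed sums, \<open>min_tail\<close> of sums of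
        absolute values; the latter dominate at the index where \<open>V\<close> attains its
        minimum.\<close>
      also have "\<dots> \<le> (\<integral>\<^sup>+\<omega>. ennreal (V (X \<omega>) ^ p) \<partial>M)"
      proof (rule nn_integral_mono)
        fix \<omega>
        have "V (X \<omega>) \<in> (\<lambda>s. \<Sum>i\<in>?A t - ?A s. ?a i * \<bar>X \<omega> i\<bar>) ` ?S t"
          unfolding V_def using ST False by (intro Min_in) auto
        then obtain s where s: "s \<in> ?S t" "V (X \<omega>) = (\<Sum>i\<in>?A t - ?A s. ?a i * \<bar>X \<omega> i\<bar>)" by blast
        have ai: "\<bar>?a i\<bar> = ?a i" if "i \<in> ?A t - ?A s" for i using a(1)[of i] sub that by (metis abs_of_nonneg subsetD)
        have "\<bar>lin_comb (?A t - ?A s) ?a (X \<omega>)\<bar> \<le> (\<Sum>i\<in>?A t - ?A s. \<bar>?a i * X \<omega> i\<bar>)"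
          unfolding lin_comb_def by (rule sum_abs)
        also have "\<dots> = V (X \<omega>)" unfolding s(2) by (intro sum.cong refl) (simp add: abs_mult ai)
        finally have le: "\<bar>lin_comb (?A t - ?A s) ?a (X \<omega>)\<bar> \<le> V (X \<omega>)" .
        then have "?Z \<omega> \<le> ennreal (V (X \<omega>))"
          using s(1) by (intro INF_lower2[of s] ennreal_leI)
        moreover have "0 \<le> V (X \<omega>)" using le by linarith
        ultimately show "?Z \<omega> ^ p \<le> ennreal (V (X \<omega>) ^ p)"
          by (simp add: ennreal_power[symmetric] power_mono)
      qed
      also have "\<dots> = (\<integral>\<^sup>+x. ennreal (V x ^ p) \<partial>\<mu>)" using V by (subst tr) auto
      finally show "ennreal ((3 * u) ^ p) < (\<integral>\<^sup>+x. ennreal (Min ((\<lambda>s. \<Sum>i\<in>?A t - ?A s. ?a i * \<bar>x i\<bar>) ` ?S t) ^ p) \<partial>\<mu>)"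
        by (simp add: V_def)
    qed (use False ST supp a(1) u p1 in auto)
  qed
  let ?\<Phi> = "\<lambda>\<omega>. SUP t\<in>T. SUP s\<in>?S t. ennreal \<bar>lin_comb (?A t - ?A s) t (X \<omega>)\<bar>"
  have "ennreal (real p / (1024 * Cbar)) \<le> (\<integral>\<^sup>+ \<omega>. ?\<Phi> \<omega> \<partial>M)"
  proof (rule ccontr)
    assume "\<not> ?thesis"
    then have lt: "(\<integral>\<^sup>+ \<omega>. ?\<Phi> \<omega> \<partial>M) < ennreal (real p / (1024 * Cbar))"
      by simp
    let ?E = "{x \<in> space \<mu>. \<forall>t\<in>T. \<forall>s\<in>?S t. \<bar>\<Sum>i\<in>?A t - ?A s. t i * x i\<bar> < r}"
    have r: "0 < r" using u by (simp add: r_def)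
    have E: "?E \<in> sets \<mu>"
    proof (intro sets.sets_Collect_finite_All finT ST)
      fix t s assume "t \<in> T" "s \<in> ?S t"
      have "?A t - ?A s \<subseteq> {1..n}" using supp by blast
      note [measurable] = lin_measurable(1)[OF this]
      show "{x \<in> space \<mu>. \<bar>\<Sum>i\<in>?A t - ?A s. t i * x i\<bar> < r} \<in> sets \<mu>" by measurable
    qed
    let ?D = "space \<mu> - ?E"
    have D: "?D \<in> sets \<mu>" using E by blast
    \<comment> \<open>Markov's inequality at the level \<open>r\<close>: an expectation below
      \<open>r / 4\<close> leaves probability at least 3/4 for all sums being below
      \<open>r\<close>.\<close>
    have "ennreal r * emeasure \<mu> ?D = (\<integral>\<^sup>+x. ennreal r * indicator ?D x \<partial>\<mu>)" using D by (simp add: nn_integral_cmult)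
    also have "\<dots> = (\<integral>\<^sup>+\<omega>. ennreal r * indicator ?D (X \<omega>) \<partial>M)" using D by (subst tr) auto
    also have "\<dots> \<le> (\<integral>\<^sup>+ \<omega>. ?\<Phi> \<omega> \<partial>M)"
    proof (rule nn_integral_mono)
      fix \<omega>
      show "ennreal r * indicator ?D (X \<omega>) \<le> ?\<Phi> \<omega>"
      proof (cases "X \<omega> \<in> ?D")
        case True
        then obtain t s where ts: "t \<in> T" "s \<in> ?S t" "r \<le> \<bar>\<Sum>i\<in>?A t - ?A s. t i * X \<omega> i\<bar>" by (auto simp: not_less)
        then have "ennreal r \<le> ennreal \<bar>lin_comb (?A t - ?A s) t (X \<omega>)\<bar>" by (simp add: lin_comb_def ennreal_leI)
        also have "\<dots> \<le> (SUP s\<in>?S t. ennreal \<bar>lin_comb (?A t - ?A s) t (X \<omega>)\<bar>)" using ts(2) by (rule SUP_upper)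
        also have "\<dots> \<le> ?\<Phi> \<omega>" using ts(1) by (rule SUP_upper)
        finally show ?thesis using True by simp
      qed simp
    qed
    also note lt
    finally have "ennreal (r * measure \<mu> ?D) < ennreal (real p / (1024 * Cbar))"
      using r by (simp add: \<mu>.emeasure_eq_measure ennreal_mult)
    then have "r * measure \<mu> ?D < real p / (1024 * Cbar)" using r by (subst (asm) ennreal_less_iff) auto
    also have "\<dots> = r * (1/4)" by (simp add: r_def u_def)
    finally have "measure \<mu> ?D < 1/4" using r by simp
    then have small: "3/4 \<le> measure \<mu> ?E" using E by (simp add: \<mu>.prob_compl)
    have "real (card T) * exp (- 4 * real p)
       \<le> real ((15 * p + 1) ^ v * 2 ^ (p + 1)) + 2 * real (card T) * (16/25) ^ (15 * p)"
    proof (rule packing_bound[where A="?A" and S="?S" and a="?a" and b="\<lambda>t. t" and u=u and r=r])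
      show "card (?A t) \<le> p" if "t \<in> T" for t using card_half[OF that] by simp
      \<comment> \<open>For \<open>k i > 4 * \<rho>\<close> the lower bound
        \<open>k i - 2 * \<rho>\<close> for \<open>t i\<close> exceeds half of \<open>k i\<close>;
        otherwise \<open>big_part\<close> is 0.\<close>
      show "?a i \<le> 2 * t i" if "t \<in> T" "i \<in> ?A t" for t i
        using ts[OF that] \<rho>0(1) by (auto simp: big_part_def)
      show "card ((\<lambda>B. B \<inter> J) ` ?A ` T) \<le> (card J + 1) ^ v" if "J \<subseteq> {1..n}" for J
        by (rule card_traces_le[OF finite_subset[OF that] that]) (use vc in \<open>auto simp: has_vc_dim_def\<close>)
      show "r + (\<Sum>i\<in>?A t. \<bar>t i\<bar>) / 2 \<le> u / 32" if t: "t \<in> T" for t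
      proof -
        have "(\<Sum>i\<in>?A t. \<bar>t i\<bar>) \<le> (\<Sum>i\<in>?A t. k i)"
        proof (rule sum_mono)
          fix i assume "i \<in> ?A t"
          from ts[OF t this] show "\<bar>t i\<bar> \<le> k i" by auto
        qed
        then show ?thesis using ksum'[OF t] tol by (simp add: r_def)
      qed
      show "3/4 \<le> measure \<mu> ?E" by (rule small)
    qed (use finT supp ST pairs a(1) tail u in auto)
    from card_bound_contradiction[OF p C N this] show False .
  qed
  then show ?thesis using v by blast
qed

text \<open>The constants are chosen before the probability space, and a quantifier inside a formula
  cannot range over types, so \<open>M\<close> lives on \<open>nat \<Rightarrow> real\<close>. Every
  law on \<open>Rn n\<close> occurs there, with the identity as \<open>X\<close>;
  \<open>minoration\<close> itself allows any sample space.\<close>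

theorem theorem5:
  shows "\<forall>C0\<ge>1::real. \<forall>Cbar>0::real. \<exists>K>0::real. \<exists>C1>0::real. \<forall>c>0::real.
    \<exists>\<delta>0>0::real. \<exists>p0::nat. \<forall>C\<ge>C1. \<forall>\<delta>>0. \<delta> \<le> \<delta>0 \<longrightarrow>
    (\<forall>p\<ge>p0. \<forall>(n::nat) (M::(nat \<Rightarrow> real) measure) (X::(nat \<Rightarrow> real) \<Rightarrow> nat \<Rightarrow> real)
        (\<rho>::real) (k::nat \<Rightarrow> real) (T::(nat \<Rightarrow> real) set) (v::nat).
      random_vector n M X \<longrightarrow> isotropic n M X \<longrightarrow> one_unconditional n M X \<longrightarrow>
      log_concave_measure n (law n M X) \<longrightarrow>
      simplified_form n M X C0 \<delta> \<rho> p k (card_exponent C v) T \<longrightarrow>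
      has_vc_dim n (supp n ` T) v \<longrightarrow>
      real (card T) \<ge> exp (card_exponent C v p) \<longrightarrow>
      (\<forall>t\<in>T. common_witness n M X Cbar \<rho> p k T t) \<longrightarrow>
      real v \<le> c * real p \<and>
      (\<integral>\<^sup>+ \<omega>. (SUP t\<in>T. SUP s\<in>far_set n M X \<rho> p k T t.
          ennreal \<bar>lin_comb (supp n t - supp n s) t (X \<omega>)\<bar>) \<partial>M) \<ge> ennreal (real p / K))"
  apply (intro allI impI)
  subgoal for C0 Cbar
    \<comment> \<open>The constant \<open>K\<close> depends on \<open>Cbar\<close> only, 12 and 4
      are absolute, and \<open>c\<close> affects only the bound on \<open>\<delta>\<close>.\<close>
    apply (rule exI[of _ "1024 * Cbar"], rule conjI, simp, rule exI[of _ 12], rule conjI, simp, intro allI impI)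
    subgoal for c
      apply (rule exI[of _ "min ((min (1 / 4000000) (exp (- (1 / (2 * c)))))\<^sup>2 / (4 * C0)) (1 / (256 * Cbar * C0))"])
      apply (rule conjI, simp add: min_def, rule exI[of _ 4], intro allI impI)
      apply (rule minoration; auto)
      done
    done
  done

end
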